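(* Let $W$ be a complex reflection group with braid group $B$ and pure braid group $P$, let $W'$ be a parabolic subgroup of $W$, and let $B'$ (resp. $P'$) be the braid group (resp. pure braid group) of $W'$. Then there is an embedding (injective group homomorphism) $B'/(P',P')\hookrightarrow B/(P,P)$, canonical up to $P^{ab}$-conjugacy; namely, it is induced by the standard embeddings $\iota:B'\hookrightarrow B$ described in the context.
   Context: A complex reflection group is a finite subgroup $W<\mathrm{GL}_n(\mathbf{C})$ generated by (pseudo-)reflections, i.e. elements $\neq 1$ fixing pointwise a hyperplane. $\mathcal{A}$ is the set of reflecting hyperplanes of $W$, and $X=\mathbf{C}^n\setminus\bigcup\mathcal{A}$. The group $W$ acts freely on $X$; $P=\pi_1(X,x_0)$ (pure braid group) and $B=\pi_1(X/W,\bar x_0)$ (braid group), so there is an exact sequence $1\to P\to B\to W\to 1$. $(P,P)$ is the commutator subgroup of $P$ and $P^{ab}=P/(P,P)\subset B/(P,P)$. A parabolic subgroup $W'$ of $W$ is the pointwise stabilizer in $W$ of a subset of $\mathbf{C}^n$; by Steinberg's theorem it is itself a reflection group, generated by the reflections of $W$ it contains, and $B',P'$ are defined from $W'$ in the same way. Standard embeddings (Broué–Malle–Rouquier): choose $v\in\mathbf{C}^n$ whose stabilizer in $W$ is $W'$, and a small open ball $\Omega$ centered at $v$ (for a $W$-invariant hermitian norm), meeting only the reflecting hyperplanes containing $v$ and with $w\Omega\cap\Omega=\emptyset$ for $w\in W\setminus W'$. Let $\tilde X'$ be the complement in $\mathbf{C}^n$ of the reflecting hyperplanes of $W'$. Inclusion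 induces isomorphisms $\pi_1(\Omega\cap X)\simeq\pi_1(\tilde X')=P'$ and $\pi_1((\Omega\cap X)/W')\simeq\pi_1(\tilde X'/W')=B'$, and the natural map $(\Omega\cap X)/W'\to X/W$ together with a path in $X$ joining the base points induces an injective morphism $\iota:B'\hookrightarrow B$ with $\iota(P')\subset P$, compatible with $W'\subset W$. These embeddings are canonical up to conjugation by elements of $P$. *)

theory Defs
  imports "HOL-Analysis.Analysis" "HOL-Algebra.Generated_Groups"
begin

section \<open>The fundamental group of an abstract topological space\<close>

text \<open>
  Orbit spaces are topologies on a type of sets, so paths are taken in a value of type
  \<open>'a topology\<close>. The library's \<open>homotopic_paths\<close> and \<open>joinpaths\<close> are only available for
  types of class \<open>topological_space\<close>. Paths are functions on all of \<open>real\<close>; since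
  \<open>homotopic_with\<close> only constrains them on \<open>{0..1}\<close>, their values elsewhere do not affect
  homotopy classes.
\<close>

definition path_homotopic :: "'a topology \<Rightarrow> (real \<Rightarrow> 'a) \<Rightarrow> (real \<Rightarrow> 'a) \<Rightarrow> bool" where
  "path_homotopic T p q \<longleftrightarrow>
     homotopic_with (\<lambda>r. r 0 = p 0 \<and> r 1 = p 1) (top_of_set {0..1}) T p q"

definition homotopy_class :: "'a topology \<Rightarrow> (real \<Rightarrow> 'a) \<Rightarrow> (real \<Rightarrow> 'a) set" where
  "homotopy_class T p = {q. path_homotopic T p q}"

definition path_concat :: "(real \<Rightarrow> 'a) \<Rightarrow> (real \<Rightarrow> 'a) \<Rightarrow> real \<Rightarrow> 'a" where
  "path_concat p q = (\<lambda>t. if t \<le> 1/2 then p (2 * t) else q (2 * t - 1))"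

definition path_reverse :: "(real \<Rightarrow> 'a) \<Rightarrow> real \<Rightarrow> 'a" where
  "path_reverse p = (\<lambda>t. p (1 - t))"

definition loop_at :: "'a topology \<Rightarrow> 'a \<Rightarrow> (real \<Rightarrow> 'a) \<Rightarrow> bool" where
  "loop_at T a p \<longleftrightarrow> pathin T p \<and> p 0 = a \<and> p 1 = a"

definition fundamental_group :: "'a topology \<Rightarrow> 'a \<Rightarrow> (real \<Rightarrow> 'a) set monoid" where
  "fundamental_group T a =
     \<lparr>carrier = {homotopy_class T p | p. loop_at T a p},
      mult = (\<lambda>c d. \<Union>p\<in>c. \<Union>q\<in>d. homotopy_class T (path_concat p q)),
      one = homotopy_class T (\<lambda>t. a)\<rparr>"

text \<open>The map on homotopy classes induced by a continuous map \<open>f\<close> into \<open>T\<close>.\<close>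

definition pi1_map :: "'b topology \<Rightarrow> ('a \<Rightarrow> 'b) \<Rightarrow> (real \<Rightarrow> 'a) set \<Rightarrow> (real \<Rightarrow> 'b) set" where
  "pi1_map T f c = (\<Union>p\<in>c. homotopy_class T (f \<circ> p))"

text \<open>
  Change of base point from \<open>g 0\<close> to \<open>g 1\<close> along a path \<open>g\<close> in \<open>T\<close>.
\<close>

definition pi1_transport :: "'a topology \<Rightarrow> (real \<Rightarrow> 'a) \<Rightarrow> (real \<Rightarrow> 'a) set \<Rightarrow> (real \<Rightarrow> 'a) set" where
  "pi1_transport T g c =
     (\<Union>p\<in>c. homotopy_class T (path_concat (path_reverse g) (path_concat p g)))"


section \<open>Orbit spaces\<close>

definition quotient_topology :: "'a topology \<Rightarrow> ('a \<Rightarrow> 'b) \<Rightarrow> 'b topology" where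
  "quotient_topology T f =
     topology (\<lambda>U. U \<subseteq> f ` topspace T \<and> openin T {x \<in> topspace T. f x \<in> U})"

lemma openin_quotient_topology:
  "openin (quotient_topology T f) U \<longleftrightarrow>
     U \<subseteq> f ` topspace T \<and> openin T {x \<in> topspace T. f x \<in> U}"
proof -
  have "istopology (\<lambda>U. U \<subseteq> f ` topspace T \<and> openin T {x \<in> topspace T. f x \<in> U})"
    unfolding istopology_def
  proof (intro conjI allI impI)
    fix S U
    assume S: "S \<subseteq> f ` topspace T \<and> openin T {x \<in> topspace T. f x \<in> S}"
      and U: "U \<subseteq> f ` topspace T \<and> openin T {x \<in> topspace T. f x \<in> U}"
    then show "S \<inter> U \<subseteq> f ` topspace T"
      by blast
    have "{x \<in> topspace T. f x \<in> S \<inter> U} =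
        {x \<in> topspace T. f x \<in> S} \<inter> {x \<in> topspace T. f x \<in> U}"
      by blast
    with S U show "openin T {x \<in> topspace T. f x \<in> S \<inter> U}"
      by (simp only: openin_Int)
  next
    fix K
    assume K: "\<forall>S\<in>K. S \<subseteq> f ` topspace T \<and> openin T {x \<in> topspace T. f x \<in> S}"
    then show "\<Union>K \<subseteq> f ` topspace T"
      by blast
    have "openin T (\<Union>S\<in>K. {x \<in> topspace T. f x \<in> S})"
      using K by (intro openin_Union) blast
    also have "(\<Union>S\<in>K. {x \<in> topspace T. f x \<in> S}) = {x \<in> topspace T. f x \<in> \<Union>K}"
      by blast
    finally show "openin T {x \<in> topspace T. f x \<in> \<Union>K}" .
  qed
  then show ?thesis
    by (simp add: quotient_topology_def)
qed

lemma topspace_quotient_topology: "topspace (quotient_topology T f) = f ` topspace T"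
proof
  show "topspace (quotient_topology T f) \<subseteq> f ` topspace T"
    using openin_topspace[of "quotient_topology T f"] by (simp only: openin_quotient_topology)
  have "{x \<in> topspace T. f x \<in> f ` topspace T} = topspace T"
    by auto
  then have "openin (quotient_topology T f) (f ` topspace T)"
    by (simp add: openin_quotient_topology)
  then show "f ` topspace T \<subseteq> topspace (quotient_topology T f)"
    by (rule openin_subset)
qed

lemma quotient_map_quotient_topology: "quotient_map T (quotient_topology T f) f"
  by (simp add: quotient_map_def topspace_quotient_topology openin_quotient_topology)

definition mat_orbit :: "(complex^'n^'n) set \<Rightarrow> complex^'n \<Rightarrow> (complex^'n) set" where
  "mat_orbit G x = (\<lambda>w. w *v x) ` G"

text \<open>The orbit space \<open>S/G\<close> of a \<open>G\<close>-stable set \<open>S\<close>; its points are the \<open>G\<close>-orbits in \<open>S\<close>.\<close>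

definition orbit_space :: "(complex^'n^'n) set \<Rightarrow> (complex^'n) set \<Rightarrow> (complex^'n) set topology" where
  "orbit_space G S = quotient_topology (top_of_set S) (mat_orbit G)"

text \<open>For \<open>H \<subseteq> G\<close>, the natural map \<open>S/H \<rightarrow> S/G\<close>: an \<open>H\<close>-orbit goes to the \<open>G\<close>-orbit containing it.\<close>

definition orbit_coarsen :: "(complex^'n^'n) set \<Rightarrow> (complex^'n) set \<Rightarrow> (complex^'n) set" where
  "orbit_coarsen G Q = (\<Union>x\<in>Q. mat_orbit G x)"


section \<open>Complex reflection groups and their parabolic subgroups\<close>

definition general_linear_group :: "(complex^'n^'n) monoid" where
  "general_linear_group = \<lparr>carrier = {A. invertible A}, mult = (**), one = mat 1\<rparr>"

definition hyperplane :: "(complex^'n) set \<Rightarrow> bool" where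
  "hyperplane H \<longleftrightarrow> vec.subspace H \<and> vec.dim H + 1 = CARD('n)"

definition is_reflection_along :: "(complex^'n) set \<Rightarrow> complex^'n^'n \<Rightarrow> bool" where
  "is_reflection_along H s \<longleftrightarrow>
     invertible s \<and> s \<noteq> mat 1 \<and> hyperplane H \<and> (\<forall>x\<in>H. s *v x = x)"

definition pseudo_reflection :: "complex^'n^'n \<Rightarrow> bool" where
  "pseudo_reflection s \<longleftrightarrow> (\<exists>H. is_reflection_along H s)"

definition complex_reflection_group :: "(complex^'n^'n) set \<Rightarrow> bool" where
  "complex_reflection_group W \<longleftrightarrow>
     finite W \<and> subgroup W general_linear_group \<and>
     generate general_linear_group {s \<in> W. pseudo_reflection s} = W"

definition parabolic_subgroup :: "(complex^'n^'n) set \<Rightarrow> (complex^'n^'n) set \<Rightarrow> bool" where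
  "parabolic_subgroup W' W \<longleftrightarrow> (\<exists>S. W' = {w \<in> W. \<forall>x\<in>S. w *v x = x})"

definition reflecting_hyperplanes :: "(complex^'n^'n) set \<Rightarrow> (complex^'n) set set" where
  "reflecting_hyperplanes W = {H. \<exists>s\<in>W. is_reflection_along H s}"

definition hyperplane_complement :: "(complex^'n^'n) set \<Rightarrow> (complex^'n) set" where
  "hyperplane_complement W = UNIV - \<Union>(reflecting_hyperplanes W)"


section \<open>Braid groups\<close>

definition pure_braid_group ::
    "(complex^'n^'n) set \<Rightarrow> complex^'n \<Rightarrow> (real \<Rightarrow> complex^'n) set monoid" where
  "pure_braid_group W x = fundamental_group (top_of_set (hyperplane_complement W)) x"

definition braid_group ::
    "(complex^'n^'n) set \<Rightarrow> complex^'n \<Rightarrow> (real \<Rightarrow> (complex^'n) set) set monoid" where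
  "braid_group W x =
     fundamental_group (orbit_space W (hyperplane_complement W)) (mat_orbit W x)"

text \<open>
  The pure braid group as a subgroup of the braid group, namely its image under the
  homomorphism \<open>P \<rightarrow> B\<close> induced by the covering \<open>X \<rightarrow> X/W\<close>.
\<close>

definition pure_braids ::
    "(complex^'n^'n) set \<Rightarrow> complex^'n \<Rightarrow> (real \<Rightarrow> (complex^'n) set) set set" where
  "pure_braids W x =
     pi1_map (orbit_space W (hyperplane_complement W)) (mat_orbit W)
       ` carrier (pure_braid_group W x)"

definition pure_commutators ::
    "(complex^'n^'n) set \<Rightarrow> complex^'n \<Rightarrow> (real \<Rightarrow> (complex^'n) set) set set" where
  "pure_commutators W x = derived (braid_group W x) (pure_braids W x)"

text \<open>The quotient \<open>B/(P,P)\<close>, and \<open>P/(P,P)\<close> as a subset of it.\<close>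

definition braid_quotient ::
    "(complex^'n^'n) set \<Rightarrow> complex^'n \<Rightarrow> (real \<Rightarrow> (complex^'n) set) set set monoid" where
  "braid_quotient W x = braid_group W x Mod pure_commutators W x"

definition braid_quotient_proj ::
    "(complex^'n^'n) set \<Rightarrow> complex^'n \<Rightarrow> (real \<Rightarrow> (complex^'n) set) set
       \<Rightarrow> (real \<Rightarrow> (complex^'n) set) set set" where
  "braid_quotient_proj W x b = pure_commutators W x #>\<^bsub>braid_group W x\<^esub> b"

definition pure_braid_ab ::
    "(complex^'n^'n) set \<Rightarrow> complex^'n \<Rightarrow> (real \<Rightarrow> (complex^'n) set) set set set" where
  "pure_braid_ab W x = braid_quotient_proj W x ` pure_braids W x"


section \<open>The standard embeddings\<close>

text \<open>Positive definite hermitian forms, linear in the first argument.\<close>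

definition hermitian_inner_product :: "(complex^'n \<Rightarrow> complex^'n \<Rightarrow> complex) \<Rightarrow> bool" where
  "hermitian_inner_product h \<longleftrightarrow>
     (\<forall>x y z. h (x + y) z = h x z + h y z) \<and>
     (\<forall>c x z. h (c *s x) z = c * h x z) \<and>
     (\<forall>x y. h y x = cnj (h x y)) \<and>
     (\<forall>x. x \<noteq> 0 \<longrightarrow> 0 < Re (h x x))"

definition hermitian_ball ::
    "(complex^'n \<Rightarrow> complex^'n \<Rightarrow> complex) \<Rightarrow> complex^'n \<Rightarrow> real \<Rightarrow> (complex^'n) set" where
  "hermitian_ball h v r = {x. sqrt (Re (h (x - v) (x - v))) < r}"

definition small_ball ::
    "(complex^'n^'n) set \<Rightarrow> (complex^'n^'n) set \<Rightarrow> (complex^'n) set \<Rightarrow> bool" where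
  "small_ball W W' \<Omega> \<longleftrightarrow>
     (\<exists>v h r. {w \<in> W. w *v v = v} = W' \<and>
        hermitian_inner_product h \<and> (\<forall>w\<in>W. \<forall>x y. h (w *v x) (w *v y) = h x y) \<and>
        0 < r \<and> \<Omega> = hermitian_ball h v r \<and>
        (\<forall>H\<in>reflecting_hyperplanes W. H \<inter> \<Omega> \<noteq> {} \<longrightarrow> v \<in> H) \<and>
        (\<forall>w\<in>W - W'. (\<lambda>x. w *v x) ` \<Omega> \<inter> \<Omega> = {}))"

text \<open>
  The braid group \<open>B'\<close> of \<open>W'\<close> is based at an arbitrary point \<open>y\<close> of the complement
  \<open>X'\<close> of the hyperplanes of \<open>W'\<close>, and \<open>B\<close> at \<open>x\<close>. For a base point \<open>z\<close> in \<open>\<Omega> \<inter> X\<close>, a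
  path \<open>d\<close> from \<open>z\<close> to \<open>y\<close> in \<open>X'\<close> and a path \<open>g\<close> from \<open>z\<close> to \<open>x\<close> in \<open>X\<close>, the embedding is
  the inverse of the isomorphism \<open>\<pi>\<^sub>1((\<Omega> \<inter> X)/W', z) \<rightarrow> \<pi>\<^sub>1(X'/W', z) \<rightarrow> \<pi>\<^sub>1(X'/W', y)\<close>
  given by inclusion and \<open>d\<close>, followed by
  \<open>\<pi>\<^sub>1((\<Omega> \<inter> X)/W', z) \<rightarrow> \<pi>\<^sub>1(X/W, z) \<rightarrow> \<pi>\<^sub>1(X/W, x)\<close> given by the natural map and \<open>g\<close>.
  The inclusion \<open>(\<Omega> \<inter> X)/W' \<rightarrow> X'/W'\<close> is the identity on \<open>W'\<close>-orbits.
\<close>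

definition local_braid_group ::
    "(complex^'n^'n) set \<Rightarrow> (complex^'n^'n) set \<Rightarrow> (complex^'n) set \<Rightarrow> complex^'n
       \<Rightarrow> (real \<Rightarrow> (complex^'n) set) set monoid" where
  "local_braid_group W W' \<Omega> z =
     fundamental_group (orbit_space W' (\<Omega> \<inter> hyperplane_complement W)) (mat_orbit W' z)"

definition local_to_parabolic ::
    "(complex^'n^'n) set \<Rightarrow> (real \<Rightarrow> complex^'n)
       \<Rightarrow> (real \<Rightarrow> (complex^'n) set) set \<Rightarrow> (real \<Rightarrow> (complex^'n) set) set" where
  "local_to_parabolic W' d =
     (let T = orbit_space W' (hyperplane_complement W')
      in pi1_transport T (mat_orbit W' \<circ> d) \<circ> pi1_map T id)"

definition local_to_global ::
    "(complex^'n^'n) set \<Rightarrow> (real \<Rightarrow> complex^'n)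
       \<Rightarrow> (real \<Rightarrow> (complex^'n) set) set \<Rightarrow> (real \<Rightarrow> (complex^'n) set) set" where
  "local_to_global W g =
     (let T = orbit_space W (hyperplane_complement W)
      in pi1_transport T (mat_orbit W \<circ> g) \<circ> pi1_map T (orbit_coarsen W))"

definition path_from_to :: "(complex^'n) set \<Rightarrow> complex^'n \<Rightarrow> complex^'n \<Rightarrow> (real \<Rightarrow> complex^'n) \<Rightarrow> bool" where
  "path_from_to S a b p \<longleftrightarrow> path p \<and> path_image p \<subseteq> S \<and> pathstart p = a \<and> pathfinish p = b"

definition standard_embedding ::
    "(complex^'n^'n) set \<Rightarrow> complex^'n \<Rightarrow> (complex^'n^'n) set \<Rightarrow> complex^'n
       \<Rightarrow> ((real \<Rightarrow> (complex^'n) set) set \<Rightarrow> (real \<Rightarrow> (complex^'n) set) set) \<Rightarrow> bool" where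
  "standard_embedding W x W' y \<iota> \<longleftrightarrow>
     (\<exists>\<Omega> z d g. small_ball W W' \<Omega> \<and> z \<in> \<Omega> \<inter> hyperplane_complement W \<and>
        path_from_to (hyperplane_complement W') z y d \<and>
        path_from_to (hyperplane_complement W) z x g \<and>
        \<iota> = local_to_global W g \<circ>
              inv_into (carrier (local_braid_group W W' \<Omega> z)) (local_to_parabolic W' d))"

text \<open>\<open>f : B'/(P',P') \<rightarrow> B/(P,P)\<close> is induced by \<open>\<iota> : B' \<rightarrow> B\<close>.\<close>

definition induced_on_quotients ::
    "(complex^'n^'n) set \<Rightarrow> complex^'n \<Rightarrow> (complex^'n^'n) set \<Rightarrow> complex^'n
       \<Rightarrow> ((real \<Rightarrow> (complex^'n) set) set \<Rightarrow> (real \<Rightarrow> (complex^'n) set) set)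
       \<Rightarrow> ((real \<Rightarrow> (complex^'n) set) set set \<Rightarrow> (real \<Rightarrow> (complex^'n) set) set set) \<Rightarrow> bool" where
  "induced_on_quotients W x W' y \<iota> f \<longleftrightarrow>
     (\<forall>b\<in>carrier (braid_group W' y).
        f (braid_quotient_proj W' y b) = braid_quotient_proj W x (\<iota> b))"

end

theory Submission
  imports Defs "HOL-Complex_Analysis.Conformal_Mappings"
begin

text \<open>
  Write \<open>X\<close> and \<open>X'\<close> for the hyperplane complements of \<open>W\<close> and \<open>W'\<close>, so that \<open>X \<subseteq> X'\<close>. A continuous
  \<open>W'\<close>-equivariant map \<open>F\<close> from \<open>X'\<close> to \<open>X\<close> induces a map of orbit spaces. With a path \<open>m\<close> in \<open>X\<close> from
  \<open>F y\<close> to \<open>x\<close> it induces a homomorphism \<open>braid_hom F m\<close> from \<open>B'\<close> to \<open>B\<close>. The radial contraction of \<open>X'\<close>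
  into a small ball around a point \<open>v\<close> with stabiliser \<open>W'\<close> is such a map. Every standard embedding
  is \<open>braid_hom\<close> of a contraction, because the contraction is an inverse of the inclusion of the ball up
  to equivariant homotopy (\<open>standard_embedding_is_braid_hom\<close>). The theorem is proved for these maps.

  Since \<open>F\<close> maps loops in \<open>X'\<close> to loops in \<open>X\<close>, pure braids go to pure braids and commutators to
  commutators, which gives the map on quotients. For its injectivity, let the image of \<open>b\<close> lie in
  \<open>(P,P)\<close>. The group \<open>W\<close> acts freely on \<open>X\<close>, so paths and homotopies in \<open>X/W\<close> lift uniquely to \<open>X\<close>. They
  show that \<open>b\<close> is represented by a loop \<open>p\<close> in \<open>X'\<close> and that \<open>F \<circ> p\<close> is a product of commutators in
  the fundamental group of \<open>X\<close>. The inclusion of \<open>X\<close> into \<open>X'\<close> turns this into a product of commutators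
  in the fundamental group of \<open>X'\<close>, where \<open>F\<close> is homotopic to the identity; so \<open>b\<close> lies in \<open>(P',P')\<close>
  (\<open>braid_hom_reflects_derived\<close>). In other words, the inclusion makes \<open>P'\<close> a retract of \<open>P\<close>.

  The points with stabiliser \<open>W'\<close> are the complement of finitely many proper complex subspaces in the
  fixed space of \<open>W'\<close>, and so they are connected by paths. Moving the centre along such a path, with a
  sufficiently small radius, joins any two contractions by an equivariant homotopy in \<open>X\<close>. Homotopic
  maps induce homomorphisms that differ by conjugation with the class of a loop in \<open>X\<close>
  (\<open>braid_hom_conjugate\<close>, \<open>conjugate_homs_retract\<close>). This is the uniqueness up to conjugation.

  Two foundations are laid first. One is that \<open>W\<close> acts freely on \<open>X\<close>, a case of Steinberg's theorem
  (\<open>reflection_group_acts_freely\<close>). It rests on the flatness of the polynomials over the invariants of a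
  reflection group, which makes them locally free. Near a point of \<open>X\<close> with nontrivial stabiliser this
  gives holomorphic functions, defined off a set of codimension two, that separate the points of an
  orbit from each other and remain bounded; in the limit two of these points coincide, a
  contradiction. The other is path lifting for orbit spaces. Orbits are
  embedded into a Banach space by their distance functions, and the orbit map becomes a covering of
  subsets of normed spaces (\<open>covering_space_orbit_embedding\<close>).
\<close>


section \<open>Complex vector spaces and finite linear groups\<close>

lemma subspace_line_unique:
  fixes K :: "(complex^'n) set"
  assumes "vec.subspace K" "a + s *s u \<in> K" "a + t *s u \<in> K" "s \<noteq> t"
  shows "a \<in> K" "u \<in> K"
proof -
  have "(a + s *s u) - (a + t *s u) \<in> K"
    using assms vec.subspace_diff by blast
  then have "(s - t) *s u \<in> K"
    by (simp add: vec.scale_left_diff_distrib)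
  then have "(1 / (s - t)) *s ((s - t) *s u) \<in> K"
    using assms(1) vec.subspace_scale by blast
  then show u: "u \<in> K"
    using assms(4) by (simp only: vector_smult_assoc) simp
  have "(a + s *s u) - s *s u \<in> K"
    using assms u vec.subspace_diff vec.subspace_scale by blast
  then show "a \<in> K" by simp
qed

lemma finite_line_meets_subspace:
  fixes K :: "(complex^'n) set"
  assumes "vec.subspace K" "\<not> (a \<in> K \<and> u \<in> K)"
  shows "finite {t. a + t *s u \<in> K}"
proof (cases "\<exists>t. a + t *s u \<in> K")
  case True
  then obtain t where t: "a + t *s u \<in> K" by blast
  have "{t. a + t *s u \<in> K} \<subseteq> {t}"
    using subspace_line_unique[OF assms(1) _ t] assms(2) by blast
  then show ?thesis using finite_subset by blast
next
  case False
  then show ?thesis by simp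
qed

lemma finite_line_meets_Union:
  fixes \<K> :: "(complex^'n) set set"
  assumes "finite \<K>" "\<And>K. K \<in> \<K> \<Longrightarrow> vec.subspace K \<and> \<not> (a \<in> K \<and> u \<in> K)"
  shows "finite {t. a + t *s u \<in> \<Union>\<K>}"
proof -
  have "{t. a + t *s u \<in> \<Union>\<K>} = (\<Union>K\<in>\<K>. {t. a + t *s u \<in> K})" by blast
  then show ?thesis
    using assms(1) finite_line_meets_subspace[where a = a and u = u] assms(2)
    by (simp only:) (rule finite_UN_I; blast)
qed

text \<open>Induction over the family. From a point of \<open>L\<close> that avoids the earlier subspaces, move in a
  direction of \<open>L\<close> outside the new one: each subspace is met for at most one parameter.\<close>

lemma subspace_avoids_finite_Union:
  fixes L :: "(complex^'n) set"
  assumes "finite \<K>" "vec.subspace L" "\<And>K. K \<in> \<K> \<Longrightarrow> vec.subspace K \<and> \<not> L \<subseteq> K"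
  obtains v where "v \<in> L" "v \<notin> \<Union>\<K>"
proof -
  have "\<exists>v\<in>L. v \<notin> \<Union>\<K>"
    using assms(1,3)
  proof (induction \<K>)
    case empty
    then show ?case using assms(2) vec.subspace_0 by auto
  next
    case (insert K \<K>)
    then obtain v where v: "v \<in> L" "v \<notin> \<Union>\<K>" by blast
    obtain u where u: "u \<in> L" "u \<notin> K" using insert.prems by blast
    have "finite {t. v + t *s u \<in> \<Union>(insert K \<K>)}"
      using insert.hyps insert.prems u v by (intro finite_line_meets_Union) auto
    then obtain t where "v + t *s u \<notin> \<Union>(insert K \<K>)"
      using ex_new_if_finite infinite_UNIV_char_0 by blast
    moreover have "v + t *s u \<in> L"
      using assms(2) u v vec.subspace_add vec.subspace_scale by blast
    ultimately show ?case by blast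
  qed
  then show ?thesis using that by blast
qed

lemma continuous_on_scalar_mult_vec [continuous_intros]:
  fixes f :: "'a::topological_space \<Rightarrow> complex" and g :: "'a \<Rightarrow> complex^'n"
  assumes "continuous_on S f" "continuous_on S g"
  shows "continuous_on S (\<lambda>x. f x *s g x)"
  unfolding vector_scalar_mult_def
  by (intro continuous_intros assms)

lemma continuous_on_matrix_vector_mult [continuous_intros]:
  fixes g :: "'a::topological_space \<Rightarrow> complex^'n"
  assumes "continuous_on S g"
  shows "continuous_on S (\<lambda>x. A *v g x)"
  unfolding matrix_vector_mult_def
  by (intro continuous_intros assms)

lemma norm_scalar_mult_vec: "norm (c *s (x::complex^'n)) = cmod c * norm x"
  by (simp add: norm_vec_def norm_mult L2_set_right_distrib)

lemma fixed_space_subspace: "vec.subspace {x. A *v x = (x::complex^'n)}"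
  by (rule vec.subspaceI) (auto simp: matrix_vector_right_distrib vector_scalar_commute)

text \<open>The complex line through two points of the set meets each subspace for at most one parameter,
  and the complex plane minus a finite set is path-connected.\<close>

lemma path_connected_subspace_minus_Union:
  fixes L :: "(complex^'n) set"
  assumes "finite \<K>" "vec.subspace L" "\<And>K. K \<in> \<K> \<Longrightarrow> vec.subspace K"
  shows "path_connected (L - \<Union>\<K>)"
  unfolding path_connected_def
proof (intro ballI)
  fix a b assume a: "a \<in> L - \<Union>\<K>" and b: "b \<in> L - \<Union>\<K>"
  define T where "T = {t. a + t *s (b - a) \<in> \<Union>\<K>}"
  have "finite T"
    unfolding T_def using assms a by (intro finite_line_meets_Union) auto
  then have "path_connected (- T)"
    by (intro path_connected_complement_countable) (auto simp: countable_finite)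
  moreover have "0 \<in> - T" "1 \<in> - T"
    using a b by (auto simp: T_def)
  ultimately obtain c where c: "path c" "path_image c \<subseteq> - T" "pathstart c = 0" "pathfinish c = 1"
    unfolding path_connected_def by blast
  let ?g = "\<lambda>s. a + c s *s (b - a)"
  have "path ?g"
    using c(1) unfolding path_def by (intro continuous_intros)
  moreover have "path_image ?g \<subseteq> L - \<Union>\<K>"
  proof -
    have "?g s \<in> L - \<Union>\<K>" if "s \<in> {0..1}" for s
    proof -
      have "c s \<notin> T" using c(2) that unfolding path_image_def by blast
      moreover have "?g s \<in> L"
        using a b assms(2) vec.subspace_add vec.subspace_scale vec.subspace_diff by blast
      ultimately show ?thesis by (auto simp: T_def)
    qed
    then show ?thesis by (auto simp: path_image_def)
  qed
  moreover have "pathstart ?g = a" "pathfinish ?g = b"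
    using c by (auto simp: pathstart_def pathfinish_def)
  ultimately show "\<exists>g. path g \<and> path_image g \<subseteq> L - \<Union>\<K> \<and> pathstart g = a \<and> pathfinish g = b"
    by blast
qed

locale finite_matrix_group =
  fixes G :: "(complex^'n^'n) set"
  assumes finite_G: "finite G"
    and one_in: "mat 1 \<in> G"
    and mult_in: "\<lbrakk>g \<in> G; h \<in> G\<rbrakk> \<Longrightarrow> g ** h \<in> G"
    and inv_in: "g \<in> G \<Longrightarrow> \<exists>h\<in>G. h ** g = mat 1 \<and> g ** h = mat 1"
begin

lemma cancel_right: "\<lbrakk>g \<in> G; a ** g = b ** g\<rbrakk> \<Longrightarrow> a = b"
  by (metis inv_in matrix_mul_assoc matrix_mul_rid)

lemma right_mult_bij: "h \<in> G \<Longrightarrow> bij_betw (\<lambda>g. g ** h) G G"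
proof -
  assume h: "h \<in> G"
  have inj: "inj_on (\<lambda>g. g ** h) G" using cancel_right h by (auto intro: inj_onI)
  moreover have "(\<lambda>g. g ** h) ` G = G"
    using h mult_in by (intro card_seteq finite_G) (auto simp: card_image inj)
  ultimately show ?thesis by (simp add: bij_betw_def)
qed

lemma sum_right_translate: "h \<in> G \<Longrightarrow> (\<Sum>g\<in>G. f (g ** h)) = (\<Sum>g\<in>G. f g)"
  using sum.reindex_bij_betw[OF right_mult_bij] by blast

lemma prod_right_translate: "h \<in> G \<Longrightarrow> (\<Prod>g\<in>G. f (g ** h)) = (\<Prod>g\<in>G. f g)"
  using prod.reindex_bij_betw[OF right_mult_bij] by blast

end

lemma group_general_linear_group: "group (general_linear_group :: (complex^'n^'n) monoid)"
proof (rule groupI)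
  fix x :: "complex^'n^'n" assume "x \<in> carrier general_linear_group"
  then obtain y where "x ** y = mat 1" "y ** x = mat 1"
    by (auto simp: general_linear_group_def invertible_def)
  then show "\<exists>y\<in>carrier general_linear_group. y \<otimes>\<^bsub>general_linear_group\<^esub> x = \<one>\<^bsub>general_linear_group\<^esub>"
    by (auto simp: general_linear_group_def invertible_def)
next
  show "\<one>\<^bsub>general_linear_group\<^esub> \<in> carrier (general_linear_group :: (complex^'n^'n) monoid)"
    by (auto simp: general_linear_group_def invertible_def intro: exI[of _ "mat 1"])
qed (simp_all add: general_linear_group_def matrix_mul_assoc invertible_mult)

lemma finite_matrix_group_if_subgroup:
  assumes "finite G" "subgroup G general_linear_group"
  shows "finite_matrix_group G"
proof -
  interpret GL: group "general_linear_group :: (complex^'n^'n) monoid"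
    by (rule group_general_linear_group)
  show ?thesis
  proof
    show "finite G" by fact
    show "mat 1 \<in> G"
      using subgroup.one_closed[OF assms(2)] by (simp add: general_linear_group_def)
    show "g ** h \<in> G" if "g \<in> G" "h \<in> G" for g h
      using subgroup.m_closed[OF assms(2) that] by (simp add: general_linear_group_def)
    show "\<exists>h\<in>G. h ** g = mat 1 \<and> g ** h = mat 1" if "g \<in> G" for g
    proof
      have c: "g \<in> carrier general_linear_group" using subgroup.subset[OF assms(2)] that by blast
      show "inv\<^bsub>general_linear_group\<^esub> g \<in> G"
        using subgroup.m_inv_closed[OF assms(2) that] .
      show "inv\<^bsub>general_linear_group\<^esub> g ** g = mat 1 \<and> g ** inv\<^bsub>general_linear_group\<^esub> g = mat 1"
        using GL.l_inv[OF c] GL.r_inv[OF c] by (simp add: general_linear_group_def)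
    qed
  qed
qed

lemma finite_matrix_group_if_reflection_group:
  "complex_reflection_group W \<Longrightarrow> finite_matrix_group W"
  by (simp add: complex_reflection_group_def finite_matrix_group_if_subgroup)

section \<open>Reflections\<close>

text \<open>A reflection differs from the identity by a map of rank one. The linear form \<open>c\<close> has kernel \<open>H\<close>
  and is normalised at a vector \<open>u\<close> outside \<open>H\<close>; the vector \<open>k = u - s u\<close> spans the image of \<open>1 - s\<close>.\<close>

lemma reflection_coordinate:
  fixes s :: "complex^'n^'n"
  assumes "is_reflection_along H s"
  obtains c k u where "\<And>x. x - s *v x = (\<Sum>i\<in>UNIV. c $ i * x $ i) *s k"
    "(\<Sum>i\<in>UNIV. c $ i * u $ i) = 1"
    "H = {x. (\<Sum>i\<in>UNIV. c $ i * x $ i) = 0}" "k \<noteq> 0"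
proof -
  have H: "vec.subspace H" "vec.dim H + 1 = CARD('n)" and fixH: "\<And>x. x \<in> H \<Longrightarrow> s *v x = x"
    and s1: "s \<noteq> mat 1"
    using assms by (auto simp: is_reflection_along_def hyperplane_def)
  have "H \<noteq> UNIV" using H(2) by (auto simp: card_cart_basis)
  then obtain u where u: "u \<notin> H" by blast
  have span_H: "vec.span H = H" using H(1) by (simp add: vec.span_eq_iff)
  have "vec.dim (insert u H) = CARD('n)"
    using u H(2) by (simp add: vec.dim_insert span_H)
  then have "vec.span (insert u H) = UNIV"
    using vec.dim_eq_full[of "insert u H"] by (simp add: card_cart_basis vec.dimension_def)
  then have ex: "\<exists>t. x - t *s u \<in> H" for x
    using vec.span_breakdown_eq[of x u H] span_H by auto
  have uniq: "t = t'" if "x - t *s u \<in> H" "x - t' *s u \<in> H" for x t t'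
  proof (rule ccontr)
    assume "t \<noteq> t'"
    moreover have "x + (- t) *s u \<in> H" "x + (- t') *s u \<in> H"
      using that by (simp_all add: vec.scale_minus_left)
    ultimately have "u \<in> H" using subspace_line_unique(2)[OF H(1), of x "- t" u "- t'"] by simp
    then show False using u by simp
  qed
  define f where "f x = (THE t. x - t *s u \<in> H)" for x
  have f: "x - f x *s u \<in> H" for x
  proof -
    obtain t where t: "x - t *s u \<in> H" using ex by blast
    show ?thesis unfolding f_def by (rule theI[of _ t]) (use t uniq in blast)+
  qed
  have f_eq: "f x = t" if "x - t *s u \<in> H" for x t
    using uniq f that by blast
  have f_add: "f (x + y) = f x + f y" for x y
  proof (rule f_eq)
    have "(x - f x *s u) + (y - f y *s u) \<in> H" using f H(1) vec.subspace_add by blast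
    then show "x + y - (f x + f y) *s u \<in> H" by (simp add: algebra_simps vector_sadd_rdistrib)
  qed
  have f_scale: "f (t *s x) = t * f x" for t x
  proof (rule f_eq)
    have "t *s (x - f x *s u) \<in> H" using f H(1) vec.subspace_scale by blast
    then show "t *s x - (t * f x) *s u \<in> H"
      by (simp add: vector_ssub_ldistrib vector_smult_assoc)
  qed
  define c where "c = (\<chi> i. f (axis i 1))"
  have f_sum: "f (\<Sum>i\<in>A. g i) = (\<Sum>i\<in>A. f (g i))" if "finite A" for A and g :: "'n \<Rightarrow> complex^'n"
    using that
  proof (induction A)
    case empty
    show ?case using f_eq[of 0 0] H(1) vec.subspace_0 by auto
  qed (simp add: f_add)
  have f_c: "f x = (\<Sum>i\<in>UNIV. c $ i * x $ i)" for x
  proof -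
    have "f x = f (\<Sum>i\<in>UNIV. x $ i *s axis i 1)" by (simp add: basis_expansion)
    also have "\<dots> = (\<Sum>i\<in>UNIV. x $ i * f (axis i 1))" by (simp add: f_sum f_scale)
    finally show ?thesis by (simp add: c_def mult.commute)
  qed
  define k where "k = u - s *v u"
  have k: "x - s *v x = f x *s k" for x
  proof -
    have "s *v (x - f x *s u) = x - f x *s u" using f fixH by blast
    then have "s *v x - f x *s (s *v u) = x - f x *s u"
      by (simp add: matrix_vector_mult_diff_distrib vector_scalar_commute)
    then show ?thesis by (simp add: k_def vector_ssub_ldistrib algebra_simps)
  qed
  have "k \<noteq> 0"
  proof
    assume "k = 0"
    then have "s *v x = mat 1 *v x" for x using k[of x] by simp
    then show False using s1 by (metis matrix_eq)
  qed
  moreover have "f u = 1" using f_eq[of u 1] H(1) vec.subspace_0 by auto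
  moreover have "H = {x. f x = 0}"
  proof (intro equalityI subsetI CollectI)
    show "f x = 0" if "x \<in> H" for x using f_eq[of x 0] that by simp
    show "x \<in> H" if "x \<in> {x. f x = 0}" for x using f[of x] that by simp
  qed
  ultimately show ?thesis using that[of c k u] k unfolding f_c by blast
qed

lemma reflection_fixes_iff:
  assumes "is_reflection_along H s"
  shows "s *v x = x \<longleftrightarrow> x \<in> H"
proof -
  obtain c k u where *: "\<And>x. x - s *v x = (\<Sum>i\<in>UNIV. c $ i * x $ i) *s k"
    "H = {x. (\<Sum>i\<in>UNIV. c $ i * x $ i) = 0}" "k \<noteq> 0"
    using reflection_coordinate[OF assms] by blast
  have "s *v x = x \<longleftrightarrow> x - s *v x = 0" by auto
  then show ?thesis using * by (simp add: vector_mul_eq_0)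
qed


section \<open>Polynomial functions\<close>

text \<open>Polynomial functions of total degree at most \<open>d\<close>. The bound, rather than the exact degree, is
  what an induction can descend on.\<close>

inductive poly_deg :: "nat \<Rightarrow> (complex^'n \<Rightarrow> complex) \<Rightarrow> bool" where
  const: "poly_deg 0 (\<lambda>x. c)"
| coord: "poly_deg d f \<Longrightarrow> poly_deg (Suc d) (\<lambda>x. x $ i * f x)"
| add: "poly_deg d f \<Longrightarrow> poly_deg d g \<Longrightarrow> poly_deg d (\<lambda>x. f x + g x)"
| Suc: "poly_deg d f \<Longrightarrow> poly_deg (Suc d) f"

definition polyfn :: "(complex^'n \<Rightarrow> complex) \<Rightarrow> bool" where
  "polyfn f \<longleftrightarrow> (\<exists>d. poly_deg d f)"

lemma poly_deg_mono: "poly_deg d f \<Longrightarrow> d \<le> e \<Longrightarrow> poly_deg e f"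
  by (induction e) (auto simp: le_Suc_eq intro: poly_deg.Suc)

lemma poly_deg_const: "poly_deg d (\<lambda>x. c)"
  by (rule poly_deg_mono[OF poly_deg.const]) simp

lemma poly_deg_0_const: "poly_deg d f \<Longrightarrow> d = 0 \<Longrightarrow> \<exists>c. f = (\<lambda>x. c)"
  by (induction rule: poly_deg.induct) auto

lemma poly_deg_cmult: "poly_deg d f \<Longrightarrow> poly_deg d (\<lambda>x. c * f x)"
proof (induction rule: poly_deg.induct)
  case (const c')
  then show ?case by (rule poly_deg_const)
next
  case (coord d f i)
  from poly_deg.coord[OF coord.IH, of i] show ?case by (simp add: mult_ac)
next
  case (add d f g)
  from poly_deg.add[OF add.IH] show ?case by (simp add: distrib_left)
qed (rule poly_deg.Suc)

lemma poly_deg_sum: "finite A \<Longrightarrow> (\<And>a. a \<in> A \<Longrightarrow> poly_deg d (f a)) \<Longrightarrow> poly_deg d (\<lambda>x. \<Sum>a\<in>A. f a x)"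
proof (induction A rule: finite_induct)
  case empty
  then show ?case by (simp add: poly_deg_const)
next
  case (insert a A)
  then show ?case using poly_deg.add[of d "f a" "\<lambda>x. \<Sum>a\<in>A. f a x"] by simp
qed

lemma poly_deg_linear_mult:
  assumes "poly_deg d f"
  shows "poly_deg (Suc d) (\<lambda>x. (\<Sum>i\<in>UNIV. c $ i * x $ i) * f x)"
proof -
  have "poly_deg (Suc d) (\<lambda>x. \<Sum>i\<in>UNIV. c $ i * (x $ i * f x))"
    by (intro poly_deg_sum poly_deg_cmult poly_deg.coord assms finite)
  then show ?thesis by (simp add: sum_distrib_right mult.assoc)
qed

lemma poly_deg_matrix:
  fixes A :: "complex^'n^'n"
  shows "poly_deg d f \<Longrightarrow> poly_deg d (\<lambda>x. f (A *v x))"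
proof (induction rule: poly_deg.induct)
  case (const c)
  then show ?case by (rule poly_deg.const)
next
  case (coord d f i)
  from poly_deg_linear_mult[OF coord.IH, of "A $ i"]
  show ?case by (simp add: matrix_vector_mult_def)
next
  case (add d f g)
  from poly_deg.add[OF add.IH] show ?case .
qed (rule poly_deg.Suc)

lemma poly_deg_mult: "poly_deg d f \<Longrightarrow> poly_deg e g \<Longrightarrow> poly_deg (d + e) (\<lambda>x. f x * g x)"
proof (induction rule: poly_deg.induct)
  case (const c)
  then show ?case by (simp add: poly_deg_cmult)
next
  case (coord d f i)
  from poly_deg.coord[OF coord.IH[OF coord.prems], of i] show ?case by (simp add: mult_ac)
next
  case (add d f g)
  from poly_deg.add[OF add.IH(1)[OF add.prems] add.IH(2)[OF add.prems]]
  show ?case by (simp add: distrib_right)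
next
  case (Suc d f)
  then show ?case by (simp add: poly_deg.Suc)
qed

lemma polyfn_const: "polyfn (\<lambda>x. c)"
  using poly_deg_const polyfn_def by blast

lemma polyfn_add: "polyfn f \<Longrightarrow> polyfn g \<Longrightarrow> polyfn (\<lambda>x. f x + g x)"
proof -
  assume "polyfn f" "polyfn g"
  then obtain d e where "poly_deg d f" "poly_deg e g" using polyfn_def by metis
  then have "poly_deg (max d e) f" "poly_deg (max d e) g" by (auto elim: poly_deg_mono)
  then have "poly_deg (max d e) (\<lambda>x. f x + g x)" by (rule poly_deg.add)
  then show ?thesis using polyfn_def by blast
qed

lemma polyfn_mult: "polyfn f \<Longrightarrow> polyfn g \<Longrightarrow> polyfn (\<lambda>x. f x * g x)"
  unfolding polyfn_def using poly_deg_mult by blast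

lemma polyfn_uminus: "polyfn f \<Longrightarrow> polyfn (\<lambda>x. - f x)"
  using polyfn_mult[OF polyfn_const[of "-1"]] by simp

lemma polyfn_diff: "polyfn f \<Longrightarrow> polyfn g \<Longrightarrow> polyfn (\<lambda>x. f x - g x)"
  using polyfn_add[OF _ polyfn_uminus, of f g] by simp

lemma polyfn_coord: "polyfn (\<lambda>x. x $ i)"
  using poly_deg.coord[OF poly_deg.const[of 1], of i] polyfn_def by fastforce

lemma polyfn_sum: "(\<And>a. a \<in> A \<Longrightarrow> polyfn (f a)) \<Longrightarrow> polyfn (\<lambda>x. \<Sum>a\<in>A. f a x)"
proof (induction A rule: infinite_finite_induct)
  case (insert a A)
  have "polyfn (f a)" "polyfn (\<lambda>x. \<Sum>a\<in>A. f a x)"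
    by (simp add: insert.prems) (rule insert.IH, simp add: insert.prems)
  from polyfn_add[OF this] show ?case using insert.hyps by simp
qed (simp_all add: polyfn_const)

lemma polyfn_prod: "(\<And>a. a \<in> A \<Longrightarrow> polyfn (f a)) \<Longrightarrow> polyfn (\<lambda>x. \<Prod>a\<in>A. f a x)"
proof (induction A rule: infinite_finite_induct)
  case (insert a A)
  have "polyfn (f a)" "polyfn (\<lambda>x. \<Prod>a\<in>A. f a x)"
    by (simp add: insert.prems) (rule insert.IH, simp add: insert.prems)
  from polyfn_mult[OF this] show ?case using insert.hyps by simp
qed (simp_all add: polyfn_const)

lemma polyfn_power: "polyfn f \<Longrightarrow> polyfn (\<lambda>x. f x ^ k)"
  by (induction k) (simp_all add: polyfn_const polyfn_mult)

lemma polyfn_matrix: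
  fixes A :: "complex^'n^'n"
  shows "polyfn f \<Longrightarrow> polyfn (\<lambda>x. f (A *v x))"
proof -
  assume "polyfn f"
  then obtain d where "poly_deg d f" using polyfn_def by blast
  then have "poly_deg d (\<lambda>x. f (A *v x))" by (rule poly_deg_matrix)
  then show ?thesis using polyfn_def by blast
qed

lemmas polyfn_intros =
  polyfn_const polyfn_add polyfn_mult polyfn_uminus polyfn_diff polyfn_coord polyfn_sum
  polyfn_prod polyfn_power

lemma polyfn_continuous:
  assumes "polyfn f" "continuous_on S g"
  shows "continuous_on S (\<lambda>x. f (g x))"
proof -
  obtain d where "poly_deg d f" using assms(1) polyfn_def by blast
  then show ?thesis
    by (induction rule: poly_deg.induct) (auto intro!: continuous_intros assms(2))
qed

lemma polyfn_line_holomorphic: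
  assumes "polyfn f"
  shows "(\<lambda>t. f (a + t *s u)) holomorphic_on S"
proof -
  obtain d where "poly_deg d f" using assms polyfn_def by blast
  then show ?thesis
    by (induction rule: poly_deg.induct) (auto intro!: holomorphic_intros)
qed

text \<open>A polynomial function is determined by its values near one point, as it is entire on
  every complex line through that point.\<close>

lemma polyfn_eq_0_if_locally_0:
  assumes f: "polyfn f" and ev: "eventually (\<lambda>y. f y = 0) (nhds x)"
  shows "f y = 0"
proof -
  let ?g = "\<lambda>t. x + t *s (y - x)"
  obtain V where V: "open V" "x \<in> V" "\<And>y. y \<in> V \<Longrightarrow> f y = 0"
    using ev by (auto simp: eventually_nhds)
  have "continuous_on UNIV ?g" by (intro continuous_intros)
  then have "open (?g -` V)" using V(1) by (rule open_vimage[rotated])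
  then obtain U where U: "open U" "0 \<in> U" "\<And>t. t \<in> U \<Longrightarrow> f (?g t) = 0"
    using V that[of "?g -` V"] by simp
  have "f (?g 1) = 0"
    by (rule analytic_continuation[OF polyfn_line_holomorphic[OF f], of UNIV U 0])
      (use U islimpt_UNIV open_imp_islimpt in auto)
  then show ?thesis by simp
qed

text \<open>The difference \<open>f - f \<circ> s\<close> vanishes on the hyperplane of \<open>s\<close>, hence is divisible by its linear
  form. At \<open>d = 0\<close> the truncated \<open>d - 1\<close> is \<open>0\<close>, and the quotient is zero because constants are
  fixed by \<open>s\<close>.\<close>

lemma reflection_difference_quotient:
  fixes s :: "complex^'n^'n"
  assumes s: "\<And>x. x - s *v x = (\<Sum>i\<in>UNIV. c $ i * x $ i) *s k"
    and "poly_deg d f"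
  shows "\<exists>h. poly_deg (d - 1) h \<and> (d = 0 \<longrightarrow> h = (\<lambda>x. 0)) \<and>
    (\<forall>x. f x - f (s *v x) = (\<Sum>i\<in>UNIV. c $ i * x $ i) * h x)"
  using assms(2)
proof (induction rule: poly_deg.induct)
  case (const a)
  then show ?case by (intro exI[of _ "\<lambda>x. 0"]) (auto intro: poly_deg.const)
next
  case (coord d f i)
  then obtain h where h: "poly_deg (d - 1) h" "d = 0 \<longrightarrow> h = (\<lambda>x. 0)"
    "\<And>x. f x - f (s *v x) = (\<Sum>i\<in>UNIV. c $ i * x $ i) * h x" by auto
  let ?h = "\<lambda>x. x $ i * h x + k $ i * f (s *v x)"
  have *: "poly_deg d (\<lambda>x. x $ i * h x)"
  proof (cases d)
    case 0
    then show ?thesis using h by (simp add: poly_deg.const)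
  next
    case (Suc d')
    then show ?thesis using h poly_deg.coord by simp
  qed
  have "poly_deg d ?h"
    by (intro poly_deg.add poly_deg_cmult poly_deg_matrix coord.hyps *)
  moreover have "x $ i * f x - (s *v x) $ i * f (s *v x) = (\<Sum>i\<in>UNIV. c $ i * x $ i) * ?h x" for x
  proof -
    have "x $ i - (s *v x) $ i = (\<Sum>i\<in>UNIV. c $ i * x $ i) * k $ i"
      using arg_cong[OF s[of x], of "\<lambda>v. v $ i"] by simp
    moreover have "x $ i * f x - (s *v x) $ i * f (s *v x) =
        x $ i * (f x - f (s *v x)) + (x $ i - (s *v x) $ i) * f (s *v x)"
      by (simp add: algebra_simps)
    ultimately show ?thesis using h(3)[of x] by (simp add: algebra_simps)
  qed
  ultimately show ?case by (intro exI[of _ ?h]) simp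
next
  case (add d f g)
  then obtain h h' where "poly_deg (d - 1) h" "d = 0 \<longrightarrow> h = (\<lambda>x. 0)"
    "\<And>x. f x - f (s *v x) = (\<Sum>i\<in>UNIV. c $ i * x $ i) * h x"
    and "poly_deg (d - 1) h'" "d = 0 \<longrightarrow> h' = (\<lambda>x. 0)"
    "\<And>x. g x - g (s *v x) = (\<Sum>i\<in>UNIV. c $ i * x $ i) * h' x" by auto
  then show ?case
    by (intro exI[of _ "\<lambda>x. h x + h' x"])
      (auto intro: poly_deg.add simp: distrib_left add_diff_add)
next
  case (Suc d f)
  then obtain h where h: "poly_deg (d - 1) h"
    "\<forall>x. f x - f (s *v x) = (\<Sum>i\<in>UNIV. c $ i * x $ i) * h x" by auto
  moreover have "poly_deg d h" using h(1) by (rule poly_deg_mono) simp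
  ultimately show ?case by (intro exI[of _ h]) simp
qed

lemma linear_form_line:
  fixes c :: "complex^'n"
  shows "(\<Sum>i\<in>UNIV. c $ i * (a + t *s u) $ i) = (\<Sum>i\<in>UNIV. c $ i * a $ i) + t * (\<Sum>i\<in>UNIV. c $ i * u $ i)"
  by (simp add: distrib_left sum.distrib sum_distrib_left mult.left_commute)

text \<open>On a line in the direction \<open>u\<close> the linear form is, up to a shift, the parameter itself. So \<open>f\<close>
  vanishes there except perhaps at one parameter, hence everywhere.\<close>

lemma polyfn_eq_0_off_hyperplane:
  assumes "polyfn f" "\<And>x. (\<Sum>i\<in>UNIV. c $ i * x $ i) * f x = 0" "(\<Sum>i\<in>UNIV. c $ i * u $ i) = 1"
  shows "f x = 0"
proof -
  let ?l = "\<lambda>x. \<Sum>i\<in>UNIV. c $ i * x $ i"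
  let ?g = "\<lambda>t. f ((x + (- ?l x) *s u) + t *s u)"
  have lin: "?l ((x + (- ?l x) *s u) + t *s u) = t" for t
    unfolding linear_form_line using assms(3) by simp
  have z: "?g t = 0" if "t \<noteq> 0" for t
    using assms(2)[of "(x + (- ?l x) *s u) + t *s u"] that unfolding lin by simp
  have lim: "(0::complex) islimpt - {0}"
    using islimpt_UNIV[of "0::complex"] unfolding islimpt_punctured[of 0 UNIV] Compl_eq_Diff_UNIV .
  have "?g (?l x) = 0"
    by (rule analytic_continuation[OF polyfn_line_holomorphic[OF assms(1)], of UNIV "- {0}" 0])
      (use z lim in auto)
  then show ?thesis by (simp add: vec.scale_minus_left)
qed

section \<open>Invariants and the module of polynomials over them\<close>

context finite_matrix_group
begin

definition invariant :: "(complex^'n \<Rightarrow> complex) \<Rightarrow> bool" where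
  "invariant f \<longleftrightarrow> polyfn f \<and> (\<forall>g\<in>G. \<forall>x. f (g *v x) = f x)"

lemma invariant_polyfn: "invariant f \<Longrightarrow> polyfn f"
  by (simp add: invariant_def)

lemma invariant_translate: "invariant f \<Longrightarrow> g \<in> G \<Longrightarrow> f (g *v x) = f x"
  by (simp add: invariant_def)

lemma invariant_intros:
  "invariant (\<lambda>x. c)"
  "invariant a \<Longrightarrow> invariant b \<Longrightarrow> invariant (\<lambda>x. a x + b x)"
  "invariant a \<Longrightarrow> invariant b \<Longrightarrow> invariant (\<lambda>x. a x * b x)"
  "invariant a \<Longrightarrow> invariant b \<Longrightarrow> invariant (\<lambda>x. a x - b x)"
  by (auto simp: invariant_def intro!: polyfn_intros)

lemma invariant_average:
  assumes "polyfn f"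
  shows "invariant (\<lambda>x. \<Sum>g\<in>G. f (g *v x))"
  unfolding invariant_def
proof (intro conjI ballI allI)
  show "polyfn (\<lambda>x. \<Sum>g\<in>G. f (g *v x))"
    by (intro polyfn_sum polyfn_matrix assms)
  fix h x assume "h \<in> G"
  then show "(\<Sum>g\<in>G. f (g *v (h *v x))) = (\<Sum>g\<in>G. f (g *v x))"
    using sum_right_translate[of h "\<lambda>g. f (g *v x)"] by (simp add: matrix_vector_mul_assoc)
qed

text \<open>
  The polynomial combinations of those relations \<open>\<Sum>i\<in>I. a i * r i = 0\<close> whose entries \<open>r i\<close> are
  invariant.\<close>

inductive syzygy_span :: "'i set \<Rightarrow> ('i \<Rightarrow> complex^'n \<Rightarrow> complex) \<Rightarrow> ('i \<Rightarrow> complex^'n \<Rightarrow> complex) \<Rightarrow> bool"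
  for I a where
  base: "\<lbrakk>\<And>i. i \<in> I \<Longrightarrow> invariant (r i); \<And>x. (\<Sum>i\<in>I. a i x * r i x) = 0; polyfn h;
      \<And>i x. i \<in> I \<Longrightarrow> f i x = r i x * h x\<rbrakk> \<Longrightarrow> syzygy_span I a f"
| add: "\<lbrakk>syzygy_span I a f; syzygy_span I a g; \<And>i x. i \<in> I \<Longrightarrow> k i x = f i x + g i x\<rbrakk>
    \<Longrightarrow> syzygy_span I a k"

lemma syzygy_span_zero: "syzygy_span I a (\<lambda>i x. 0)"
  by (rule syzygy_span.base[where r = "\<lambda>i x. 0" and h = "\<lambda>x. 0"])
    (simp_all add: invariant_intros polyfn_const)

lemma syzygy_span_cong:
  assumes "syzygy_span I a f" "\<And>i x. i \<in> I \<Longrightarrow> g i x = f i x"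
  shows "syzygy_span I a g"
  by (rule syzygy_span.add[OF assms(1) syzygy_span_zero]) (simp add: assms(2))

lemma syzygy_span_cmult:
  assumes "syzygy_span I a f" "polyfn p"
  shows "syzygy_span I a (\<lambda>i x. p x * f i x)"
  using assms(1)
proof (induction rule: syzygy_span.induct)
  case (base r h f)
  then show ?case
    by (intro syzygy_span.base[where r = r and h = "\<lambda>x. p x * h x"])
      (auto intro: polyfn_mult assms(2))
next
  case (add f g k)
  from add.IH show ?case
    by (rule syzygy_span.add) (auto simp: add.hyps distrib_left)
qed

lemma syzygy_span_translate:
  assumes "syzygy_span I a f" "g \<in> G"
  shows "syzygy_span I a (\<lambda>i x. f i (g *v x))"
  using assms(1)
proof (induction rule: syzygy_span.induct)
  case (base r h f)
  then show ?case
    by (intro syzygy_span.base[where r = r and h = "\<lambda>x. h (g *v x)"])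
      (auto intro: polyfn_matrix simp: invariant_translate assms(2))
next
  case (add f f' k)
  from add.IH show ?case
    by (rule syzygy_span.add) (auto simp: add.hyps)
qed

lemma syzygy_span_sum:
  assumes "\<And>j. j \<in> J \<Longrightarrow> syzygy_span I a (f j)"
  shows "syzygy_span I a (\<lambda>i x. \<Sum>j\<in>J. f j i x)"
  using assms
proof (induction J rule: infinite_finite_induct)
  case (insert j J)
  then have "syzygy_span I a (f j)" "syzygy_span I a (\<lambda>i x. \<Sum>j\<in>J. f j i x)" by simp_all
  then show ?case by (rule syzygy_span.add) (simp add: insert.hyps)
qed (simp_all add: syzygy_span_zero)

end

text \<open>
  This is the equational form of the statement that the polynomials are flat over the invariants
  of a reflection group. The argument is Chevalley's. Since the \<open>a i\<close> are invariant, the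
  difference quotients along a reflection \<open>s\<close> of the entries of a relation \<open>f\<close> again form a
  relation, of smaller degree, and by induction \<open>f - f \<circ> s\<close> lies in the span. Reflections generate
  \<open>W\<close>, so \<open>f\<close> is congruent modulo the span to its average over \<open>W\<close>, and the average has invariant
  entries.\<close>

lemma syzygies_spanned_by_invariant_syzygies:
  fixes W :: "(complex^'n^'n) set"
  assumes W: "complex_reflection_group W"
    and "\<And>i. i \<in> I \<Longrightarrow> poly_deg d (f i)"
    and a: "\<And>i. i \<in> I \<Longrightarrow> finite_matrix_group.invariant W (a i)"
    and "\<And>x. (\<Sum>i\<in>I. a i x * f i x) = 0"
  shows "finite_matrix_group.syzygy_span W I a f"
proof -
  interpret finite_matrix_group W
    using W by (rule finite_matrix_group_if_reflection_group)
  interpret GL: group "general_linear_group :: (complex^'n^'n) monoid"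
    by (rule group_general_linear_group)
  show ?thesis
    using assms(2,4)
  proof (induction d arbitrary: f)
    case 0
    then have "\<exists>c. f i = (\<lambda>x. c)" if "i \<in> I" for i using poly_deg_0_const that by blast
    then have "invariant (f i)" if "i \<in> I" for i using invariant_intros(1) that by metis
    then show ?case
      using 0(2) by (intro syzygy_span.base[where r = f and h = "\<lambda>x. 1"]) (auto intro: polyfn_const)
  next
    case (Suc d)
    have refl: "syzygy_span I a (\<lambda>i x. f i x - f i (s *v x))"
      if s: "s \<in> W" "pseudo_reflection s" for s
    proof -
      obtain H where "is_reflection_along H s" using s(2) pseudo_reflection_def by blast
      then obtain c k u where ck: "\<And>x. x - s *v x = (\<Sum>i\<in>UNIV. c $ i * x $ i) *s k"
        and u: "(\<Sum>i\<in>UNIV. c $ i * u $ i) = 1"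
        by (rule reflection_coordinate) (rule that; assumption)
      have "\<forall>i\<in>I. \<exists>h. poly_deg d h \<and>
          (\<forall>x. f i x - f i (s *v x) = (\<Sum>i\<in>UNIV. c $ i * x $ i) * h x)"
        using reflection_difference_quotient[OF ck Suc.prems(1)] by fastforce
      then obtain h where h: "\<And>i. i \<in> I \<Longrightarrow> poly_deg d (h i)"
        "\<And>i x. i \<in> I \<Longrightarrow> f i x - f i (s *v x) = (\<Sum>i\<in>UNIV. c $ i * x $ i) * h i x"
        by metis
      have "(\<Sum>i\<in>I. a i x * h i x) = 0" for x
      proof (rule polyfn_eq_0_off_hyperplane[OF _ _ u])
        show "polyfn (\<lambda>x. \<Sum>i\<in>I. a i x * h i x)"
          using h(1) invariant_polyfn[OF a] by (intro polyfn_sum polyfn_mult) (auto simp: polyfn_def)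
        fix x
        have "l * (\<Sum>i\<in>I. a i x * h i x) = (\<Sum>i\<in>I. a i x * (l * h i x))" for l
          by (simp add: sum_distrib_left mult_ac)
        then have "(\<Sum>i\<in>UNIV. c $ i * x $ i) * (\<Sum>i\<in>I. a i x * h i x) =
            (\<Sum>i\<in>I. a i x * ((\<Sum>i\<in>UNIV. c $ i * x $ i) * h i x))" .
        also have "\<dots> = (\<Sum>i\<in>I. a i x * (f i x - f i (s *v x)))"
          using h(2) by (intro sum.cong) auto
        also have "\<dots> = (\<Sum>i\<in>I. a i x * f i x) - (\<Sum>i\<in>I. a i (s *v x) * f i (s *v x))"
          using invariant_translate[OF a s(1)] by (simp add: algebra_simps sum_subtractf)
        also have "\<dots> = 0" by (simp add: Suc.prems(2))
        finally show "(\<Sum>i\<in>UNIV. c $ i * x $ i) * (\<Sum>i\<in>I. a i x * h i x) = 0" .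
      qed
      then have "syzygy_span I a h" using Suc.IH h(1) by blast
      then have "syzygy_span I a (\<lambda>i x. (\<Sum>i\<in>UNIV. c $ i * x $ i) * h i x)"
        by (rule syzygy_span_cmult) (intro polyfn_intros)
      then show ?thesis by (rule syzygy_span_cong) (simp add: h(2))
    qed
    have gen: "w \<in> W \<and> syzygy_span I a (\<lambda>i x. f i x - f i (w *v x))"
      if "w \<in> generate general_linear_group {s \<in> W. pseudo_reflection s}" for w
      using that
    proof (induction w rule: generate.induct)
      case one
      show ?case using syzygy_span_zero one_in by (simp add: general_linear_group_def)
    next
      case (incl s)
      then show ?case using refl by blast
    next
      case (inv s)
      let ?t = "inv\<^bsub>general_linear_group\<^esub> s"
      have s: "s \<in> W" "pseudo_reflection s" using inv by auto
      have sub: "subgroup W general_linear_group" using W by (simp add: complex_reflection_group_def)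
      have t: "?t \<in> W" using subgroup.m_inv_closed[OF sub s(1)] .
      have "s \<in> carrier general_linear_group" using subgroup.subset[OF sub] s(1) by (rule subsetD)
      then have "s ** ?t = mat 1" using GL.r_inv by (simp add: general_linear_group_def)
      then have st: "s *v (?t *v x) = x" for x by (simp add: matrix_vector_mul_assoc)
      have "syzygy_span I a (\<lambda>i x. (-1) * (f i (?t *v x) - f i (s *v (?t *v x))))"
        by (intro syzygy_span_cmult polyfn_const syzygy_span_translate[OF refl[OF s] t])
      then show ?case using t by (simp add: st)
    next
      case (eng w w')
      have "syzygy_span I a (\<lambda>i x. f i (w' *v x) - f i (w *v (w' *v x)))"
        by (rule syzygy_span_translate) (use eng.IH in simp_all)
      from syzygy_span.add[OF conjunct2[OF eng.IH(2)] this]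
      have "syzygy_span I a (\<lambda>i x. f i x - f i ((w ** w') *v x))"
        by (simp add: matrix_vector_mul_assoc)
      then show ?case using eng.IH mult_in by (simp add: general_linear_group_def)
    qed
    have W_gen: "generate general_linear_group {s \<in> W. pseudo_reflection s} = W"
      using W by (simp add: complex_reflection_group_def)
    have 1: "syzygy_span I a (\<lambda>i x. \<Sum>w\<in>W. f i x - f i (w *v x))"
      using gen W_gen by (intro syzygy_span_sum) auto
    have 2: "syzygy_span I a (\<lambda>i x. \<Sum>w\<in>W. f i (w *v x))"
    proof (rule syzygy_span.base[where h = "\<lambda>x. 1"])
      show "invariant (\<lambda>x. \<Sum>w\<in>W. f i (w *v x))" if "i \<in> I" for i
        using Suc.prems(1)[OF that] by (intro invariant_average) (auto simp: polyfn_def)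
      show "(\<Sum>i\<in>I. a i x * (\<Sum>w\<in>W. f i (w *v x))) = 0" for x
      proof -
        have "(\<Sum>i\<in>I. a i x * (\<Sum>w\<in>W. f i (w *v x))) = (\<Sum>i\<in>I. \<Sum>w\<in>W. a i (w *v x) * f i (w *v x))"
          using invariant_translate[OF a] by (simp add: sum_distrib_left)
        also have "\<dots> = (\<Sum>w\<in>W. \<Sum>i\<in>I. a i (w *v x) * f i (w *v x))" by (rule sum.swap)
        finally show ?thesis by (simp add: Suc.prems(2))
      qed
    qed (auto intro: polyfn_const)
    have "syzygy_span I a (\<lambda>i x. of_nat (card W) * f i x)"
      by (rule syzygy_span.add[OF 1 2]) (simp add: sum_subtractf)
    then have "syzygy_span I a (\<lambda>i x. (1 / of_nat (card W)) * (of_nat (card W) * f i x))"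
      by (rule syzygy_span_cmult) (rule polyfn_const)
    moreover have "card W \<noteq> 0" using finite_G one_in by auto
    ultimately show ?case by simp
  qed
qed


lemma degree_prod_linear:
  fixes b :: "'a \<Rightarrow> complex"
  assumes "finite A"
  shows "degree (\<Prod>a\<in>A. [:- b a, 1:]) = card A" "coeff (\<Prod>a\<in>A. [:- b a, 1:]) (card A) = 1"
proof -
  have "degree (\<Prod>a\<in>A. [:- b a, 1:]) = card A \<and> lead_coeff (\<Prod>a\<in>A. [:- b a, 1:]) = 1"
    using assms
  proof (induction A rule: finite_induct)
    case (insert a A)
    then have "(\<Prod>a\<in>A. [:- b a, 1:]) \<noteq> 0" by auto
    then have "degree ([:- b a, 1:] * (\<Prod>a\<in>A. [:- b a, 1:])) = Suc (card A)"
      using insert by (subst degree_mult_eq) simp_all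
    moreover have "lead_coeff ([:- b a, 1:] * (\<Prod>a\<in>A. [:- b a, 1:])) = 1"
      using insert.IH by (subst lead_coeff_mult) (elim conjE, simp)
    ultimately show ?case using insert.hyps by simp
  qed simp
  then show "degree (\<Prod>a\<in>A. [:- b a, 1:]) = card A" "coeff (\<Prod>a\<in>A. [:- b a, 1:]) (card A) = 1"
    by auto
qed

lemma polyfn_coeff_prod_linear:
  assumes "\<And>a. a \<in> A \<Longrightarrow> polyfn (b a)"
  shows "polyfn (\<lambda>y. coeff (\<Prod>a\<in>A. [:- b a y, 1:]) k)"
  using assms
proof (induction A arbitrary: k rule: infinite_finite_induct)
  case (insert a A)
  let ?p = "\<lambda>y. \<Prod>a\<in>A. [:- b a y, 1:]"
  have ba: "polyfn (b a)" and IH: "polyfn (\<lambda>y. coeff (?p y) k)" for k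
    using insert.prems insert.IH by simp_all
  have "polyfn (\<lambda>y. coeff ([:- b a y, 1:] * ?p y) k)"
  proof (cases k)
    case 0
    have "polyfn (\<lambda>y. - b a y * coeff (?p y) 0)"
      by (rule polyfn_mult[OF polyfn_uminus[OF ba] IH])
    then show ?thesis by (simp add: 0)
  next
    case (Suc k')
    have "polyfn (\<lambda>y. - b a y * coeff (?p y) (Suc k') + coeff (?p y) k')"
      by (rule polyfn_add[OF polyfn_mult[OF polyfn_uminus[OF ba] IH] IH])
    then show ?thesis by (simp add: Suc)
  qed
  then show ?case using insert.hyps by simp
qed (simp_all add: polyfn_const)

definition lin :: "complex^'n \<Rightarrow> complex^'n \<Rightarrow> complex" where
  "lin l y = (\<Sum>i\<in>UNIV. l $ i * y $ i)"

lemma polyfn_lin: "polyfn (lin l)"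
  unfolding lin_def by (intro polyfn_sum polyfn_mult polyfn_const polyfn_coord)

lemma lin_diff: "lin l (a - b) = lin l a - lin l b"
  by (simp add: lin_def algebra_simps sum_subtractf)

lemma lin_add: "lin l (a + b) = lin l a + lin l b"
  by (simp add: lin_def algebra_simps sum.distrib)

lemma lin_scale: "lin l (t *s a) = t * lin l a"
  by (simp add: lin_def sum_distrib_left mult_ac)

lemma exists_lin_nonzero:
  fixes V :: "(complex^'n) set"
  assumes "finite V" "0 \<notin> V"
  obtains l where "\<And>v. v \<in> V \<Longrightarrow> lin l v \<noteq> 0"
proof -
  let ?K = "\<lambda>v. {l. lin l v = 0}"
  have "vec.subspace (?K v) \<and> \<not> UNIV \<subseteq> ?K v" if "v \<in> V" for v
  proof
    show "vec.subspace (?K v)"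
      by (rule vec.subspaceI)
        (auto simp: lin_def distrib_right sum.distrib mult.assoc simp flip: sum_distrib_left)
    have "v \<noteq> 0" using that assms(2) by metis
    then obtain i where "v $ i \<noteq> 0" by (metis vec_eq_iff zero_index)
    then have "lin (axis i 1) v \<noteq> 0"
      by (simp add: lin_def axis_def if_distrib[of "\<lambda>c. c * _"] cong: if_cong)
    then show "\<not> UNIV \<subseteq> ?K v" by blast
  qed
  then obtain l where "l \<notin> \<Union>(?K ` V)"
    using assms(1) by (rule_tac subspace_avoids_finite_Union[of "?K ` V" UNIV]) auto
  then show ?thesis using that by blast
qed

context finite_matrix_group
begin

text \<open>Generation with a denominator: \<open>f\<close> is a combination of \<open>E\<close> with invariant coefficients after
  multiplication by \<open>b\<close>. The coefficients are indexed by the generators themselves.\<close>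

definition inv_span :: "(complex^'n \<Rightarrow> complex) \<Rightarrow> (complex^'n \<Rightarrow> complex) set \<Rightarrow> (complex^'n \<Rightarrow> complex) \<Rightarrow> bool" where
  "inv_span b E f \<longleftrightarrow>
     (\<exists>c. (\<forall>e\<in>E. invariant (c e)) \<and> (\<forall>y. b y * f y = (\<Sum>e\<in>E. c e y * e y)))"

lemma inv_span_base: "finite E \<Longrightarrow> e \<in> E \<Longrightarrow> inv_span (\<lambda>_. 1) E e"
  unfolding inv_span_def
  by (intro exI[of _ "\<lambda>e' y. if e' = e then 1 else 0"])
    (auto simp: if_distrib[of "\<lambda>c. c * _"] invariant_intros(1) cong: if_cong)

lemma inv_span_add:
  assumes "inv_span b E f" "inv_span b E g"
  shows "inv_span b E (\<lambda>y. f y + g y)"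
proof -
  obtain c d where "\<And>e. e \<in> E \<Longrightarrow> invariant (c e)" "\<And>y. b y * f y = (\<Sum>e\<in>E. c e y * e y)"
    "\<And>e. e \<in> E \<Longrightarrow> invariant (d e)" "\<And>y. b y * g y = (\<Sum>e\<in>E. d e y * e y)"
    using assms unfolding inv_span_def by blast
  then show ?thesis
    unfolding inv_span_def
    by (intro exI[of _ "\<lambda>e y. c e y + d e y"] conjI ballI allI invariant_intros(2))
      (simp_all add: distrib_left distrib_right sum.distrib)
qed

lemma inv_span_mult:
  assumes "inv_span b E f" "invariant a"
  shows "inv_span b E (\<lambda>y. a y * f y)"
proof -
  obtain c where c: "\<And>e. e \<in> E \<Longrightarrow> invariant (c e)" "\<And>y. b y * f y = (\<Sum>e\<in>E. c e y * e y)"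
    using assms(1) unfolding inv_span_def by blast
  have "b y * (a y * f y) = a y * (b y * f y)" for y by simp
  then have "b y * (a y * f y) = (\<Sum>e\<in>E. (a y * c e y) * e y)" for y
    unfolding c(2) by (simp add: sum_distrib_left mult.assoc)
  then show ?thesis
    unfolding inv_span_def
    by (intro exI[of _ "\<lambda>e y. a y * c e y"] conjI ballI allI invariant_intros(3))
      (simp_all add: assms(2) c(1))
qed

lemma inv_span_sum:
  assumes "finite J" "\<And>j. j \<in> J \<Longrightarrow> inv_span b E (f j)"
  shows "inv_span b E (\<lambda>y. \<Sum>j\<in>J. f j y)"
  using assms
proof (induction J rule: finite_induct)
  case empty
  then show ?case
    unfolding inv_span_def by (intro exI[of _ "\<lambda>e y. 0"]) (simp add: invariant_intros(1))
next
  case (insert j J)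
  then show ?case using inv_span_add[of b E "f j" "\<lambda>y. \<Sum>j\<in>J. f j y"] by simp
qed

definition monomial :: "('n \<Rightarrow> nat) \<Rightarrow> complex^'n \<Rightarrow> complex" where
  "monomial m y = (\<Prod>i\<in>UNIV. y $ i ^ m i)"

lemma polyfn_monomial: "polyfn (monomial m)"
  unfolding monomial_def by (intro polyfn_prod polyfn_power polyfn_coord)

lemma monomial_upd: "monomial (m(i := k)) y = y $ i ^ k * (\<Prod>j\<in>UNIV - {i}. y $ j ^ m j)"
  unfolding monomial_def by (subst prod.remove[of _ i]) (auto intro!: prod.cong)

text \<open>The coordinate \<open>y $ i\<close> is a root of \<open>\<Prod>g\<in>G. (T - (g y) $ i)\<close>, a monic polynomial in \<open>T\<close> whose
  coefficients are invariant functions of \<open>y\<close>.\<close>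

lemma coordinate_power_integral:
  obtains r where "\<And>k. invariant (r k)" "\<And>y. y $ i ^ card G = (\<Sum>k<card G. r k y * y $ i ^ k)"
proof -
  define p where "p y = (\<Prod>g\<in>G. [:- (g *v y) $ i, 1:])" for y
  have "invariant (\<lambda>y. coeff (p y) k)" for k
    unfolding invariant_def
  proof (intro conjI ballI allI)
    show "polyfn (\<lambda>y. coeff (p y) k)"
      unfolding p_def by (intro polyfn_coeff_prod_linear polyfn_matrix[OF polyfn_coord])
    fix h y assume "h \<in> G"
    then have "p (h *v y) = p y"
      unfolding p_def using prod_right_translate[of h "\<lambda>g. [:- (g *v y) $ i, 1:]"]
      by (simp add: matrix_vector_mul_assoc)
    then show "coeff (p (h *v y)) k = coeff (p y) k" by simp
  qed
  moreover have "y $ i ^ card G = (\<Sum>k<card G. (- coeff (p y) k) * y $ i ^ k)" for y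
  proof -
    have "poly (p y) (y $ i) = 0"
      unfolding p_def poly_prod using finite_G one_in by (intro prod_zero) (auto intro!: bexI[of _ "mat 1"])
    moreover have "poly (p y) (y $ i) = (\<Sum>k\<le>card G. coeff (p y) k * y $ i ^ k)"
      unfolding poly_altdef p_def degree_prod_linear[OF finite_G] ..
    moreover have "coeff (p y) (card G) = 1"
      unfolding p_def by (rule degree_prod_linear(2)[OF finite_G])
    ultimately show ?thesis
      by (simp add: lessThan_Suc_atMost[symmetric] sum_negf eq_neg_iff_add_eq_0 add.commute)
  qed
  ultimately show ?thesis
    using invariant_intros(3)[OF invariant_intros(1)[of "-1"]]
    by (intro that[of "\<lambda>k y. - coeff (p y) k"]) auto
qed

text \<open>The monomials with all exponents below \<open>card G\<close> generate, because higher powers of a coordinate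
  can be lowered by the monic equation that it satisfies.\<close>

lemma polynomials_finitely_generated:
  obtains E where "finite E" "\<And>e. e \<in> E \<Longrightarrow> polyfn e" "\<And>f. polyfn f \<Longrightarrow> inv_span (\<lambda>_. 1) E f"
proof -
  define M where "M = {m :: 'n \<Rightarrow> nat. \<forall>i. m i < card G}"
  define E where "E = monomial ` M"
  have "M = PiE UNIV (\<lambda>_. {..<card G})" by (auto simp: M_def PiE_def)
  then have "finite M" by (simp add: finite_PiE)
  then have finE: "finite E" by (simp add: E_def)
  have G0: "card G > 0" using finite_G one_in by (auto simp: card_gt_0_iff)
  have mon: "inv_span (\<lambda>_. 1) E (monomial m)" if "m \<in> M" for m
    using inv_span_base finE that by (simp add: E_def)
  have mon_coord: "inv_span (\<lambda>_. 1) E (\<lambda>y. y $ i * monomial m y)" if m: "m \<in> M" for m i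
  proof -
    have *: "y $ i * monomial m y = monomial (m(i := Suc (m i))) y" for y
      using monomial_upd[of m i "m i" y] monomial_upd[of m i "Suc (m i)" y] by simp
    show ?thesis
    proof (cases "Suc (m i) < card G")
      case True
      then have "m(i := Suc (m i)) \<in> M" using m by (simp add: M_def)
      then show ?thesis using mon by (simp add: *)
    next
      case False
      moreover have "m i < card G" using m by (simp add: M_def)
      ultimately have eq: "Suc (m i) = card G" by linarith
      obtain r where r: "\<And>k. invariant (r k)"
        "\<And>y. y $ i ^ card G = (\<Sum>k<card G. r k y * y $ i ^ k)"
        using coordinate_power_integral by blast
      have "y $ i * monomial m y = (\<Sum>k<card G. r k y * monomial (m(i := k)) y)" for y
        unfolding * eq monomial_upd r(2) by (simp add: sum_distrib_right mult.assoc)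
      moreover have "inv_span (\<lambda>_. 1) E (\<lambda>y. \<Sum>k<card G. r k y * monomial (m(i := k)) y)"
        using m by (intro inv_span_sum inv_span_mult mon r(1)) (auto simp: M_def)
      ultimately show ?thesis by simp
    qed
  qed
  have "inv_span (\<lambda>_. 1) E f" if "poly_deg d f" for d f
    using that
  proof (induction rule: poly_deg.induct)
    case (const c)
    have "(\<lambda>_. 0) \<in> M" using G0 by (simp add: M_def)
    from inv_span_mult[OF mon[OF this] invariant_intros(1)[of c]]
    show ?case by (simp add: monomial_def)
  next
    case (coord d f i)
    then obtain c where c: "\<And>e. e \<in> E \<Longrightarrow> invariant (c e)" "\<And>y. f y = (\<Sum>e\<in>E. c e y * e y)"
      unfolding inv_span_def by auto
    have "inv_span (\<lambda>_. 1) E (\<lambda>y. c e y * (y $ i * e y))" if e: "e \<in> E" for e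
    proof -
      have "inv_span (\<lambda>_. 1) E (\<lambda>y. y $ i * e y)" using mon_coord e by (auto simp: E_def)
      then show ?thesis using c(1)[OF e] by (rule inv_span_mult)
    qed
    then have "inv_span (\<lambda>_. 1) E (\<lambda>y. \<Sum>e\<in>E. c e y * (y $ i * e y))"
      using finE by (rule inv_span_sum[rotated])
    then show ?case by (simp add: c(2) sum_distrib_left mult.left_commute)
  next
    case (add d f g)
    then show ?case by (intro inv_span_add)
  qed
  then show ?thesis
    using finE polyfn_monomial by (intro that[of E]) (auto simp: E_def polyfn_def)
qed

text \<open>Generators of the polynomials as a module over the invariants, after localisation at the orbit
  of \<open>x\<close>; the denominator \<open>b\<close> is one for all polynomials at once.\<close>

definition local_generators :: "complex^'n \<Rightarrow> (complex^'n \<Rightarrow> complex) set \<Rightarrow> bool" where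
  "local_generators x E \<longleftrightarrow> finite E \<and> (\<forall>e\<in>E. polyfn e) \<and>
     (\<exists>b. invariant b \<and> b x \<noteq> 0 \<and> (\<forall>f. polyfn f \<longrightarrow> inv_span b E f))"

definition local_basis :: "complex^'n \<Rightarrow> (complex^'n \<Rightarrow> complex) \<Rightarrow> (complex^'n \<Rightarrow> complex) set \<Rightarrow> bool" where
  "local_basis x b E \<longleftrightarrow> finite E \<and> (\<forall>e\<in>E. polyfn e) \<and> invariant b \<and> b x \<noteq> 0 \<and>
     (\<forall>f. polyfn f \<longrightarrow> inv_span b E f) \<and>
     (\<forall>c. (\<forall>e\<in>E. invariant (c e)) \<and> (\<forall>y. (\<Sum>e\<in>E. c e y * e y) = 0) \<longrightarrow> (\<forall>e\<in>E. \<forall>y. c e y = 0))"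

text \<open>Nakayama's argument. If some relation has a coefficient \<open>c e\<close> that does not vanish at \<open>x\<close>, then
  with the larger denominator \<open>c e * b\<close> the generator \<open>e\<close> can be dropped. So in a generating set of
  least cardinality all coefficients of all relations vanish at \<open>x\<close>.\<close>

lemma minimal_local_generators:
  obtains E where "local_generators x E"
    "\<forall>c. (\<forall>e\<in>E. invariant (c e)) \<and> (\<forall>y. (\<Sum>e\<in>E. c e y * e y) = 0) \<longrightarrow> (\<forall>e\<in>E. c e x = 0)"
proof -
  obtain E0 where "finite E0" "\<And>e. e \<in> E0 \<Longrightarrow> polyfn e"
    "\<And>f. polyfn f \<Longrightarrow> inv_span (\<lambda>_. 1) E0 f"
    by (rule polynomials_finitely_generated) (rule that; assumption)
  then have "local_generators x E0"
    unfolding local_generators_def using invariant_intros(1)[of 1] by (intro conjI) (auto intro!: exI[of _ "\<lambda>_. 1"])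
  then obtain E where E: "local_generators x E" and min: "\<And>E'. local_generators x E' \<Longrightarrow> card E \<le> card E'"
    using ex_has_least_nat[of "local_generators x" E0 card] by blast
  obtain b where finE: "finite E" and polE: "\<And>e. e \<in> E \<Longrightarrow> polyfn e" and b: "invariant b" "b x \<noteq> 0"
    and span: "\<And>f. polyfn f \<Longrightarrow> inv_span b E f"
    using E unfolding local_generators_def by auto
  have "c e0 x = 0" if c: "\<And>e. e \<in> E \<Longrightarrow> invariant (c e)" "\<And>y. (\<Sum>e\<in>E. c e y * e y) = 0"
    and e0: "e0 \<in> E" for c e0
  proof (rule ccontr)
    assume nz: "c e0 x \<noteq> 0"
    have "inv_span (\<lambda>y. c e0 y * b y) (E - {e0}) f" if f: "polyfn f" for f
    proof -
      obtain d where d: "\<And>e. e \<in> E \<Longrightarrow> invariant (d e)" "\<And>y. b y * f y = (\<Sum>e\<in>E. d e y * e y)"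
        using span[OF f] unfolding inv_span_def by blast
      have "c e0 y * b y * f y = (\<Sum>e\<in>E - {e0}. (c e0 y * d e y - d e0 y * c e y) * e y)" for y
      proof -
        have "c e0 y * b y * f y = c e0 y * (\<Sum>e\<in>E. d e y * e y) - d e0 y * (\<Sum>e\<in>E. c e y * e y)"
          using d(2)[of y] c(2)[of y] by (simp add: mult.assoc)
        also have "\<dots> = (\<Sum>e\<in>E. (c e0 y * d e y - d e0 y * c e y) * e y)"
          by (simp add: sum_distrib_left left_diff_distrib sum_subtractf mult.assoc)
        also have "\<dots> = (\<Sum>e\<in>E - {e0}. (c e0 y * d e y - d e0 y * c e y) * e y)"
          using finE e0 by (subst sum.remove[of _ e0]) auto
        finally show ?thesis .
      qed
      then show ?thesis
        unfolding inv_span_def using c(1) d(1) e0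
        by (intro exI[of _ "\<lambda>e y. c e0 y * d e y - d e0 y * c e y"])
          (auto intro!: invariant_intros(3,4))
    qed
    then have "local_generators x (E - {e0})"
      unfolding local_generators_def using finE polE b nz c(1)[OF e0]
      by (intro conjI exI[of _ "\<lambda>y. c e0 y * b y"]) (auto intro: invariant_intros(3))
    then have "card E \<le> card (E - {e0})" by (rule min)
    then show False using card_Diff1_less[OF finE e0] by simp
  qed
  then show ?thesis by (intro that[OF E]) blast
qed

end

text \<open>Minimal generators of a flat module are independent. Flatness rewrites a relation \<open>a\<close> among them
  as an invariant matrix \<open>M\<close> with \<open>b * i = (\<Sum>k\<in>E. M i k * k)\<close> and \<open>(\<Sum>i\<in>E. a i * M i k) = 0\<close>. By
  minimality \<open>M\<close> is \<open>b x\<close> times the identity matrix at \<open>x\<close>, hence invertible near \<open>x\<close>, so that \<open>a\<close>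
  vanishes near \<open>x\<close> and therefore everywhere.\<close>

lemma reflection_group_local_basis:
  fixes W :: "(complex^'n^'n) set"
  assumes W: "complex_reflection_group W"
  shows "\<exists>b E. finite_matrix_group.local_basis W x b E"
proof -
  interpret finite_matrix_group W
    using W by (rule finite_matrix_group_if_reflection_group)
  obtain E where E: "local_generators x E" and
    min: "\<forall>c. (\<forall>e\<in>E. invariant (c e)) \<and> (\<forall>y. (\<Sum>e\<in>E. c e y * e y) = 0) \<longrightarrow> (\<forall>e\<in>E. c e x = 0)"
    by (rule minimal_local_generators[of x]) (rule that)
  obtain b where finE: "finite E" and polE: "\<And>e. e \<in> E \<Longrightarrow> polyfn e" and b: "invariant b" "b x \<noteq> 0"
    and span: "\<And>f. polyfn f \<Longrightarrow> inv_span b E f"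
    using E unfolding local_generators_def by auto
  have indep: "a e y = 0" if a: "\<And>e. e \<in> E \<Longrightarrow> invariant (a e)" and rel: "\<And>y. (\<Sum>e\<in>E. a e y * e y) = 0"
    and "e \<in> E" for a e y
  proof -
    have "\<exists>d. \<forall>e\<in>E. poly_deg d e"
      using finE polE
    proof (induction E rule: finite_induct)
      case (insert e E)
      then obtain d where d: "\<forall>e\<in>E. poly_deg d e" by auto
      obtain d' where "poly_deg d' e" using insert.prems polyfn_def by blast
      then show ?case
        using d by (intro exI[of _ "max d d'"])
          (auto intro: poly_deg_mono[OF _ max.cobounded1] poly_deg_mono[OF _ max.cobounded2])
    qed simp
    then obtain d where "\<And>e. e \<in> E \<Longrightarrow> poly_deg d e" by blast
    then have sp: "syzygy_span E a (\<lambda>e. e)"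
      using syzygies_spanned_by_invariant_syzygies[OF W _ a rel] by blast
    have "\<exists>M. (\<forall>i\<in>E. \<forall>k\<in>E. invariant (M i k)) \<and>
        (\<forall>i\<in>E. \<forall>y. b y * f i y = (\<Sum>k\<in>E. M i k y * k y)) \<and>
        (\<forall>k\<in>E. \<forall>y. (\<Sum>i\<in>E. a i y * M i k y) = 0)" if "syzygy_span E a f" for f
      using that
    proof (induction rule: syzygy_span.induct)
      case (base r h f)
      obtain c where c: "\<And>e. e \<in> E \<Longrightarrow> invariant (c e)" "\<And>y. b y * h y = (\<Sum>e\<in>E. c e y * e y)"
        using span[OF base(3)] unfolding inv_span_def by blast
      have 1: "b y * f i y = (\<Sum>k\<in>E. r i y * c k y * k y)" if "i \<in> E" for i y
      proof -
        have "b y * f i y = r i y * (b y * h y)" using base(4)[OF that] by simp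
        then show ?thesis by (simp add: c(2) sum_distrib_left mult.assoc)
      qed
      have 2: "(\<Sum>i\<in>E. a i y * (r i y * c k y)) = 0" for k y
        using base(2)[of y] by (simp add: mult.assoc[symmetric] flip: sum_distrib_right)
      show ?case
        using 1 2 base(1) c(1) by (intro exI[of _ "\<lambda>i k y. r i y * c k y"]) (auto intro!: invariant_intros(3))
    next
      case (add f g h)
      from add.IH(1) obtain M where M: "\<And>i k. i \<in> E \<Longrightarrow> k \<in> E \<Longrightarrow> invariant (M i k)"
        "\<And>i y. i \<in> E \<Longrightarrow> b y * f i y = (\<Sum>k\<in>E. M i k y * k y)"
        "\<And>k y. k \<in> E \<Longrightarrow> (\<Sum>i\<in>E. a i y * M i k y) = 0" by blast
      from add.IH(2) obtain N where N: "\<And>i k. i \<in> E \<Longrightarrow> k \<in> E \<Longrightarrow> invariant (N i k)"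
        "\<And>i y. i \<in> E \<Longrightarrow> b y * g i y = (\<Sum>k\<in>E. N i k y * k y)"
        "\<And>k y. k \<in> E \<Longrightarrow> (\<Sum>i\<in>E. a i y * N i k y) = 0" by blast
      show ?case
        using M N add.hyps(3)
        by (intro exI[of _ "\<lambda>i k y. M i k y + N i k y"])
          (auto intro!: invariant_intros(2) simp: distrib_left distrib_right sum.distrib)
    qed
    from this[OF sp] obtain M where M: "\<And>i k. i \<in> E \<Longrightarrow> k \<in> E \<Longrightarrow> invariant (M i k)"
      "\<And>i y. i \<in> E \<Longrightarrow> b y * i y = (\<Sum>k\<in>E. M i k y * k y)"
      "\<And>k y. k \<in> E \<Longrightarrow> (\<Sum>i\<in>E. a i y * M i k y) = 0" by blast
    have Mx: "M i k x = (if i = k then b x else 0)" if i: "i \<in> E" and k: "k \<in> E" for i k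
    proof -
      let ?c = "\<lambda>k y. M i k y - (if i = k then b y else 0)"
      have "invariant (?c e)" if "e \<in> E" for e
        using M(1)[OF i that] b(1) by (cases "i = e") (simp_all add: invariant_intros(4))
      moreover have "(\<Sum>e\<in>E. ?c e y * e y) = 0" for y
        using M(2)[OF i, of y] finE i
        by (simp add: left_diff_distrib sum_subtractf if_distrib[of "\<lambda>c. c * _"] cong: if_cong)
      ultimately have "?c k x = 0"
        using min[rule_format, of ?c k] k by simp
      then show ?thesis by simp
    qed
    \<comment> \<open>If all entries of \<open>M y\<close> are within \<open>\<eta>\<close> of those at \<open>x\<close>, then \<open>M y\<close> is diagonally dominant.
      Its kernel is trivial, as one sees at an entry \<open>a k y\<close> of maximal modulus.\<close>
    define \<eta> where "\<eta> = cmod (b x) / (real (card E) + 1)"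
    have \<eta>: "\<eta> > 0" using b(2) by (simp add: \<eta>_def)
    have "eventually (\<lambda>y. \<forall>i\<in>E. \<forall>k\<in>E. dist (M i k y) (M i k x) < \<eta>) (nhds x)"
    proof -
      have "eventually (\<lambda>y. dist (M i k y) (M i k x) < \<eta>) (nhds x)" if "i \<in> E" "k \<in> E" for i k
      proof -
        have "continuous_on UNIV (M i k)"
          using polyfn_continuous[OF invariant_polyfn[OF M(1)[OF that]] continuous_on_id] by simp
        then have "open {y. dist (M i k y) (M i k x) < \<eta>}"
          by (intro open_Collect_less continuous_intros)
        then show ?thesis using \<eta> by (auto simp: eventually_nhds)
      qed
      then show ?thesis using finE by (intro eventually_ball_finite ballI) auto
    qed
    then have "eventually (\<lambda>y. a e y = 0) (nhds x)"
    proof (rule eventually_mono)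
      fix y assume near: "\<forall>i\<in>E. \<forall>k\<in>E. dist (M i k y) (M i k x) < \<eta>"
      define m where "m = Max ((\<lambda>i. cmod (a i y)) ` E)"
      have ne: "E \<noteq> {}" using \<open>e \<in> E\<close> by blast
      have le: "cmod (a i y) \<le> m" if "i \<in> E" for i
        unfolding m_def using finE that by simp
      have "m \<in> (\<lambda>i. cmod (a i y)) ` E" unfolding m_def using finE ne by (intro Max_in) auto
      then obtain k where k: "k \<in> E" "m = cmod (a k y)" by blast
      have "a k y * b x = (\<Sum>i\<in>E. a i y * M i k x)"
        using k finE by (simp add: Mx if_distrib[of "\<lambda>c. _ * c"] cong: if_cong)
      also have "\<dots> = (\<Sum>i\<in>E. a i y * (M i k x - M i k y))"
        using M(3)[OF k(1), of y] by (simp add: right_diff_distrib sum_subtractf)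
      finally have eq: "a k y * b x = (\<Sum>i\<in>E. a i y * (M i k x - M i k y))" .
      have "m * cmod (b x) \<le> (\<Sum>i\<in>E. cmod (a i y * (M i k x - M i k y)))"
        unfolding k(2) norm_mult[symmetric] eq by (rule norm_sum)
      also have "\<dots> \<le> (\<Sum>i\<in>E. m * \<eta>)"
      proof (rule sum_mono)
        fix i assume i: "i \<in> E"
        have "cmod (M i k x - M i k y) \<le> \<eta>"
          using near i k(1) by (simp add: dist_norm norm_minus_commute less_imp_le)
        moreover have "0 \<le> m" using le[OF i] norm_ge_zero order_trans by blast
        ultimately show "cmod (a i y * (M i k x - M i k y)) \<le> m * \<eta>"
          unfolding norm_mult using le[OF i] by (intro mult_mono) auto
      qed
      also have "\<dots> = m * (real (card E) * \<eta>)" by simp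
      finally have "m * cmod (b x) \<le> m * (real (card E) * \<eta>)" .
      moreover have "real (card E) * \<eta> < cmod (b x)"
        using b(2) by (simp add: \<eta>_def field_simps)
      ultimately have "m \<le> 0" by (meson mult_le_cancel_left_pos not_le)
      then have "cmod (a e y) \<le> 0" using le[OF \<open>e \<in> E\<close>] by linarith
      then show "a e y = 0" by simp
    qed
    then show ?thesis
      by (rule polyfn_eq_0_if_locally_0[OF invariant_polyfn[OF a[OF \<open>e \<in> E\<close>]]])
  qed
  have "\<forall>c. (\<forall>e\<in>E. invariant (c e)) \<and> (\<forall>y. (\<Sum>e\<in>E. c e y * e y) = 0) \<longrightarrow> (\<forall>e\<in>E. \<forall>y. c e y = 0)"
  proof (intro allI impI ballI)
    fix c e y
    assume *: "(\<forall>e\<in>E. invariant (c e)) \<and> (\<forall>y. (\<Sum>e\<in>E. c e y * e y) = 0)" and e: "e \<in> E"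
    show "c e y = 0" by (rule indep[of c, OF _ _ e]) (use * in auto)
  qed
  moreover have "\<forall>e\<in>E. polyfn e" "\<forall>f. polyfn f \<longrightarrow> inv_span b E f" using polE span by auto
  ultimately have "local_basis x b E"
    unfolding local_basis_def using finE b by (intro conjI)
  then show ?thesis by blast
qed


section \<open>Freeness of the action on the hyperplane complement\<close>

context finite_matrix_group
begin

text \<open>A polynomial in \<open>y\<close> that is nonzero exactly when the linear form \<open>l\<close> separates \<open>y\<close> from its images
  under the nontrivial elements of \<open>G\<close>.\<close>

definition separator :: "complex^'n \<Rightarrow> complex^'n \<Rightarrow> complex" where
  "separator l y = (\<Prod>g\<in>G - {mat 1}. lin l (y - g *v y))"

lemma separator_nonzero_iff: "separator l y \<noteq> 0 \<longleftrightarrow> (\<forall>g\<in>G - {mat 1}. lin l (y - g *v y) \<noteq> 0)"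
  using finite_G by (simp add: separator_def)

lemma polyfn_separator: "polyfn (separator l)"
  unfolding separator_def lin_diff
  by (intro polyfn_prod polyfn_diff polyfn_matrix polyfn_lin)

lemma exists_separator_nonzero:
  assumes "\<And>g. \<lbrakk>g \<in> G; g \<noteq> mat 1\<rbrakk> \<Longrightarrow> g *v y \<noteq> y"
  obtains l where "separator l y \<noteq> 0"
proof -
  have "finite ((\<lambda>g. y - g *v y) ` (G - {mat 1}))" using finite_G by simp
  moreover have "0 \<notin> (\<lambda>g. y - g *v y) ` (G - {mat 1})"
  proof
    assume "0 \<in> (\<lambda>g. y - g *v y) ` (G - {mat 1})"
    then obtain g where "g \<in> G" "g \<noteq> mat 1" "0 = y - g *v y" by blast
    then show False using assms[of g] by simp
  qed
  ultimately
  obtain l where l: "\<And>v. v \<in> (\<lambda>g. y - g *v y) ` (G - {mat 1}) \<Longrightarrow> lin l v \<noteq> 0"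
    by (rule exists_lin_nonzero) (rule that; blast)
  have "separator l y \<noteq> 0" unfolding separator_nonzero_iff using l by blast
  then show ?thesis by (rule that)
qed

text \<open>The polynomial \<open>\<Prod>h\<in>G - {mat 1}. (T - lin l (h *v y))\<close> in \<open>T\<close> vanishes at \<open>T = lin l (g *v y)\<close> for
  \<open>g \<noteq> mat 1\<close> and is the separator for \<open>g = mat 1\<close>. Expanding it in powers of \<open>T\<close>, and each power
  of \<open>lin l\<close> in the generators with invariant coefficients, gives the \<open>f e\<close>.\<close>

lemma separator_expansion:
  assumes "local_basis x b E"
  shows "\<exists>f. (\<forall>e\<in>E. polyfn (f e)) \<and>
    (\<forall>y. \<forall>g\<in>G. (\<Sum>e\<in>E. f e y * e (g *v y)) = (if g = mat 1 then b y * separator l y else 0))"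
proof -
  define G' where "G' = G - {mat 1}"
  have fin: "finite G'" using finite_G by (simp add: G'_def)
  have finE: "finite E" and b: "invariant b" and span: "\<And>f. polyfn f \<Longrightarrow> inv_span b E f"
    using assms unfolding local_basis_def by auto
  define p where "p y = (\<Prod>g\<in>G'. [:- lin l (g *v y), 1:])" for y
  have "\<forall>k. \<exists>c. (\<forall>e\<in>E. invariant (c e)) \<and> (\<forall>y. b y * lin l y ^ k = (\<Sum>e\<in>E. c e y * e y))"
  proof
    fix k
    have "polyfn (\<lambda>y. lin l y ^ k)" by (intro polyfn_power polyfn_lin)
    from span[OF this]
    show "\<exists>c. (\<forall>e\<in>E. invariant (c e)) \<and> (\<forall>y. b y * lin l y ^ k = (\<Sum>e\<in>E. c e y * e y))"
      unfolding inv_span_def .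
  qed
  from choice[OF this] obtain c where "\<forall>k. (\<forall>e\<in>E. invariant (c k e)) \<and>
    (\<forall>y. b y * lin l y ^ k = (\<Sum>e\<in>E. c k e y * e y))" ..
  then have c: "\<And>k e. e \<in> E \<Longrightarrow> invariant (c k e)"
    "\<And>k y. b y * lin l y ^ k = (\<Sum>e\<in>E. c k e y * e y)"
    by auto
  define f where "f e y = (\<Sum>k\<le>card G'. coeff (p y) k * c k e y)" for e y
  have "polyfn (f e)" if "e \<in> E" for e
    unfolding f_def p_def using invariant_polyfn[OF c(1)[OF that]]
    by (intro polyfn_sum polyfn_mult polyfn_coeff_prod_linear polyfn_matrix polyfn_lin)
  moreover have "(\<Sum>e\<in>E. f e y * e (g *v y)) = (if g = mat 1 then b y * separator l y else 0)"
    if g: "g \<in> G" for y g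
  proof -
    have "(\<Sum>e\<in>E. f e y * e (g *v y)) =
        (\<Sum>e\<in>E. \<Sum>k\<le>card G'. coeff (p y) k * (c k e (g *v y) * e (g *v y)))"
      unfolding f_def using invariant_translate[OF c(1) g]
      by (simp add: sum_distrib_right mult.assoc)
    also have "\<dots> = (\<Sum>k\<le>card G'. coeff (p y) k * (\<Sum>e\<in>E. c k e (g *v y) * e (g *v y)))"
      by (subst sum.swap) (simp add: sum_distrib_left)
    also have "\<dots> = b y * (\<Sum>k\<le>card G'. coeff (p y) k * lin l (g *v y) ^ k)"
      unfolding c(2)[symmetric] invariant_translate[OF b g]
      by (simp add: sum_distrib_left mult.left_commute)
    also have "(\<Sum>k\<le>card G'. coeff (p y) k * lin l (g *v y) ^ k) = poly (p y) (lin l (g *v y))"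
      unfolding poly_altdef p_def degree_prod_linear[OF fin] ..
    also have "\<dots> = (\<Prod>h\<in>G'. lin l (g *v y) - lin l (h *v y))"
      by (simp add: p_def poly_prod)
    also have "b y * \<dots> = (if g = mat 1 then b y * separator l y else 0)"
    proof (cases "g = mat 1")
      case True
      then show ?thesis by (simp add: separator_def G'_def lin_diff)
    next
      case False
      then have "(\<Prod>h\<in>G'. lin l (g *v y) - lin l (h *v y)) = 0"
        using g by (intro prod_zero[OF fin] bexI[of _ g]) (auto simp: G'_def)
      then show ?thesis using False by simp
    qed
    finally show ?thesis .
  qed
  ultimately show ?thesis by blast
qed

text \<open>The polynomial \<open>q\<close> vanishes at \<open>h *v z\<close> for \<open>h \<noteq> mat 1\<close>, but not at \<open>z\<close>. Multiplying the \<open>F e\<close> by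
  \<open>q\<close> and averaging gives a relation with invariant coefficients, which is trivial by independence;
  its coefficient at \<open>z\<close> is \<open>q z * F e z\<close>.\<close>

lemma free_point_coefficients_unique:
  assumes "local_basis x b E"
    and F: "\<And>e. e \<in> E \<Longrightarrow> polyfn (F e)"
    and rel: "\<And>y g. g \<in> G \<Longrightarrow> (\<Sum>e\<in>E. F e y * e (g *v y)) = 0"
    and l: "separator l z \<noteq> 0" and e: "e \<in> E"
  shows "F e z = 0"
proof -
  have finE: "finite E"
    and indep: "\<And>c e y. \<lbrakk>\<forall>e\<in>E. invariant (c e); \<forall>y. (\<Sum>e\<in>E. c e y * e y) = 0; e \<in> E\<rbrakk> \<Longrightarrow> c e y = 0"
    using assms(1) unfolding local_basis_def by auto
  define q where "q y = (\<Prod>g\<in>G - {mat 1}. lin l y - lin l (g *v z))" for y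
  have q: "polyfn q"
    unfolding q_def by (intro polyfn_prod polyfn_diff polyfn_lin polyfn_const)
  have q0: "q (h *v z) = 0" if "h \<in> G - {mat 1}" for h
    unfolding q_def using that finite_G by (intro prod_zero) auto
  define c where "c e y = (\<Sum>h\<in>G. q (h *v y) * F e (h *v y))" for e y
  have "\<forall>e\<in>E. invariant (c e)"
  proof
    fix e assume "e \<in> E"
    from invariant_average[OF polyfn_mult[OF q F[OF this]]]
    show "invariant (c e)" unfolding c_def .
  qed
  moreover have "\<forall>y. (\<Sum>e\<in>E. c e y * e y) = 0"
  proof
    fix y
    have "(\<Sum>e\<in>E. c e y * e y) = (\<Sum>h\<in>G. q (h *v y) * (\<Sum>e\<in>E. F e (h *v y) * e y))"
      unfolding c_def by (simp add: sum_distrib_right sum_distrib_left mult.assoc) (rule sum.swap)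
    also have "\<dots> = 0"
    proof (rule sum.neutral, rule ballI)
      fix h assume "h \<in> G"
      then obtain k where k: "k \<in> G" "k ** h = mat 1" using inv_in by blast
      then have "k *v (h *v y) = y" by (simp add: matrix_vector_mul_assoc)
      then show "q (h *v y) * (\<Sum>e\<in>E. F e (h *v y) * e y) = 0"
        using rel[OF k(1), of "h *v y"] by simp
    qed
    finally show "(\<Sum>e\<in>E. c e y * e y) = 0" .
  qed
  ultimately have "c e z = 0" using indep e by blast
  moreover have "c e z = q z * F e z"
    unfolding c_def using finite_G one_in q0 by (subst sum.remove[of _ "mat 1"]) auto
  moreover have "q z \<noteq> 0" using l by (simp add: q_def separator_def lin_diff)
  ultimately show ?thesis by simp
qed

end

lemma tube_lower_bound:
  fixes \<psi> :: "real \<times> complex \<Rightarrow> complex"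
  assumes "continuous_on UNIV \<psi>" "compact K" "\<And>t. t \<in> K \<Longrightarrow> \<psi> (0, t) \<noteq> 0"
  shows "\<exists>\<epsilon> m. 0 < \<epsilon> \<and> 0 < m \<and> (\<forall>s t. 0 \<le> s \<longrightarrow> s \<le> \<epsilon> \<longrightarrow> t \<in> K \<longrightarrow> m \<le> cmod (\<psi> (s, t)))"
proof (cases "K = {}")
  case True
  then show ?thesis by (intro exI[of _ 1]) auto
next
  case False
  have "continuous_on K (\<lambda>t. cmod (\<psi> (0, t)))"
    by (intro continuous_intros continuous_on_compose2[OF assms(1)]) auto
  then obtain t0 where t0: "t0 \<in> K" "\<And>t. t \<in> K \<Longrightarrow> cmod (\<psi> (0, t0)) \<le> cmod (\<psi> (0, t))"
    using continuous_attains_inf[OF assms(2) False] by blast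
  define m where "m = cmod (\<psi> (0, t0)) / 2"
  have m: "m > 0" using assms(3)[OF t0(1)] by (simp add: m_def)
  have "uniformly_continuous_on ({0..1} \<times> K) \<psi>"
    using assms(1,2) by (intro compact_uniformly_continuous compact_Times)
      (auto intro: continuous_on_subset)
  then obtain d where d: "d > 0" "\<And>p q. \<lbrakk>p \<in> {0..1} \<times> K; q \<in> {0..1} \<times> K; dist p q < d\<rbrakk> \<Longrightarrow> dist (\<psi> p) (\<psi> q) < m"
    unfolding uniformly_continuous_on_def using m by metis
  define \<epsilon> where "\<epsilon> = min 1 (d / 2)"
  have "m \<le> cmod (\<psi> (s, t))" if "0 \<le> s" "s \<le> \<epsilon>" "t \<in> K" for s t
  proof -
    have "dist (s, t) (0, t) < d"
      using that d(1) by (simp add: dist_Pair_Pair \<epsilon>_def)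
    then have "dist (\<psi> (s, t)) (\<psi> (0, t)) < m"
      using that by (intro d(2)) (auto simp: \<epsilon>_def)
    moreover have "2 * m \<le> cmod (\<psi> (0, t))" using t0(2)[OF that(3)] by (simp add: m_def)
    moreover have "cmod (\<psi> (0, t)) \<le> cmod (\<psi> (s, t)) + dist (\<psi> (s, t)) (\<psi> (0, t))"
      by (metis add.commute dist_norm norm_minus_commute norm_triangle_sub)
    ultimately show ?thesis by linarith
  qed
  moreover have "\<epsilon> > 0" using d(1) by (simp add: \<epsilon>_def)
  ultimately show ?thesis using m by (intro exI[of _ \<epsilon>] exI[of _ m]) auto
qed

text \<open>A non-identity matrix that is not a reflection fixes a subspace of codimension at least two:
  adjoining one more vector does not yet give the whole space.\<close>

lemma fixed_space_codim_ge_2: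
  fixes g :: "complex^'n^'n"
  assumes "invertible g" "g \<noteq> mat 1" "\<not> is_reflection_along {y. g *v y = y} g"
  shows "vec.span (insert u {y. g *v y = y}) \<noteq> UNIV"
proof
  let ?K = "{y. g *v y = y}"
  assume full: "vec.span (insert u ?K) = UNIV"
  have K: "vec.subspace ?K" by (rule fixed_space_subspace)
  then have span_K: "vec.span ?K = ?K" by (simp add: vec.span_eq_iff)
  have u: "u \<notin> ?K"
  proof
    assume "u \<in> ?K"
    then have "?K = UNIV" using full span_K by (simp add: insert_absorb)
    then have "g *v y = mat 1 *v y" for y by auto
    then show False using assms(2) by (metis matrix_eq)
  qed
  have "vec.dim (insert u ?K) = CARD('n)"
    using full vec.dim_span[of "insert u ?K"] by (simp add: card_cart_basis)
  then have "vec.dim ?K + 1 = CARD('n)"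
    using u by (simp add: vec.dim_insert span_K)
  then show False
    using assms K by (simp add: is_reflection_along_def hyperplane_def)
qed

text \<open>This is the case of Steinberg's theorem for stabilisers that contain no reflection. Suppose that
  \<open>w \<noteq> mat 1\<close> fixes \<open>x\<close>, and take a local basis \<open>E\<close> at \<open>x\<close> with denominator \<open>b\<close>. At points \<open>z\<close> with
  trivial stabiliser there are unique numbers \<open>\<Phi> e z\<close> with \<open>(\<Sum>e\<in>E. \<Phi> e z * e (g *v z)) = b z\<close> for
  \<open>g = mat 1\<close> and \<open>= 0\<close> for all other \<open>g\<close>; by the expansions above they are quotients of
  polynomials \<open>f l e / separator l\<close>, hence holomorphic.

  Near \<open>x\<close> the points with nontrivial stabiliser lie on subspaces of codimension at least two. So
  there are discs arbitrarily close to \<open>x\<close>, all in the direction \<open>u\<close>, that consist of points with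
  trivial stabiliser and whose boundary circles stay in a fixed region on which one \<open>separator l\<close>
  is bounded away from zero. By the maximum principle the \<open>\<Phi> e\<close> stay bounded along the centres of
  these discs. At \<open>x\<close> itself \<open>e (w *v x) = e x\<close>, so the difference of the conditions for
  \<open>mat 1\<close> and for \<open>w\<close> gives \<open>b x = 0\<close> in the limit, which is a contradiction.\<close>

theorem reflection_group_acts_freely:
  fixes W :: "(complex^'n^'n) set"
  assumes W: "complex_reflection_group W" and x: "x \<in> hyperplane_complement W"
    and w: "w \<in> W" "w *v x = x"
  shows "w = mat 1"
proof (rule ccontr)
  assume w1: "w \<noteq> mat 1"
  interpret finite_matrix_group W
    using W by (rule finite_matrix_group_if_reflection_group)
  obtain b E where basis: "local_basis x b E"
    using reflection_group_local_basis[OF W] by blast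
  have finE: "finite E" and polE: "\<And>e. e \<in> E \<Longrightarrow> polyfn e" and b: "invariant b" "b x \<noteq> 0"
    using basis unfolding local_basis_def by auto
  define K where "K g = {y. g *v y = y}" for g :: "complex^'n^'n"
  have K: "vec.subspace (K g)" for g
    unfolding K_def by (rule fixed_space_subspace)
  define W' where "W' = {g \<in> W - {mat 1}. g *v x = x}"
  have inv: "invertible g" if "g \<in> W" for g
    using inv_in[OF that] unfolding invertible_def by blast
  have codim: "vec.span (insert u (K g)) \<noteq> UNIV" if "g \<in> W'" for u g
    unfolding K_def
  proof (rule fixed_space_codim_ge_2)
    show "invertible g" "g \<noteq> mat 1" using that inv by (auto simp: W'_def)
    show "\<not> is_reflection_along {y. g *v y = y} g"
      using that x by (auto simp: W'_def hyperplane_complement_def reflecting_hyperplanes_def)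
  qed
  have K_proper: "K g \<noteq> UNIV" if "g \<in> W - {mat 1}" for g
  proof
    assume "K g = UNIV"
    then have "g *v y = mat 1 *v y" for y by (auto simp: K_def)
    then show False using that by (metis DiffE matrix_eq singletonI)
  qed
  \<comment> \<open>The direction \<open>u\<close> of the discs. On the disc through \<open>x\<close> itself, points with nontrivial
    stabiliser are isolated.\<close>
  obtain u where u: "\<And>g. g \<in> W - {mat 1} \<Longrightarrow> g *v u \<noteq> u"
  proof -
    obtain u where "u \<notin> \<Union>(K ` (W - {mat 1}))"
      using finite_G K K_proper
      by (rule_tac subspace_avoids_finite_Union[of "K ` (W - {mat 1})" UNIV]) auto
    then show ?thesis by (intro that[of u]) (auto simp: K_def)
  qed
  \<comment> \<open>The direction \<open>v\<close> in which the centres approach \<open>x\<close>; it keeps the whole discs off the fixed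
    spaces through \<open>x\<close>.\<close>
  obtain v where v: "\<And>g. g \<in> W' \<Longrightarrow> v \<notin> vec.span (insert u (K g))"
  proof -
    obtain v where "v \<notin> \<Union>((\<lambda>g. vec.span (insert u (K g))) ` W')"
      using finite_G codim
      by (rule_tac subspace_avoids_finite_Union[of "(\<lambda>g. vec.span (insert u (K g))) ` W'" UNIV])
        (auto simp: W'_def)
    then show ?thesis by (intro that[of v]) auto
  qed
  define y where "y s t = x + complex_of_real s *s v + t *s u" for s :: real and t :: complex
  have y_cont: "continuous_on S (\<lambda>p. y (\<sigma> p) (\<tau> p))"
    if "continuous_on S \<sigma>" "continuous_on S \<tau>" for S :: "'z::topological_space set" and \<sigma> \<tau>
    unfolding y_def by (intro continuous_intros that)
  obtain l where l: "separator l u \<noteq> 0"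
    using exists_separator_nonzero u by blast
  obtain r where r: "r > 0" "\<And>g z. \<lbrakk>g \<in> W; g *v x \<noteq> x; dist x z < r\<rbrakk> \<Longrightarrow> g *v z \<noteq> z"
  proof -
    have "open (\<Inter>g\<in>{g \<in> W. g *v x \<noteq> x}. {z. g *v z \<noteq> z})"
      using finite_G by (intro open_INT ballI open_Collect_neq continuous_intros) auto
    then obtain r where "r > 0" "ball x r \<subseteq> (\<Inter>g\<in>{g \<in> W. g *v x \<noteq> x}. {z. g *v z \<noteq> z})"
      by (metis (mono_tags, lifting) INT_I mem_Collect_eq open_contains_ball)
    then show ?thesis by (intro that[of r]) (auto simp: subset_iff)
  qed
  \<comment> \<open>On the line \<open>x + t *s u\<close> each factor of the separator is an affine function of \<open>t\<close> that is not
    constant, so all its zeros other than \<open>t = 0\<close> avoid a small disc.\<close>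
  obtain \<delta> where \<delta>: "\<delta> > 0" "\<delta> * norm u < r / 2"
    "\<And>t. \<lbrakk>t \<noteq> 0; cmod t \<le> \<delta>\<rbrakk> \<Longrightarrow> separator l (y 0 t) \<noteq> 0"
  proof -
    have lu: "lin l (u - g *v u) \<noteq> 0" if "g \<in> W - {mat 1}" for g
      using l that separator_nonzero_iff by blast
    have eq: "lin l (y 0 t - g *v y 0 t) = lin l (x - g *v x) + t * lin l (u - g *v u)" for g t
      by (simp add: y_def matrix_vector_right_distrib vector_scalar_commute lin_add lin_diff
          lin_scale algebra_simps)
    define T where "T = (\<Union>g\<in>W - {mat 1}. {t. lin l (y 0 t - g *v y 0 t) = 0})"
    have "finite {t. lin l (y 0 t - g *v y 0 t) = 0}" if "g \<in> W - {mat 1}" for g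
    proof (rule finite_subset)
      show "{t. lin l (y 0 t - g *v y 0 t) = 0} \<subseteq> {- lin l (x - g *v x) / lin l (u - g *v u)}"
        unfolding eq using lu[OF that] by (auto simp: field_simps eq_neg_iff_add_eq_0)
    qed simp
    then have "finite T" unfolding T_def using finite_G by blast
    then obtain d where d: "d > 0" "\<And>t. t \<in> T \<Longrightarrow> t \<noteq> 0 \<Longrightarrow> d \<le> dist 0 t"
      using finite_set_avoid[of T 0] by auto
    define \<delta> where "\<delta> = min (d / 2) (r / (4 * (norm u + 1)))"
    have "\<delta> * norm u \<le> r / (4 * (norm u + 1)) * norm u"
      by (intro mult_right_mono) (auto simp: \<delta>_def)
    also have "\<dots> \<le> r / 4"
    proof -
      have "0 < norm u + 1" using norm_ge_zero[of u] by linarith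
      have "r / (4 * (norm u + 1)) * norm u = (r / 4) * (norm u / (norm u + 1))" by simp
      also have "\<dots> \<le> (r / 4) * 1"
        using r(1) \<open>0 < norm u + 1\<close> by (intro mult_left_mono) (auto simp: divide_le_eq)
      finally show ?thesis by simp
    qed
    also have "\<dots> < r / 2" using r(1) by simp
    finally have "\<delta> * norm u < r / 2" .
    moreover have "0 < 4 * (norm u + 1)" by (simp add: add_nonneg_pos)
    then have "\<delta> > 0" using d(1) r(1) by (simp add: \<delta>_def)
    moreover have "separator l (y 0 t) \<noteq> 0" if "t \<noteq> 0" "cmod t \<le> \<delta>" for t
    proof -
      have "t \<notin> T" using d(2)[of t] that d(1) by (auto simp: \<delta>_def)
      then show ?thesis unfolding separator_nonzero_iff T_def by blast
    qed
    ultimately show ?thesis by (rule_tac that)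
  qed
  have "\<exists>\<epsilon>0 m. 0 < \<epsilon>0 \<and> 0 < m \<and> (\<forall>s t. 0 \<le> s \<longrightarrow> s \<le> \<epsilon>0 \<longrightarrow> t \<in> sphere 0 \<delta> \<longrightarrow> m \<le> cmod (separator l (y s t)))"
  proof -
    have cont: "continuous_on UNIV (\<lambda>p. separator l (y (fst p) (snd p)))"
      by (intro polyfn_continuous[OF polyfn_separator] y_cont continuous_intros)
    have nz: "separator l (y (fst (0::real, t)) (snd (0::real, t))) \<noteq> 0" if "t \<in> sphere 0 \<delta>" for t
      using \<delta>(3)[of t] \<delta>(1) that by auto
    from tube_lower_bound[OF cont compact_sphere[of 0 \<delta>] nz] show ?thesis
      unfolding fst_conv snd_conv by blast
  qed
  then obtain \<epsilon>0 m where \<epsilon>0: "0 < \<epsilon>0" and m: "0 < m"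
    "\<And>s t. \<lbrakk>0 \<le> s; s \<le> \<epsilon>0; t \<in> sphere 0 \<delta>\<rbrakk> \<Longrightarrow> m \<le> cmod (separator l (y s t))" by blast
  define \<epsilon> where "\<epsilon> = min \<epsilon>0 (r / (4 * (norm v + 1)))"
  have "0 < 4 * (norm v + 1)" by (simp add: add_nonneg_pos)
  then have \<epsilon>: "\<epsilon> > 0" "\<epsilon> \<le> \<epsilon>0" using \<epsilon>0 r(1) by (auto simp: \<epsilon>_def)
  have \<epsilon>v: "\<epsilon> * norm v < r / 2"
  proof -
    have "\<epsilon> * norm v \<le> r / (4 * (norm v + 1)) * norm v"
      by (intro mult_right_mono) (auto simp: \<epsilon>_def)
    also have "\<dots> = (r / 4) * (norm v / (norm v + 1))" by simp
    also have "\<dots> \<le> (r / 4) * 1"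
      using r(1) \<open>0 < 4 * (norm v + 1)\<close> by (intro mult_left_mono) (auto simp: divide_le_eq)
    finally show ?thesis using r(1) by simp
  qed
  have free: "g *v y s t \<noteq> y s t" if s: "0 < s" "s \<le> \<epsilon>" and t: "cmod t \<le> \<delta>" and g: "g \<in> W" "g \<noteq> mat 1" for s t g
  proof (cases "g *v x = x")
    case True
    then have g': "g \<in> W'" using g by (simp add: W'_def)
    show ?thesis
    proof
      assume "g *v y s t = y s t"
      then have "y s t \<in> K g" "x \<in> K g" using True by (auto simp: K_def)
      then have "y s t - x \<in> vec.span (insert u (K g))"
        by (intro vec.span_diff vec.span_base) auto
      moreover have "t *s u \<in> vec.span (insert u (K g))"
        by (intro vec.span_scale vec.span_base) auto
      ultimately have "(y s t - x) - t *s u \<in> vec.span (insert u (K g))"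
        by (rule vec.span_diff)
      then have "complex_of_real s *s v \<in> vec.span (insert u (K g))" by (simp add: y_def)
      then have "(1 / complex_of_real s) *s (complex_of_real s *s v) \<in> vec.span (insert u (K g))"
        by (rule vec.span_scale)
      then have "v \<in> vec.span (insert u (K g))"
        using s(1) by (simp only: vector_smult_assoc) simp
      then show False using v[OF g'] by simp
    qed
  next
    case False
    have "dist x (y s t) = norm (complex_of_real s *s v + t *s u)"
      by (simp add: dist_norm y_def norm_minus_commute add.assoc add.commute)
    also have "\<dots> \<le> s * norm v + cmod t * norm u"
      using norm_triangle_ineq[of "complex_of_real s *s v" "t *s u"] s(1)
      by (simp add: norm_scalar_mult_vec)
    also have "\<dots> \<le> \<epsilon> * norm v + \<delta> * norm u"
      using s t by (intro add_mono mult_right_mono) auto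
    also have "\<dots> < r" using \<delta>(2) \<epsilon>v by simp
    finally show ?thesis using r(2)[OF g(1) False] by blast
  qed
  have "\<forall>k. \<exists>f. (\<forall>e\<in>E. polyfn (f e)) \<and>
    (\<forall>y. \<forall>g\<in>W. (\<Sum>e\<in>E. f e y * e (g *v y)) = (if g = mat 1 then b y * separator k y else 0))"
    using separator_expansion[OF basis] by blast
  from choice[OF this] obtain f where "\<forall>k. (\<forall>e\<in>E. polyfn (f k e)) \<and>
    (\<forall>y. \<forall>g\<in>W. (\<Sum>e\<in>E. f k e y * e (g *v y)) = (if g = mat 1 then b y * separator k y else 0))" ..
  then have f: "\<And>k e. e \<in> E \<Longrightarrow> polyfn (f k e)"
    "\<And>k y g. g \<in> W \<Longrightarrow> (\<Sum>e\<in>E. f k e y * e (g *v y)) = (if g = mat 1 then b y * separator k y else 0)"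
    by auto
  have consistent: "f k e z * separator k' z = f k' e z * separator k z"
    if "separator k z \<noteq> 0" "e \<in> E" for k k' z e
  proof -
    let ?F = "\<lambda>e z. f k e z * separator k' z - f k' e z * separator k z"
    have "?F e z = 0"
    proof (rule free_point_coefficients_unique[OF basis _ _ that(1,2)])
      show "polyfn (?F e)" if "e \<in> E" for e
        by (intro polyfn_diff polyfn_mult polyfn_separator f(1) that)
      show "(\<Sum>e\<in>E. ?F e y * e (g *v y)) = 0" if "g \<in> W" for y g
      proof -
        have "(\<Sum>e\<in>E. ?F e y * e (g *v y)) =
          separator k' y * (\<Sum>e\<in>E. f k e y * e (g *v y)) - separator k y * (\<Sum>e\<in>E. f k' e y * e (g *v y))"
          by (simp add: sum_distrib_left sum_subtractf algebra_simps)
        then show ?thesis by (simp add: f(2)[OF that])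
      qed
    qed
    then show ?thesis by simp
  qed
  define \<Phi> where "\<Phi> e z = (let k = SOME k. separator k z \<noteq> 0 in f k e z / separator k z)" for e z
  have \<Phi>: "\<Phi> e z = f k e z / separator k z" if "separator k z \<noteq> 0" "e \<in> E" for k e z
  proof -
    define k' where "k' = (SOME k. separator k z \<noteq> 0)"
    have "separator k' z \<noteq> 0" unfolding k'_def using that(1) by (rule someI)
    then show ?thesis
      using consistent[OF that, of k'] that(1) by (simp add: \<Phi>_def k'_def[symmetric] field_simps)
  qed
  have \<Phi>_sum: "(\<Sum>e\<in>E. \<Phi> e z * e (g *v z)) = (if g = mat 1 then b z else 0)"
    if "separator k z \<noteq> 0" "g \<in> W" for k g z
  proof -
    have "(\<Sum>e\<in>E. \<Phi> e z * e (g *v z)) = (\<Sum>e\<in>E. f k e z * e (g *v z)) / separator k z"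
      unfolding sum_divide_distrib using \<Phi>[OF that(1)] by (intro sum.cong) auto
    then show ?thesis using f(2)[OF that(2)] that(1) by simp
  qed
  have "\<exists>B. \<forall>e\<in>E. \<forall>s\<in>{0<..\<epsilon>}. cmod (\<Phi> e (y s 0)) \<le> B"
  proof -
    let ?C = "{0..\<epsilon>} \<times> sphere (0::complex) \<delta>"
    have "\<exists>M. \<forall>p\<in>?C. \<forall>e\<in>E. cmod (f l e (y (fst p) (snd p))) \<le> M"
    proof -
      have "continuous_on ?C (\<lambda>p. \<Sum>e\<in>E. cmod (f l e (y (fst p) (snd p))))"
        by (intro continuous_intros polyfn_continuous[OF f(1)] y_cont) auto
      moreover have "compact ?C" by (intro compact_Times compact_Icc compact_sphere)
      ultimately have "bounded ((\<lambda>p. \<Sum>e\<in>E. cmod (f l e (y (fst p) (snd p)))) ` ?C)"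
        by (intro compact_imp_bounded compact_continuous_image)
      then obtain M where "\<forall>q\<in>(\<lambda>p. \<Sum>e\<in>E. cmod (f l e (y (fst p) (snd p)))) ` ?C. norm q \<le> M"
        unfolding bounded_iff by blast
      then have M: "\<bar>\<Sum>e\<in>E. cmod (f l e (y (fst p) (snd p)))\<bar> \<le> M" if "p \<in> ?C" for p
        using that unfolding real_norm_def by blast
      have "cmod (f l e (y (fst p) (snd p))) \<le> M" if "p \<in> ?C" "e \<in> E" for p e
      proof -
        have "cmod (f l e (y (fst p) (snd p))) \<le> (\<Sum>e\<in>E. cmod (f l e (y (fst p) (snd p))))"
          using finE that(2) by (intro member_le_sum) auto
        then show ?thesis using M[OF that(1)] by linarith
      qed
      then show ?thesis by blast
    qed
    then obtain M where M: "\<And>s t e. \<lbrakk>0 \<le> s; s \<le> \<epsilon>; t \<in> sphere 0 \<delta>; e \<in> E\<rbrakk> \<Longrightarrow> cmod (f l e (y s t)) \<le> M"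
      by force
    have "cmod (\<Phi> e (y s 0)) \<le> M / m" if e: "e \<in> E" and s: "0 < s" "s \<le> \<epsilon>" for e s
    proof -
      let ?\<phi> = "\<lambda>t. \<Phi> e (y s t)"
      define U where "U k = {t. separator k (y s t) \<noteq> 0}" for k
      have openU: "open (U k)" for k
        unfolding U_def
        by (intro open_Collect_neq polyfn_continuous[OF polyfn_separator] y_cont continuous_intros)
      have "?\<phi> holomorphic_on U k" for k
      proof (rule holomorphic_transform)
        show "(\<lambda>t. f k e (y s t) / separator k (y s t)) holomorphic_on U k"
          unfolding y_def
          by (intro holomorphic_on_divide polyfn_line_holomorphic f(1) e polyfn_separator)
            (auto simp: U_def y_def)
        show "f k e (y s t) / separator k (y s t) = ?\<phi> t" if "t \<in> U k" for t
          using \<Phi>[OF _ e] that by (simp add: U_def)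
      qed
      then have hol: "?\<phi> holomorphic_on (\<Union>k. U k)"
        using openU by (intro holomorphic_on_UN_open) auto
      have sub: "cball 0 \<delta> \<subseteq> (\<Union>k. U k)"
      proof
        fix t :: complex assume "t \<in> cball 0 \<delta>"
        then obtain k where "separator k (y s t) \<noteq> 0"
          using exists_separator_nonzero[of "y s t"] free[OF s] by auto
        then show "t \<in> (\<Union>k. U k)" by (auto simp: U_def)
      qed
      show ?thesis
      proof (rule maximum_modulus_frontier[of ?\<phi> "cball 0 \<delta>"])
        show "?\<phi> holomorphic_on interior (cball 0 \<delta>)"
          using hol sub interior_subset by (meson holomorphic_on_subset subset_trans)
        show "continuous_on (closure (cball 0 \<delta>)) ?\<phi>"
          using continuous_on_subset[OF holomorphic_on_imp_continuous_on[OF hol] sub] by simp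
        show "bounded (cball (0::complex) \<delta>)" by simp
        show "0 \<in> cball (0::complex) \<delta>" using \<delta>(1) by simp
        fix t :: complex assume "t \<in> frontier (cball 0 \<delta>)"
        then have t: "t \<in> sphere 0 \<delta>" by simp
        have sm: "m \<le> cmod (separator l (y s t))" using m(2) s \<epsilon>(2) t by simp
        then have "separator l (y s t) \<noteq> 0" using m(1) by auto
        then have "cmod (?\<phi> t) = cmod (f l e (y s t)) / cmod (separator l (y s t))"
          using \<Phi>[OF _ e] by (simp add: norm_divide)
        also have "\<dots> \<le> M / m"
          using M[OF _ s(2) t e] s(1) sm m(1) by (intro frac_le) (auto intro: order_trans[OF norm_ge_zero])
        finally show "cmod (?\<phi> t) \<le> M / m" .
      qed
    qed
    then show ?thesis by (intro exI[of _ "M / m"]) auto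
  qed
  then obtain B where "\<forall>e\<in>E. \<forall>s\<in>{0<..\<epsilon>}. cmod (\<Phi> e (y s 0)) \<le> B" ..
  then have B: "cmod (\<Phi> e (y s 0)) \<le> B" if "e \<in> E" "0 < s" "s \<le> \<epsilon>" for e s
    using that by simp
  \<comment> \<open>The bound for \<open>b\<close> along the centres, as one continuous function, to pass to the limit.\<close>
  define R where "R s = (\<Sum>e\<in>E. B * cmod (e (y s 0) - e (w *v y s 0))) - cmod (b (y s 0))" for s
  have R0: "0 \<le> R s" if s: "0 < s" "s \<le> \<epsilon>" for s
  proof -
    obtain k where k: "separator k (y s 0) \<noteq> 0"
      using exists_separator_nonzero[of "y s 0"] free[OF s, of 0] \<delta>(1) by auto
    have "b (y s 0) = (\<Sum>e\<in>E. \<Phi> e (y s 0) * e (mat 1 *v y s 0)) - (\<Sum>e\<in>E. \<Phi> e (y s 0) * e (w *v y s 0))"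
      unfolding \<Phi>_sum[OF k one_in] \<Phi>_sum[OF k w(1)] using w1 by simp
    also have "\<dots> = (\<Sum>e\<in>E. \<Phi> e (y s 0) * (e (y s 0) - e (w *v y s 0)))"
      by (simp add: right_diff_distrib sum_subtractf)
    also have "cmod \<dots> \<le> (\<Sum>e\<in>E. B * cmod (e (y s 0) - e (w *v y s 0)))"
      using B[OF _ s] by (intro sum_norm_le) (auto simp: norm_mult intro!: mult_right_mono)
    finally show ?thesis by (simp add: R_def)
  qed
  have contR: "continuous_on UNIV R"
    unfolding R_def
    by (intro continuous_intros polyfn_continuous[OF polE] polyfn_continuous[OF invariant_polyfn[OF b(1)]] y_cont) auto
  have "isCont R 0" using contR by (simp add: continuous_on_eq_continuous_at)
  then have "(R \<longlongrightarrow> R 0) (at_right 0)"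
    unfolding isCont_def by (rule filterlim_mono[OF _ order_refl at_le]) simp
  moreover have "eventually (\<lambda>s. 0 \<le> R s) (at_right 0)"
    using \<epsilon>(1) R0 by (auto simp: eventually_at_right intro!: exI[of _ \<epsilon>])
  ultimately have "0 \<le> R 0" by (rule tendsto_lowerbound) simp
  moreover have "R 0 = - cmod (b x)" using w(2) by (simp add: R_def y_def)
  ultimately show False using b(2) by simp
qed


section \<open>The fundamental groupoid\<close>

lemma path_homotopicD:
  assumes "path_homotopic T p q"
  shows "pathin T p" "pathin T q" "q 0 = p 0" "q 1 = p 1"
  using homotopic_with_imp_continuous_maps homotopic_with_imp_property assms
  unfolding path_homotopic_def pathin_def by blast+

lemma path_homotopic_refl: "pathin T p \<Longrightarrow> path_homotopic T p p"
  by (simp add: path_homotopic_def pathin_def)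

lemma path_homotopic_sym: "path_homotopic T p q \<Longrightarrow> path_homotopic T q p"
  using path_homotopicD[of T p q] unfolding path_homotopic_def
  by (simp add: homotopic_with_sym)

lemma path_homotopic_trans:
  "path_homotopic T p q \<Longrightarrow> path_homotopic T q r \<Longrightarrow> path_homotopic T p r"
  using path_homotopicD[of T p q] unfolding path_homotopic_def
  by (auto intro: homotopic_with_trans)

lemma path_homotopic_eq:
  assumes "pathin T p" "\<And>t. t \<in> {0..1} \<Longrightarrow> p t = q t"
  shows "path_homotopic T p q"
  unfolding path_homotopic_def
  using assms by (intro homotopic_with_equal) (auto simp: pathin_def)

lemma homotopy_class_eqI: "path_homotopic T p q \<Longrightarrow> homotopy_class T p = homotopy_class T q"
  unfolding homotopy_class_def using path_homotopic_sym path_homotopic_trans by blast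

lemma homotopy_class_eqD:
  "\<lbrakk>pathin T q; homotopy_class T p = homotopy_class T q\<rbrakk> \<Longrightarrow> path_homotopic T p q"
  unfolding homotopy_class_def using path_homotopic_refl by blast

lemma homotopy_class_cong:
  "\<lbrakk>pathin T p; \<And>t. t \<in> {0..1} \<Longrightarrow> p t = q t\<rbrakk> \<Longrightarrow> homotopy_class T p = homotopy_class T q"
  by (intro homotopy_class_eqI path_homotopic_eq)

lemma mem_homotopy_class: "q \<in> homotopy_class T p \<longleftrightarrow> path_homotopic T p q"
  by (simp add: homotopy_class_def)

lemma homotopy_class_self: "pathin T p \<Longrightarrow> p \<in> homotopy_class T p"
  by (simp add: homotopy_class_def path_homotopic_refl)

text \<open>The straight-line homotopy between the parameter paths. With \<open>K\<close> a path, or a map on a square, all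
  groupoid laws and the naturality of homotopies are instances of this.\<close>

lemma path_homotopic_convex:
  fixes u v :: "real \<Rightarrow> 'c::real_normed_vector"
  assumes K: "continuous_map (top_of_set D) T K" and D: "convex D"
    and u: "continuous_on {0..1} u" "\<And>t. t \<in> {0..1} \<Longrightarrow> u t \<in> D"
    and v: "continuous_on {0..1} v" "\<And>t. t \<in> {0..1} \<Longrightarrow> v t \<in> D"
    and uv: "u 0 = v 0" "u 1 = v 1"
  shows "path_homotopic T (K \<circ> u) (K \<circ> v)"
  unfolding path_homotopic_def homotopic_with_def
proof (intro exI[of _ "K \<circ> (\<lambda>(s, t). (1 - s) *\<^sub>R u t + s *\<^sub>R v t)"] conjI allI ballI)
  have "continuous_on ({0..1} \<times> {0..1}) (\<lambda>(s, t). (1 - s) *\<^sub>R u t + s *\<^sub>R v t)"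
    unfolding case_prod_unfold
    by (intro continuous_intros continuous_on_compose2[OF u(1)] continuous_on_compose2[OF v(1)]) auto
  then have "continuous_map (prod_topology (top_of_set {0..1}) (top_of_set {0..1})) (top_of_set D)
      (\<lambda>(s, t). (1 - s) *\<^sub>R u t + s *\<^sub>R v t)"
    using u(2) v(2) convexD[OF D]
    by (auto simp: prod_topology_subtopology_eu continuous_map_in_subtopology image_subset_iff)
  then show "continuous_map (prod_topology (top_of_set {0..1}) (top_of_set {0..1})) T
      (K \<circ> (\<lambda>(s, t). (1 - s) *\<^sub>R u t + s *\<^sub>R v t))"
    using K by (rule continuous_map_compose)
qed (auto simp: uv algebra_simps simp flip: scaleR_add_left)

lemma comp_path_concat: "f \<circ> path_concat p q = path_concat (f \<circ> p) (f \<circ> q)"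
  by (auto simp: path_concat_def)

lemma comp_path_reverse: "f \<circ> path_reverse p = path_reverse (f \<circ> p)"
  by (auto simp: path_reverse_def)

lemma path_concat_ends [simp]: "path_concat p q 0 = p 0" "path_concat p q 1 = q 1"
  by (auto simp: path_concat_def)

lemma path_reverse_ends [simp]: "path_reverse p 0 = p 1" "path_reverse p 1 = p 0"
  by (auto simp: path_reverse_def)

lemma pathin_comp: "pathin S p \<Longrightarrow> continuous_map S T f \<Longrightarrow> pathin T (f \<circ> p)"
  unfolding pathin_def by (rule continuous_map_compose)

lemma continuous_map_concat:
  fixes f g :: "'s \<times> real \<Rightarrow> 'a"
  assumes f: "continuous_map (prod_topology S (top_of_set {0..1})) T f"
    and g: "continuous_map (prod_topology S (top_of_set {0..1})) T g"
    and fg: "\<And>s. s \<in> topspace S \<Longrightarrow> f (s, 1) = g (s, 0)"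
  shows "continuous_map (prod_topology S (top_of_set {0..1})) T
    (\<lambda>z. if snd z \<le> 1 / 2 then f (fst z, 2 * snd z) else g (fst z, 2 * snd z - 1))"
proof (rule continuous_map_cases_le)
  let ?X = "prod_topology S (top_of_set {0..1::real})"
  have snd_X: "continuous_map (subtopology ?X A) euclideanreal snd" for A
    using continuous_map_snd[of S "top_of_set {0..1::real}"]
    by (intro continuous_map_from_subtopology) (simp add: continuous_map_in_subtopology)
  have fst_X: "continuous_map (subtopology ?X A) S fst" for A
    by (intro continuous_map_from_subtopology continuous_map_fst)
  show "continuous_map ?X euclideanreal snd"
    using snd_X[of UNIV] by simp
  show "continuous_map ?X euclideanreal (\<lambda>z. 1 / 2)" by simp
  show "continuous_map (subtopology ?X {z \<in> topspace ?X. snd z \<le> 1 / 2}) T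
      (\<lambda>z. f (fst z, 2 * snd z))"
  proof (rule continuous_map_compose[OF _ f, unfolded o_def])
    show "continuous_map (subtopology ?X {z \<in> topspace ?X. snd z \<le> 1 / 2}) ?X
        (\<lambda>z. (fst z, 2 * snd z))"
      by (intro continuous_map_pairedI fst_X)
        (auto simp: continuous_map_in_subtopology intro!: continuous_map_real_mult snd_X)
  qed
  show "continuous_map (subtopology ?X {z \<in> topspace ?X. 1 / 2 \<le> snd z}) T
      (\<lambda>z. g (fst z, 2 * snd z - 1))"
  proof (rule continuous_map_compose[OF _ g, unfolded o_def])
    show "continuous_map (subtopology ?X {z \<in> topspace ?X. 1 / 2 \<le> snd z}) ?X
        (\<lambda>z. (fst z, 2 * snd z - 1))"
      by (intro continuous_map_pairedI fst_X)
        (auto simp: continuous_map_in_subtopology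
          intro!: continuous_map_real_mult continuous_map_diff snd_X)
  qed
  show "f (fst z, 2 * snd z) = g (fst z, 2 * snd z - 1)"
    if "z \<in> topspace ?X" "snd z = 1 / 2" for z
  proof -
    have "2 * snd z = 1" "2 * snd z - 1 = 0" "fst z \<in> topspace S" using that by auto
    then show ?thesis using fg by simp
  qed
qed

lemma path_homotopic_concat:
  assumes p: "path_homotopic T p p'" and q: "path_homotopic T q q'" and pq: "p 1 = q 0"
  shows "path_homotopic T (path_concat p q) (path_concat p' q')"
proof -
  let ?I = "top_of_set {0..1::real}"
  obtain h where h: "continuous_map (prod_topology ?I ?I) T h"
    "\<And>t. h (0, t) = p t" "\<And>t. h (1, t) = p' t" "\<And>s. s \<in> {0..1} \<Longrightarrow> h (s, 0) = p 0 \<and> h (s, 1) = p 1"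
    using p unfolding path_homotopic_def homotopic_with_def by blast
  obtain k where k: "continuous_map (prod_topology ?I ?I) T k"
    "\<And>t. k (0, t) = q t" "\<And>t. k (1, t) = q' t" "\<And>s. s \<in> {0..1} \<Longrightarrow> k (s, 0) = q 0 \<and> k (s, 1) = q 1"
    using q unfolding path_homotopic_def homotopic_with_def by blast
  show ?thesis
    unfolding path_homotopic_def homotopic_with_def
  proof (intro exI[of _ "\<lambda>z. if snd z \<le> 1 / 2 then h (fst z, 2 * snd z) else k (fst z, 2 * snd z - 1)"]
        conjI allI ballI)
    show "continuous_map (prod_topology ?I ?I) T
        (\<lambda>z. if snd z \<le> 1 / 2 then h (fst z, 2 * snd z) else k (fst z, 2 * snd z - 1))"
      using h k pq by (intro continuous_map_concat) auto
  qed (use h k in \<open>auto simp: path_concat_def\<close>)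
qed

lemma pathin_concat: "\<lbrakk>pathin T p; pathin T q; p 1 = q 0\<rbrakk> \<Longrightarrow> pathin T (path_concat p q)"
  using path_homotopicD(1) path_homotopic_concat path_homotopic_refl by metis

lemma pathin_reverse:
  assumes "pathin T p" shows "pathin T (path_reverse p)"
proof -
  have "continuous_map (top_of_set {0..1}) (top_of_set {0..1}) (\<lambda>t::real. 1 - t)"
    by (auto simp: continuous_map_in_subtopology intro!: continuous_intros)
  from continuous_map_compose[OF this] assms show ?thesis
    by (simp add: pathin_def path_reverse_def o_def)
qed

lemma path_homotopic_reparam:
  fixes u v :: "real \<Rightarrow> real"
  assumes "pathin T p" "continuous_on {0..1} u" "continuous_on {0..1} v"
    "\<And>t. t \<in> {0..1} \<Longrightarrow> u t \<in> {0..1}" "\<And>t. t \<in> {0..1} \<Longrightarrow> v t \<in> {0..1}"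
    "u 0 = v 0" "u 1 = v 1"
    "\<And>t. t \<in> {0..1} \<Longrightarrow> q t = p (u t)" "\<And>t. t \<in> {0..1} \<Longrightarrow> r t = p (v t)"
  shows "path_homotopic T q r"
proof -
  have *: "path_homotopic T (p \<circ> u) (p \<circ> v)"
    using assms(1) by (intro path_homotopic_convex[where D = "{0..1}"] assms)
      (auto simp: pathin_def)
  have "path_homotopic T (p \<circ> u) q" "path_homotopic T (p \<circ> v) r"
    using path_homotopicD[OF *] assms(8,9) by (auto intro!: path_homotopic_eq)
  then show ?thesis using * path_homotopic_sym path_homotopic_trans by metis
qed

text \<open>The two products run through the same path; \<open>?v\<close> is the piecewise linear change of parameter with
  slopes \<open>1/2\<close>, \<open>1\<close> and \<open>2\<close> that relates them, written with \<open>min\<close> and \<open>max\<close> so that its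
  continuity is syntactic.\<close>

lemma path_homotopic_assoc:
  assumes "pathin T p" "pathin T q" "pathin T r" "p 1 = q 0" "q 1 = r 0"
  shows "path_homotopic T (path_concat (path_concat p q) r) (path_concat p (path_concat q r))"
proof (rule path_homotopic_reparam)
  let ?v = "\<lambda>t::real. max (min (t / 2) (1/4)) (max (min (t - 1/4) (1/2)) (2 * t - 1))"
  show "pathin T (path_concat (path_concat p q) r)"
    using assms by (intro pathin_concat) auto
  show "continuous_on {0..1} (\<lambda>t::real. t)" "continuous_on {0..1} ?v"
    by (auto intro!: continuous_intros)
  show "?v t \<in> {0..1}" if "t \<in> {0..1}" for t
    using that by (auto simp: min_def max_def)
  show "path_concat p (path_concat q r) t = path_concat (path_concat p q) r (?v t)" if "t \<in> {0..1}" for t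
  proof -
    consider "t \<le> 1/2" | "1/2 < t" "t \<le> 3/4" | "3/4 < t" by linarith
    then show ?thesis
    proof cases
      case 1
      then have "?v t = t / 2" using that by (auto simp: min_def max_def)
      then show ?thesis using 1 by (simp add: path_concat_def)
    next
      case 2
      then have "?v t = t - 1/4" by (auto simp: min_def max_def)
      then show ?thesis using 2 by (simp add: path_concat_def algebra_simps)
    next
      case 3
      then have "?v t = 2 * t - 1" using that by (auto simp: min_def max_def)
      then show ?thesis using 3 by (simp add: path_concat_def algebra_simps)
    qed
  qed
qed auto

lemma path_homotopic_const_left:
  assumes "pathin T p" shows "path_homotopic T (path_concat (\<lambda>t. p 0) p) p"
proof (rule path_homotopic_reparam[OF assms, where u = "\<lambda>t. max 0 (2 * t - 1)" and v = "\<lambda>t. t"])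
  show "path_concat (\<lambda>t. p 0) p t = p (max 0 (2 * t - 1))" for t
    by (cases "t \<le> 1/2") (simp_all add: path_concat_def max_absorb1 max_absorb2)
qed (auto intro!: continuous_intros)

lemma path_homotopic_const_right:
  assumes "pathin T p" shows "path_homotopic T (path_concat p (\<lambda>t. p 1)) p"
proof (rule path_homotopic_reparam[OF assms, where u = "\<lambda>t. min 1 (2 * t)" and v = "\<lambda>t. t"])
  show "path_concat p (\<lambda>t. p 1) t = p (min 1 (2 * t))" for t
    by (cases "t \<le> 1/2") (simp_all add: path_concat_def min_absorb1 min_absorb2)
qed (auto intro!: continuous_intros)

lemma path_homotopic_inverse_right:
  assumes "pathin T p" shows "path_homotopic T (path_concat p (path_reverse p)) (\<lambda>t. p 0)"
proof (rule path_homotopic_reparam[OF assms, where u = "\<lambda>t. min (2 * t) (2 - 2 * t)" and v = "\<lambda>t. 0"])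
  show "path_concat p (path_reverse p) t = p (min (2 * t) (2 - 2 * t))" for t
    by (cases "t \<le> 1/2")
      (simp_all add: path_concat_def path_reverse_def min_absorb1 min_absorb2 algebra_simps)
qed (auto intro!: continuous_intros)

lemma path_reverse_reverse [simp]: "path_reverse (path_reverse p) = p"
  by (simp add: path_reverse_def)

lemma path_homotopic_inverse_left:
  "pathin T p \<Longrightarrow> path_homotopic T (path_concat (path_reverse p) p) (\<lambda>t. p 1)"
  using path_homotopic_inverse_right[OF pathin_reverse, of T p] by simp

lemma path_homotopic_reverse:
  assumes "path_homotopic T p q" shows "path_homotopic T (path_reverse p) (path_reverse q)"
proof -
  have "continuous_map (top_of_set {0..1}) (top_of_set {0..1}) (\<lambda>t::real. 1 - t)"
    by (auto simp: continuous_map_in_subtopology intro!: continuous_intros)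
  from homotopic_with_compose_continuous_map_right[OF assms[unfolded path_homotopic_def] this]
  show ?thesis by (simp add: path_homotopic_def path_reverse_def o_def)
qed

text \<open>
  A homotopy class of paths determines its end points, which are read off from any representative
  by \<open>psrc\<close> and \<open>ptgt\<close>. With end points as functions of the class, the groupoid laws become conditional
  rewrite rules whose side conditions can be computed.\<close>

definition pmul :: "'a topology \<Rightarrow> (real \<Rightarrow> 'a) set \<Rightarrow> (real \<Rightarrow> 'a) set \<Rightarrow> (real \<Rightarrow> 'a) set" where
  "pmul T c d = (\<Union>p\<in>c. \<Union>q\<in>d. homotopy_class T (path_concat p q))"

definition pinv :: "'a topology \<Rightarrow> (real \<Rightarrow> 'a) set \<Rightarrow> (real \<Rightarrow> 'a) set" where
  "pinv T c = (\<Union>p\<in>c. homotopy_class T (path_reverse p))"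

definition punit :: "'a topology \<Rightarrow> 'a \<Rightarrow> (real \<Rightarrow> 'a) set" where
  "punit T a = homotopy_class T (\<lambda>t. a)"

definition is_arrow :: "'a topology \<Rightarrow> (real \<Rightarrow> 'a) set \<Rightarrow> bool" where
  "is_arrow T c \<longleftrightarrow> (\<exists>p. pathin T p \<and> c = homotopy_class T p)"

definition psrc :: "(real \<Rightarrow> 'a) set \<Rightarrow> 'a" where
  "psrc c = (SOME p. p \<in> c) 0"

definition ptgt :: "(real \<Rightarrow> 'a) set \<Rightarrow> 'a" where
  "ptgt c = (SOME p. p \<in> c) 1"

lemma is_arrow_class [simp]: "pathin T p \<Longrightarrow> is_arrow T (homotopy_class T p)"
  by (auto simp: is_arrow_def)

lemma arrow_cases:
  assumes "is_arrow T c"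
  obtains p where "pathin T p" "c = homotopy_class T p"
  using assms by (auto simp: is_arrow_def)

lemma psrc_class [simp]: "pathin T p \<Longrightarrow> psrc (homotopy_class T p) = p 0"
  and ptgt_class [simp]: "pathin T p \<Longrightarrow> ptgt (homotopy_class T p) = p 1"
proof -
  assume "pathin T p"
  then have "(SOME q. q \<in> homotopy_class T p) \<in> homotopy_class T p"
    using homotopy_class_self someI_ex[of "\<lambda>q. q \<in> homotopy_class T p"] by blast
  then show "psrc (homotopy_class T p) = p 0" "ptgt (homotopy_class T p) = p 1"
    unfolding psrc_def ptgt_def mem_homotopy_class using path_homotopicD(3,4) by metis+
qed

lemma pmul_class:
  assumes "pathin T p" "pathin T q" "p 1 = q 0"
  shows "pmul T (homotopy_class T p) (homotopy_class T q) = homotopy_class T (path_concat p q)"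
proof -
  have "homotopy_class T (path_concat p' q') = homotopy_class T (path_concat p q)"
    if "p' \<in> homotopy_class T p" "q' \<in> homotopy_class T q" for p' q'
    using that assms(3) path_homotopic_concat homotopy_class_eqI unfolding mem_homotopy_class by metis
  then show ?thesis
    using homotopy_class_self[OF assms(1)] homotopy_class_self[OF assms(2)]
    unfolding pmul_def by blast
qed

lemma pinv_class:
  assumes "pathin T p"
  shows "pinv T (homotopy_class T p) = homotopy_class T (path_reverse p)"
proof -
  have "homotopy_class T (path_reverse p') = homotopy_class T (path_reverse p)"
    if "p' \<in> homotopy_class T p" for p'
    using that path_homotopic_reverse homotopy_class_eqI unfolding mem_homotopy_class by metis
  then show ?thesis using homotopy_class_self[OF assms] unfolding pinv_def by blast
qed

lemma pathin_const_iff: "pathin T (\<lambda>t. a) \<longleftrightarrow> a \<in> topspace T"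
  by (simp add: pathin_def)

lemma punit_arrow [simp]:
  assumes "a \<in> topspace T"
  shows "is_arrow T (punit T a)" "psrc (punit T a) = a" "ptgt (punit T a) = a"
  using assms unfolding punit_def by (simp_all add: pathin_const_iff)

lemma pmul_arrow [simp]:
  assumes "is_arrow T c" "is_arrow T d" "ptgt c = psrc d"
  shows "is_arrow T (pmul T c d)" "psrc (pmul T c d) = psrc c" "ptgt (pmul T c d) = ptgt d"
proof -
  obtain p q where "pathin T p" "c = homotopy_class T p" "pathin T q" "d = homotopy_class T q"
    using assms arrow_cases by metis
  then show "is_arrow T (pmul T c d)" "psrc (pmul T c d) = psrc c" "ptgt (pmul T c d) = ptgt d"
    using assms(3) by (simp_all add: pmul_class pathin_concat)
qed

lemma pinv_arrow [simp]:
  assumes "is_arrow T c"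
  shows "is_arrow T (pinv T c)" "psrc (pinv T c) = ptgt c" "ptgt (pinv T c) = psrc c"
proof -
  obtain p where "pathin T p" "c = homotopy_class T p"
    using assms arrow_cases by metis
  then show "is_arrow T (pinv T c)" "psrc (pinv T c) = ptgt c" "ptgt (pinv T c) = psrc c"
    by (simp_all add: pinv_class pathin_reverse)
qed

lemma pathin_ends: "pathin T p \<Longrightarrow> p 0 \<in> topspace T" "pathin T p \<Longrightarrow> p 1 \<in> topspace T"
  unfolding pathin_def using continuous_map_image_subset_topspace by fastforce+

lemma arrow_ends [simp]: "is_arrow T c \<Longrightarrow> psrc c \<in> topspace T" "is_arrow T c \<Longrightarrow> ptgt c \<in> topspace T"
  by (auto elim!: arrow_cases simp: pathin_ends)

lemma pmul_assoc [simp]: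
  assumes "is_arrow T c" "is_arrow T d" "is_arrow T e" "ptgt c = psrc d" "ptgt d = psrc e"
  shows "pmul T (pmul T c d) e = pmul T c (pmul T d e)"
proof -
  obtain p q r where "pathin T p" "c = homotopy_class T p" "pathin T q" "d = homotopy_class T q"
    "pathin T r" "e = homotopy_class T r"
    using assms arrow_cases by metis
  then show ?thesis
    using assms(4,5)
    by (simp add: pmul_class pathin_concat homotopy_class_eqI[OF path_homotopic_assoc])
qed

lemma pmul_punit_left [simp]: "is_arrow T c \<Longrightarrow> psrc c = a \<Longrightarrow> pmul T (punit T a) c = c"
  by (auto elim!: arrow_cases simp: punit_def pmul_class pathin_const_iff pathin_ends
      homotopy_class_eqI[OF path_homotopic_const_left])

lemma pmul_punit_right [simp]: "is_arrow T c \<Longrightarrow> ptgt c = a \<Longrightarrow> pmul T c (punit T a) = c"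
  by (auto elim!: arrow_cases simp: punit_def pmul_class pathin_const_iff pathin_ends
      homotopy_class_eqI[OF path_homotopic_const_right])

lemma pmul_pinv_left [simp]: "is_arrow T c \<Longrightarrow> pmul T (pinv T c) c = punit T (ptgt c)"
  by (auto elim!: arrow_cases simp: punit_def pinv_class pmul_class pathin_reverse
      homotopy_class_eqI[OF path_homotopic_inverse_left])

lemma pmul_pinv_right [simp]: "is_arrow T c \<Longrightarrow> pmul T c (pinv T c) = punit T (psrc c)"
  by (auto elim!: arrow_cases simp: punit_def pinv_class pmul_class pathin_reverse
      homotopy_class_eqI[OF path_homotopic_inverse_right])

lemma pmul_pinv_left' [simp]:
  assumes "is_arrow T c" "is_arrow T d" "ptgt c = psrc d"
  shows "pmul T (pinv T c) (pmul T c d) = d"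
  using pmul_assoc[of T "pinv T c" c d] assms by (simp del: pmul_assoc)

lemma pmul_pinv_right' [simp]:
  assumes "is_arrow T c" "is_arrow T d" "psrc c = psrc d"
  shows "pmul T c (pmul T (pinv T c) d) = d"
  using pmul_assoc[of T c "pinv T c" d] assms by (simp del: pmul_assoc)

lemma pinv_unique:
  assumes "is_arrow T c" "is_arrow T d" "ptgt c = psrc d" "pmul T c d = punit T (psrc c)" "ptgt d = psrc c"
  shows "d = pinv T c"
  using pmul_pinv_left'[OF assms(1-3)] assms by simp

lemma pinv_pmul [simp]:
  assumes "is_arrow T c" "is_arrow T d" "ptgt c = psrc d"
  shows "pinv T (pmul T c d) = pmul T (pinv T d) (pinv T c)"
  by (rule pinv_unique[symmetric]) (simp_all add: assms)

lemma pinv_pinv [simp]: "is_arrow T c \<Longrightarrow> pinv T (pinv T c) = c"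
  by (rule pinv_unique[symmetric]) simp_all

lemma pinv_punit [simp]: "a \<in> topspace T \<Longrightarrow> pinv T (punit T a) = punit T a"
  by (rule pinv_unique[symmetric]) simp_all

lemma carrier_fundamental_group:
  "c \<in> carrier (fundamental_group T a) \<longleftrightarrow> is_arrow T c \<and> psrc c = a \<and> ptgt c = a"
  unfolding fundamental_group_def loop_at_def is_arrow_def by auto

lemma mult_fundamental_group [simp]: "mult (fundamental_group T a) = pmul T"
  by (simp add: fundamental_group_def pmul_def fun_eq_iff)

lemma one_fundamental_group [simp]: "one (fundamental_group T a) = punit T a"
  by (simp add: fundamental_group_def punit_def)

lemma group_fundamental_group:
  assumes "a \<in> topspace T"
  shows "group (fundamental_group T a)"
proof (rule groupI)
  fix c assume c: "c \<in> carrier (fundamental_group T a)"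
  show "\<exists>d\<in>carrier (fundamental_group T a). d \<otimes>\<^bsub>fundamental_group T a\<^esub> c = \<one>\<^bsub>fundamental_group T a\<^esub>"
    using c by (intro bexI[of _ "pinv T c"]) (auto simp: carrier_fundamental_group)
qed (use assms in \<open>auto simp: carrier_fundamental_group\<close>)

lemma inv_fundamental_group:
  assumes "c \<in> carrier (fundamental_group T a)"
  shows "inv\<^bsub>fundamental_group T a\<^esub> c = pinv T c"
proof -
  have "a \<in> topspace T" using assms by (auto simp: carrier_fundamental_group)
  then interpret group "fundamental_group T a" by (rule group_fundamental_group)
  show ?thesis
    using assms by (intro inv_equality) (auto simp: carrier_fundamental_group)
qed

text \<open>Change of base point, as conjugation in the groupoid.\<close>

definition pconj :: "'a topology \<Rightarrow> (real \<Rightarrow> 'a) set \<Rightarrow> (real \<Rightarrow> 'a) set \<Rightarrow> (real \<Rightarrow> 'a) set" where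
  "pconj T \<gamma> c = pmul T (pinv T \<gamma>) (pmul T c \<gamma>)"

lemma pi1_transport_eq_pconj:
  assumes "pathin T g" "c \<in> carrier (fundamental_group T (g 0))"
  shows "pi1_transport T g c = pconj T (homotopy_class T g) c"
proof -
  obtain p where p: "pathin T p" "c = homotopy_class T p" "p 0 = g 0" "p 1 = g 0"
    using assms(2) by (auto simp: carrier_fundamental_group elim!: arrow_cases)
  have "homotopy_class T (path_concat (path_reverse g) (path_concat q g)) = pconj T (homotopy_class T g) c"
    if "q \<in> c" for q
  proof -
    have "path_homotopic T p q" using that by (simp add: p(2) mem_homotopy_class)
    then have "pathin T q" "q 0 = g 0" "q 1 = g 0" "c = homotopy_class T q"
      using path_homotopicD[of T p q] p homotopy_class_eqI by auto
    then show ?thesis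
      using assms(1) by (simp add: pconj_def pinv_class pmul_class pathin_reverse pathin_concat)
  qed
  moreover have "p \<in> c" using p homotopy_class_self by simp
  ultimately show ?thesis unfolding pi1_transport_def by blast
qed

lemma pconj_carrier:
  assumes "is_arrow T \<gamma>" "c \<in> carrier (fundamental_group T (psrc \<gamma>))"
  shows "pconj T \<gamma> c \<in> carrier (fundamental_group T (ptgt \<gamma>))"
  using assms by (simp add: pconj_def carrier_fundamental_group)

lemma pconj_pmul:
  assumes "is_arrow T \<gamma>" "c \<in> carrier (fundamental_group T (psrc \<gamma>))" "d \<in> carrier (fundamental_group T (psrc \<gamma>))"
  shows "pconj T \<gamma> (pmul T c d) = pmul T (pconj T \<gamma> c) (pconj T \<gamma> d)"
  using assms by (simp add: pconj_def carrier_fundamental_group)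

lemma pconj_pconj:
  assumes "is_arrow T \<gamma>" "is_arrow T \<delta>" "ptgt \<gamma> = psrc \<delta>" "c \<in> carrier (fundamental_group T (psrc \<gamma>))"
  shows "pconj T \<delta> (pconj T \<gamma> c) = pconj T (pmul T \<gamma> \<delta>) c"
  using assms by (simp add: pconj_def carrier_fundamental_group)

lemma pconj_punit:
  assumes "c \<in> carrier (fundamental_group T a)"
  shows "pconj T (punit T a) c = c"
proof -
  have "a \<in> topspace T" using assms by (auto simp: carrier_fundamental_group)
  then show ?thesis using assms by (simp add: pconj_def carrier_fundamental_group)
qed

lemma pconj_group_hom:
  assumes "is_arrow T \<gamma>"
  shows "group_hom (fundamental_group T (psrc \<gamma>)) (fundamental_group T (ptgt \<gamma>)) (pconj T \<gamma>)"
  unfolding group_hom_def group_hom_axioms_def hom_def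
  using assms by (auto simp: group_fundamental_group pconj_carrier pconj_pmul)

lemma pconj_bij:
  assumes "is_arrow T \<gamma>"
  shows "bij_betw (pconj T \<gamma>) (carrier (fundamental_group T (psrc \<gamma>))) (carrier (fundamental_group T (ptgt \<gamma>)))"
proof (rule bij_betw_byWitness[where f' = "pconj T (pinv T \<gamma>)"])
  show "\<forall>c\<in>carrier (fundamental_group T (psrc \<gamma>)). pconj T (pinv T \<gamma>) (pconj T \<gamma> c) = c"
    using assms by (simp add: pconj_pconj pconj_punit)
  show "\<forall>c\<in>carrier (fundamental_group T (ptgt \<gamma>)). pconj T \<gamma> (pconj T (pinv T \<gamma>) c) = c"
    using assms by (simp add: pconj_pconj pconj_punit)
  show "pconj T \<gamma> ` carrier (fundamental_group T (psrc \<gamma>)) \<subseteq> carrier (fundamental_group T (ptgt \<gamma>))"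
    using assms by (auto simp: pconj_carrier)
  show "pconj T (pinv T \<gamma>) ` carrier (fundamental_group T (ptgt \<gamma>)) \<subseteq> carrier (fundamental_group T (psrc \<gamma>))"
    using pconj_carrier[of T "pinv T \<gamma>"] assms by auto
qed

lemma path_homotopic_comp:
  assumes "path_homotopic S p q" "continuous_map S T f"
  shows "path_homotopic T (f \<circ> p) (f \<circ> q)"
  using homotopic_with_compose_continuous_map_left[OF assms(1)[unfolded path_homotopic_def] assms(2)]
  unfolding path_homotopic_def by simp

lemma pi1_map_class:
  assumes "continuous_map S T f" "pathin S p"
  shows "pi1_map T f (homotopy_class S p) = homotopy_class T (f \<circ> p)"
proof -
  have "homotopy_class T (f \<circ> q) = homotopy_class T (f \<circ> p)" if "q \<in> homotopy_class S p" for q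
    using that path_homotopic_comp[OF _ assms(1)] homotopy_class_eqI unfolding mem_homotopy_class by metis
  then show ?thesis using homotopy_class_self[OF assms(2)] unfolding pi1_map_def by blast
qed

lemma pi1_map_arrow:
  assumes "continuous_map S T f" "is_arrow S c"
  shows "is_arrow T (pi1_map T f c)" "psrc (pi1_map T f c) = f (psrc c)" "ptgt (pi1_map T f c) = f (ptgt c)"
  using assms by (auto elim!: arrow_cases simp: pi1_map_class pathin_comp)

lemma pi1_map_pmul:
  assumes "continuous_map S T f" "is_arrow S c" "is_arrow S d" "ptgt c = psrc d"
  shows "pi1_map T f (pmul S c d) = pmul T (pi1_map T f c) (pi1_map T f d)"
  using assms(2-)
  by (auto elim!: arrow_cases
      simp: pi1_map_class[OF assms(1)] pathin_comp[OF _ assms(1)] pmul_class pathin_concat comp_path_concat)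

lemma pi1_map_pinv:
  assumes "continuous_map S T f" "is_arrow S c"
  shows "pi1_map T f (pinv S c) = pinv T (pi1_map T f c)"
  using assms(2-)
  by (auto elim!: arrow_cases
      simp: pi1_map_class[OF assms(1)] pathin_comp[OF _ assms(1)] pinv_class pathin_reverse comp_path_reverse)

lemma pi1_map_comp:
  assumes "continuous_map R S f" "continuous_map S T g" "is_arrow R c"
  shows "pi1_map T g (pi1_map S f c) = pi1_map T (g \<circ> f) c"
  using assms(3)
  by (auto elim!: arrow_cases simp: pi1_map_class[OF assms(1)] pi1_map_class[OF assms(2)]
      pi1_map_class[OF continuous_map_compose[OF assms(1,2)]] pathin_comp[OF _ assms(1)] o_assoc)

lemma pi1_map_group_hom:
  assumes "continuous_map S T f" "a \<in> topspace S"
  shows "group_hom (fundamental_group S a) (fundamental_group T (f a)) (pi1_map T f)"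
  unfolding group_hom_def group_hom_axioms_def hom_def
  using assms continuous_map_image_subset_topspace[OF assms(1)]
  by (auto simp: group_fundamental_group carrier_fundamental_group pi1_map_arrow pi1_map_pmul)

lemma pi1_map_pconj:
  assumes "continuous_map S T f" "is_arrow S \<gamma>" "c \<in> carrier (fundamental_group S (psrc \<gamma>))"
  shows "pi1_map T f (pconj S \<gamma> c) = pconj T (pi1_map T f \<gamma>) (pi1_map T f c)"
  using assms by (simp add: pconj_def carrier_fundamental_group pi1_map_pmul pi1_map_pinv)

text \<open>
  The two ways round the boundary of the square are homotopic in the square, which is convex.\<close>

lemma square_homotopy:
  assumes K: "continuous_map (top_of_set ({0..1} \<times> {0..1})) T K"
  shows "pmul T (homotopy_class T (\<lambda>s. K (s, 0))) (homotopy_class T (\<lambda>t. K (1, t))) =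
    pmul T (homotopy_class T (\<lambda>t. K (0, t))) (homotopy_class T (\<lambda>s. K (s, 1)))"
proof -
  have path: "pathin T (K \<circ> u)"
    if "continuous_on {0..1} u" "\<And>t. t \<in> {0..1} \<Longrightarrow> u t \<in> {0..1} \<times> {0..1}" for u :: "real \<Rightarrow> real \<times> real"
    unfolding pathin_def
    by (rule continuous_map_compose[OF _ K])
      (use that in \<open>auto simp: continuous_map_in_subtopology\<close>)
  let ?l = "\<lambda>s::real. (s, 0::real)" and ?r = "\<lambda>s::real. (s, 1::real)"
    and ?b = "\<lambda>t::real. (0::real, t)" and ?t = "\<lambda>t::real. (1::real, t)"
  have paths: "pathin T (K \<circ> ?l)" "pathin T (K \<circ> ?r)" "pathin T (K \<circ> ?b)" "pathin T (K \<circ> ?t)"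
    by (intro path; force intro!: continuous_intros)+
  have "path_homotopic T (K \<circ> path_concat ?l ?t) (K \<circ> path_concat ?b ?r)"
  proof (rule path_homotopic_convex[OF K])
    show "convex ({0..1::real} \<times> {0..1::real})" by (intro convex_Times) auto
    have cont: "continuous_on {0..1} (path_concat u v)"
      if "continuous_on UNIV u" "continuous_on UNIV v" "u 1 = v 0" for u v :: "real \<Rightarrow> real \<times> real"
      using pathin_concat[of euclidean u v] that continuous_on_subset[OF _ subset_UNIV]
      by (auto simp: pathin_def)
    show "continuous_on {0..1} (path_concat ?l ?t)" "continuous_on {0..1} (path_concat ?b ?r)"
      by (intro cont continuous_intros; simp)+
  qed (auto simp: path_concat_def)
  then have "homotopy_class T (path_concat (K \<circ> ?l) (K \<circ> ?t)) = homotopy_class T (path_concat (K \<circ> ?b) (K \<circ> ?r))"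
    by (simp add: homotopy_class_eqI comp_path_concat)
  then have "pmul T (homotopy_class T (K \<circ> ?l)) (homotopy_class T (K \<circ> ?t)) =
      pmul T (homotopy_class T (K \<circ> ?b)) (homotopy_class T (K \<circ> ?r))"
    using paths by (simp add: pmul_class)
  then show ?thesis by (simp add: o_def)
qed


section \<open>Orbit spaces of free actions\<close>

lemma pathin_top_of_set: "pathin (top_of_set S) p \<longleftrightarrow> path p \<and> path_image p \<subseteq> S"
  by (auto simp: pathin_canon_iff path_image_def)

lemma continuous_map_orbit: "continuous_map (top_of_set S) (orbit_space G S) (mat_orbit G)"
  unfolding orbit_space_def by (rule quotient_imp_continuous_map[OF quotient_map_quotient_topology])

lemma topspace_orbit_space: "topspace (orbit_space G S) = mat_orbit G ` S"
  by (simp add: orbit_space_def topspace_quotient_topology)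

lemma continuous_map_from_orbit_space:
  assumes "continuous_map (top_of_set S) T (f \<circ> mat_orbit G)"
  shows "continuous_map (orbit_space G S) T f"
  using continuous_compose_quotient_map[OF quotient_map_quotient_topology assms]
  unfolding orbit_space_def .

text \<open>Orbits are embedded into a Banach space by their distance functions, truncated at \<open>1\<close> to be
  bounded. The norm distance is then the truncated Hausdorff distance, and lifting theorems for
  covering spaces between normed spaces apply to orbit spaces.\<close>

definition orbit_distance :: "(complex^'n) set \<Rightarrow> (complex^'n) \<Rightarrow>\<^sub>C real" where
  "orbit_distance Q = Bcontfun (\<lambda>z. min 1 (infdist z Q))"

lemma orbit_distance_apply: "apply_bcontfun (orbit_distance Q) z = min 1 (infdist z Q)"
proof -
  have "(\<lambda>z. min 1 (infdist z Q)) \<in> bcontfun"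
    by (rule bcontfun_normI[of _ 1]) (auto intro!: continuous_intros simp: infdist_nonneg)
  then show ?thesis unfolding orbit_distance_def by (simp add: Bcontfun_inverse)
qed

lemma orbit_distance_inject:
  assumes "orbit_distance Q = orbit_distance Q'" "closed Q" "Q \<noteq> {}" "closed Q'" "Q' \<noteq> {}"
  shows "Q = Q'"
proof -
  have *: "z \<in> A \<longleftrightarrow> apply_bcontfun (orbit_distance A) z = 0" if "closed A" "A \<noteq> {}" for A and z :: "complex^'n"
    using in_closed_iff_infdist_zero[OF that, of z] infdist_nonneg[of z A]
    by (auto simp: orbit_distance_apply min_def)
  show ?thesis using *[OF assms(2,3)] *[OF assms(4,5)] assms(1) by auto
qed

context finite_matrix_group
begin

lemma self_in_orbit: "x \<in> mat_orbit G x"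
  unfolding mat_orbit_def using one_in by (force intro: rev_image_eqI)

lemma finite_orbit: "finite (mat_orbit G x)"
  unfolding mat_orbit_def using finite_G by simp

lemma orbit_translate:
  assumes "g \<in> G" shows "mat_orbit G (g *v x) = mat_orbit G x"
proof -
  have "mat_orbit G (g *v x) = (\<lambda>w. w *v x) ` (\<lambda>w. w ** g) ` G"
    by (simp add: mat_orbit_def image_image matrix_vector_mul_assoc)
  then show ?thesis using right_mult_bij[OF assms] by (simp add: mat_orbit_def bij_betw_def)
qed

lemma orbit_eqD:
  assumes "mat_orbit G x = mat_orbit G y"
  obtains g where "g \<in> G" "y = g *v x"
proof -
  have "y \<in> mat_orbit G x" using self_in_orbit assms by simp
  then show ?thesis using that by (auto simp: mat_orbit_def)
qed

definition orbit_embedding :: "complex^'n \<Rightarrow> (complex^'n) \<Rightarrow>\<^sub>C real" where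
  "orbit_embedding x = orbit_distance (mat_orbit G x)"

lemma orbit_distance_orbit_inject:
  "orbit_distance (mat_orbit G x) = orbit_distance (mat_orbit G y) \<Longrightarrow> mat_orbit G x = mat_orbit G y"
  by (rule orbit_distance_inject) (use self_in_orbit finite_orbit finite_imp_closed in auto)

lemma orbit_embedding_translate: "g \<in> G \<Longrightarrow> orbit_embedding (g *v x) = orbit_embedding x"
  by (simp add: orbit_embedding_def orbit_translate)

lemma infdist_orbit_less:
  assumes "infdist z (mat_orbit G x) < e"
  obtains g where "g \<in> G" "dist z (g *v x) < e"
proof -
  obtain q where "q \<in> mat_orbit G x" "infdist z (mat_orbit G x) = dist z q"
    using infdist_attains_inf[of "mat_orbit G x" z] self_in_orbit finite_orbit finite_imp_closed by blast
  then show ?thesis using that assms by (auto simp: mat_orbit_def)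
qed

lemma orbit_embedding_dist_le:
  "dist (orbit_embedding x) (orbit_embedding y) \<le> (\<Sum>g\<in>G. dist (g *v x) (g *v y))"
proof (rule dist_bound)
  fix z
  have *: "infdist z (mat_orbit G x) \<le> infdist z (mat_orbit G y) + (\<Sum>g\<in>G. dist (g *v x) (g *v y))" for x y
  proof -
    obtain q where q: "q \<in> mat_orbit G y" "infdist z (mat_orbit G y) = dist z q"
      using infdist_attains_inf[of "mat_orbit G y" z] self_in_orbit finite_orbit finite_imp_closed by blast
    then obtain g where g: "g \<in> G" "q = g *v y" by (auto simp: mat_orbit_def)
    have "infdist z (mat_orbit G x) \<le> dist z (g *v x)"
      using g(1) by (intro infdist_le) (auto simp: mat_orbit_def)
    also have "\<dots> \<le> dist z q + dist (g *v x) (g *v y)"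
      using dist_triangle[of z "g *v x" q] by (simp add: g(2) dist_commute)
    also have "dist (g *v x) (g *v y) \<le> (\<Sum>g\<in>G. dist (g *v x) (g *v y))"
      using g(1) finite_G by (intro member_le_sum) auto
    finally show ?thesis using q(2) by simp
  qed
  have "(\<Sum>g\<in>G. dist (g *v y) (g *v x)) = (\<Sum>g\<in>G. dist (g *v x) (g *v y))"
    by (simp add: dist_commute)
  then show "dist (orbit_embedding x z) (orbit_embedding y z) \<le> (\<Sum>g\<in>G. dist (g *v x) (g *v y))"
    using *[of x y] *[of y x]
    by (auto simp: orbit_embedding_def orbit_distance_apply dist_real_def min_def abs_le_iff)
qed

lemma continuous_orbit_embedding: "continuous_on S orbit_embedding"
  unfolding continuous_on_def
proof
  fix x assume "x \<in> S"
  have "continuous_on S (\<lambda>y. \<Sum>g\<in>G. dist (g *v y) (g *v x))"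
    by (intro continuous_intros)
  from this[unfolded continuous_on_def, rule_format, OF \<open>x \<in> S\<close>]
  have lim: "((\<lambda>y. \<Sum>g\<in>G. dist (g *v y) (g *v x)) \<longlongrightarrow> 0) (at x within S)" by simp
  have "((\<lambda>y. dist (orbit_embedding y) (orbit_embedding x)) \<longlongrightarrow> 0) (at x within S)"
    by (rule Lim_null_comparison[OF _ lim]) (simp add: orbit_embedding_dist_le)
  then show "(orbit_embedding \<longlongrightarrow> orbit_embedding x) (at x within S)"
    by (rule tendsto_dist_iff[THEN iffD2])
qed

end

locale free_action = finite_matrix_group G for G :: "(complex^'n^'n) set" +
  fixes S :: "(complex^'n) set"
  assumes stable: "\<lbrakk>g \<in> G; x \<in> S\<rbrakk> \<Longrightarrow> g *v x \<in> S"
    and free: "\<lbrakk>g \<in> G; x \<in> S; g *v x = x\<rbrakk> \<Longrightarrow> g = mat 1"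
begin

text \<open>If the distance functions of the orbits of \<open>x\<close> and \<open>y\<close> are close, then evaluating them at \<open>x\<close> shows
  that some translate of \<open>y\<close> is close to \<open>x\<close>.\<close>

lemma orbit_embedding_open:
  assumes U: "openin (top_of_set S) U"
  shows "openin (top_of_set (orbit_embedding ` S)) (orbit_embedding ` U)"
  unfolding openin_euclidean_subtopology_iff
proof (intro conjI ballI)
  show "orbit_embedding ` U \<subseteq> orbit_embedding ` S"
    using openin_subset[OF U] by auto
  fix q assume "q \<in> orbit_embedding ` U"
  then obtain x where x: "x \<in> U" "q = orbit_embedding x" by blast
  obtain e where e: "e > 0" "\<And>x'. \<lbrakk>x' \<in> S; dist x' x < e\<rbrakk> \<Longrightarrow> x' \<in> U"
    using U x(1) unfolding openin_euclidean_subtopology_iff by metis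
  show "\<exists>e>0. \<forall>q'\<in>orbit_embedding ` S. dist q' q < e \<longrightarrow> q' \<in> orbit_embedding ` U"
  proof (intro exI[of _ "min e 1"] conjI ballI impI)
    show "min e 1 > 0" using e(1) by simp
    fix q' assume "q' \<in> orbit_embedding ` S" and d: "dist q' q < min e 1"
    then obtain y where y: "y \<in> S" "q' = orbit_embedding y" by blast
    have "dist (q' x) (q x) < min e 1" using d dist_bounded[of q' x q] by linarith
    moreover have "infdist x (mat_orbit G x) = 0" using self_in_orbit by simp
    then have "q x = 0" by (simp add: x(2) orbit_embedding_def orbit_distance_apply)
    ultimately have "min 1 (infdist x (mat_orbit G y)) < min e 1"
      using infdist_nonneg[of x "mat_orbit G y"]
      by (simp add: y(2) orbit_embedding_def orbit_distance_apply)
    then have "infdist x (mat_orbit G y) < e" by (auto simp: min_def split: if_splits)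
    then obtain g where g: "g \<in> G" "dist x (g *v y) < e" by (rule infdist_orbit_less)
    then have "g *v y \<in> U" using e(2) stable y(1) by (simp add: dist_commute)
    moreover have "orbit_embedding (g *v y) = q'" using orbit_embedding_translate[OF g(1)] y(2) by simp
    ultimately show "q' \<in> orbit_embedding ` U" by blast
  qed
qed

lemma wandering_neighbourhood:
  assumes "x \<in> S"
  obtains B where "open B" "x \<in> B" "\<And>g b. \<lbrakk>g \<in> G; b \<in> B; g *v b \<in> B\<rbrakk> \<Longrightarrow> g = mat 1"
proof -
  have "\<exists>B. open B \<and> x \<in> B \<and> (\<forall>b\<in>B. g *v b \<notin> B)" if g: "g \<in> G - {mat 1}" for g
  proof -
    have "g *v x \<noteq> x" using g free assms by blast
    then obtain V V' where V: "open V" "open V'" "g *v x \<in> V" "x \<in> V'" "V \<inter> V' = {}"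
      by (meson hausdorff)
    have "open ((\<lambda>y. g *v y) -` V)"
      using V(1) by (intro open_vimage continuous_intros)
    then show ?thesis using V by (intro exI[of _ "V' \<inter> (\<lambda>y. g *v y) -` V"]) auto
  qed
  then obtain B where B: "\<And>g. g \<in> G - {mat 1} \<Longrightarrow> open (B g) \<and> x \<in> B g \<and> (\<forall>b\<in>B g. g *v b \<notin> B g)"
    by metis
  show ?thesis
  proof
    show "open (\<Inter>g\<in>G - {mat 1}. B g)" using B finite_G by (intro open_INT) auto
    show "x \<in> (\<Inter>g\<in>G - {mat 1}. B g)" using B by auto
    show "g = mat 1" if "g \<in> G" "b \<in> (\<Inter>g\<in>G - {mat 1}. B g)" "g *v b \<in> (\<Inter>g\<in>G - {mat 1}. B g)" for g b
      using that B[of g] by blast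
  qed
qed

text \<open>Over the image of a neighbourhood that is disjoint from its translates, the sheets are these
  translates.\<close>

lemma covering_space_orbit_embedding: "covering_space S orbit_embedding (orbit_embedding ` S)"
proof
  show "continuous_on S orbit_embedding" by (rule continuous_orbit_embedding)
  fix q assume "q \<in> orbit_embedding ` S"
  then obtain x where x: "x \<in> S" "q = orbit_embedding x" by blast
  obtain B where B: "open B" "x \<in> B" "\<And>g b. \<lbrakk>g \<in> G; b \<in> B; g *v b \<in> B\<rbrakk> \<Longrightarrow> g = mat 1"
    using wandering_neighbourhood[OF x(1)] by metis
  define U where "U = S \<inter> B"
  have U: "openin (top_of_set S) U" unfolding U_def using B(1) by (rule openin_open_Int)
  let ?T = "orbit_embedding ` U"
  let ?v = "(\<lambda>g. (\<lambda>y. g *v y) ` U) ` G"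
  have emb_eq: "\<exists>g\<in>G. z = g *v y" if "orbit_embedding y = orbit_embedding z" for y z
    using orbit_distance_orbit_inject[of y z] that orbit_eqD[of y z] unfolding orbit_embedding_def by metis
  have open_sheet: "openin (top_of_set S) ((\<lambda>y. g *v y) ` U)" if g: "g \<in> G" for g
  proof -
    obtain h where h: "h \<in> G" "h ** g = mat 1" "g ** h = mat 1" using inv_in g by blast
    have 1: "h *v (g *v y) = y" "g *v (h *v y) = y" for y
      using h by (simp_all add: matrix_vector_mul_assoc)
    have "(\<lambda>y. g *v y) ` U = S \<inter> (\<lambda>y. h *v y) -` B"
    proof (intro equalityI subsetI)
      fix y assume "y \<in> S \<inter> (\<lambda>y. h *v y) -` B"
      then have "h *v y \<in> U" using stable h(1) by (simp add: U_def)
      then show "y \<in> (\<lambda>y. g *v y) ` U" using 1(2) by (metis image_eqI)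
    qed (use 1 stable g in \<open>auto simp: U_def\<close>)
    moreover have "open ((\<lambda>y. h *v y) -` B)" using B(1) by (intro open_vimage continuous_intros)
    ultimately show ?thesis by (simp add: openin_open_Int)
  qed
  have 1: "\<Union>?v = S \<inter> orbit_embedding -` ?T"
  proof (intro equalityI subsetI)
    fix y assume "y \<in> S \<inter> orbit_embedding -` ?T"
    then obtain u where u: "u \<in> U" "orbit_embedding u = orbit_embedding y" by force
    then show "y \<in> \<Union>?v" using emb_eq[OF u(2)] by blast
  next
    fix y assume "y \<in> \<Union>?v"
    then obtain g u where "g \<in> G" "u \<in> U" "y = g *v u" by blast
    then show "y \<in> S \<inter> orbit_embedding -` ?T"
      using stable orbit_embedding_translate by (auto simp: U_def)
  qed
  have 2: "pairwise disjnt ?v"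
  proof (rule pairwiseI)
    fix V V' assume "V \<in> ?v" "V' \<in> ?v" "V \<noteq> V'"
    then obtain g g' where g: "g \<in> G" "g' \<in> G" "V = (\<lambda>y. g *v y) ` U" "V' = (\<lambda>y. g' *v y) ` U" "g \<noteq> g'"
      by blast
    obtain h where h: "h \<in> G" "h ** g = mat 1" "g ** h = mat 1" using inv_in g(1) by blast
    show "disjnt V V'"
    proof (rule ccontr)
      assume "\<not> disjnt V V'"
      then obtain u u' where u: "u \<in> U" "u' \<in> U" "g *v u = g' *v u'" using g(3,4) by (auto simp: disjnt_iff)
      have "(h ** g') *v u' = u"
        using u(3) h(2) by (metis matrix_vector_mul_assoc matrix_vector_mul_lid)
      then have "h ** g' = mat 1" using B(3)[of "h ** g'" u'] h(1) g(2) mult_in u by (auto simp: U_def)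
      then have "g = g'" using h(3) by (metis matrix_mul_assoc matrix_mul_lid matrix_mul_rid)
      then show False using g(5) by simp
    qed
  qed
  have 3: "\<exists>r. homeomorphism V ?T orbit_embedding r" if V: "V \<in> ?v" for V
  proof -
    obtain g where g: "g \<in> G" "V = (\<lambda>y. g *v y) ` U" using V by blast
    have oV: "openin (top_of_set S) V" using open_sheet g by simp
    have img: "orbit_embedding ` V = ?T"
      using orbit_embedding_translate[OF g(1)] by (simp add: g(2) image_image)
    have "inj_on orbit_embedding V"
    proof (rule inj_onI)
      fix y z assume "y \<in> V" "z \<in> V" and eq: "orbit_embedding y = orbit_embedding z"
      then obtain u u' where u: "u \<in> U" "u' \<in> U" "y = g *v u" "z = g *v u'" using g(2) by blast
      have "orbit_embedding u = orbit_embedding u'"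
        using eq orbit_embedding_translate[OF g(1)] u by simp
      then obtain k where k: "k \<in> G" "u' = k *v u" using emb_eq by blast
      then have "k = mat 1" using B(3)[of k u] u by (auto simp: U_def)
      then show "y = z" using k u by simp
    qed
    then obtain r where "homeomorphism V ?T orbit_embedding r"
    proof (rule homeomorphism_injective_open_map[OF continuous_orbit_embedding img])
      fix A assume "openin (top_of_set V) A"
      then have "openin (top_of_set S) A" using oV by (rule openin_trans)
      then have "openin (top_of_set (orbit_embedding ` S)) (orbit_embedding ` A)" by (rule orbit_embedding_open)
      moreover have "orbit_embedding ` A \<subseteq> ?T"
        using img openin_imp_subset[OF \<open>openin (top_of_set V) A\<close>] by blast
      moreover have "?T \<subseteq> orbit_embedding ` S" by (auto simp: U_def)
      ultimately show "openin (top_of_set ?T) (orbit_embedding ` A)" by (rule openin_subset_trans)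
    qed
    then show ?thesis by blast
  qed
  have "q \<in> ?T" using x B(2) by (auto simp: U_def)
  moreover have "openin (top_of_set (orbit_embedding ` S)) ?T" using U by (rule orbit_embedding_open)
  moreover have "\<forall>V\<in>?v. openin (top_of_set S) V" using open_sheet by blast
  ultimately show "\<exists>T. q \<in> T \<and> openin (top_of_set (orbit_embedding ` S)) T \<and>
      (\<exists>v. \<Union>v = S \<inter> orbit_embedding -` T \<and> (\<forall>u\<in>v. openin (top_of_set S) u) \<and>
        pairwise disjnt v \<and> (\<forall>u\<in>v. \<exists>q. homeomorphism u T orbit_embedding q))"
    using 1 2 3 by (intro exI[of _ ?T] conjI exI[of _ ?v]) blast+
qed simp

lemma continuous_map_orbit_distance:
  "continuous_map (orbit_space G S) (top_of_set (orbit_embedding ` S)) orbit_distance"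
proof (rule continuous_map_from_orbit_space)
  have "orbit_distance \<circ> mat_orbit G = orbit_embedding"
    by (auto simp: orbit_embedding_def)
  then show "continuous_map (top_of_set S) (top_of_set (orbit_embedding ` S)) (orbit_distance \<circ> mat_orbit G)"
    using continuous_orbit_embedding by (simp add: continuous_map_in_subtopology)
qed

text \<open>
  Paths are pushed forward to the embedded orbit space and lifted there. A lift lives in \<open>S\<close>, and it
  lies over the original path because the embedding is injective on orbits.\<close>

lemma orbit_path_lift:
  assumes \<beta>: "pathin (orbit_space G S) \<beta>" and y: "y \<in> S" "\<beta> 0 = mat_orbit G y"
  obtains p where "pathin (top_of_set S) p" "p 0 = y" "\<And>t. t \<in> {0..1} \<Longrightarrow> mat_orbit G (p t) = \<beta> t"
proof -
  let ?g = "orbit_distance \<circ> \<beta>"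
  have "pathin (top_of_set (orbit_embedding ` S)) ?g"
    using \<beta> continuous_map_orbit_distance by (rule pathin_comp)
  then have g: "path ?g" "path_image ?g \<subseteq> orbit_embedding ` S"
    by (simp_all add: pathin_top_of_set)
  have start: "pathstart ?g = orbit_embedding y"
    by (simp add: pathstart_def y(2) orbit_embedding_def)
  obtain h where h: "path h" "path_image h \<subseteq> S" "pathstart h = y"
    "\<And>t. t \<in> {0..1} \<Longrightarrow> orbit_embedding (h t) = ?g t"
    by (rule covering_space_lift_path_strong[OF covering_space_orbit_embedding y(1) g start]) (rule that; blast)
  show ?thesis
  proof
    show "pathin (top_of_set S) h"
      using h(1,2) by (simp add: pathin_top_of_set)
    show "h 0 = y" using h(3) by (simp add: pathstart_def)
    fix t :: real assume t: "t \<in> {0..1}"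
    have "\<beta> t \<in> topspace (orbit_space G S)"
      using \<beta> t unfolding pathin_def using continuous_map_image_subset_topspace by fastforce
    then obtain z where "\<beta> t = mat_orbit G z" by (auto simp: topspace_orbit_space)
    then show "mat_orbit G (h t) = \<beta> t"
      using h(4)[OF t] orbit_distance_orbit_inject by (simp add: orbit_embedding_def)
  qed
qed

lemma orbit_path_homotopic_lift:
  assumes p: "pathin (top_of_set S) p" and q: "pathin (top_of_set S) q" and pq: "p 0 = q 0"
    and hom: "path_homotopic (orbit_space G S) (mat_orbit G \<circ> p) (mat_orbit G \<circ> q)"
  shows "path_homotopic (top_of_set S) p q"
proof -
  have emb: "orbit_distance \<circ> (mat_orbit G \<circ> r) = orbit_embedding \<circ> r" for r :: "real \<Rightarrow> complex^'n"
    by (auto simp: orbit_embedding_def)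
  have conv: "path r" "path_image r \<subseteq> S" if "pathin (top_of_set S) r" for r
    using that by (simp_all add: pathin_top_of_set)
  have "path_homotopic (top_of_set (orbit_embedding ` S)) (orbit_embedding \<circ> p) (orbit_embedding \<circ> q)"
    using path_homotopic_comp[OF hom continuous_map_orbit_distance] by (simp add: emb)
  then have hp: "homotopic_paths (orbit_embedding ` S) (orbit_embedding \<circ> p) (orbit_embedding \<circ> q)"
    by (simp add: homotopic_paths_def path_homotopic_def pathstart_def pathfinish_def)
  have "homotopic_paths S p q"
    by (rule covering_space_lift_homotopic_paths[OF covering_space_orbit_embedding _ _ _ _ hp])
      (use conv[OF p] conv[OF q] pq continuous_orbit_embedding
        in \<open>auto intro!: path_continuous_image simp: path_image_compose pathstart_def\<close>)
  then show ?thesis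
    by (simp add: homotopic_paths_def path_homotopic_def pathstart_def pathfinish_def)
qed

lemma orbit_arrow_lift:
  assumes c: "is_arrow (orbit_space G S) c" and y: "y \<in> S" "psrc c = mat_orbit G y"
  obtains p where "pathin (top_of_set S) p" "p 0 = y" "c = homotopy_class (orbit_space G S) (mat_orbit G \<circ> p)"
proof -
  obtain \<beta> where \<beta>: "pathin (orbit_space G S) \<beta>" "c = homotopy_class (orbit_space G S) \<beta>"
    using c by (rule arrow_cases)
  then have "\<beta> 0 = mat_orbit G y" using y(2) by simp
  then obtain p where p: "pathin (top_of_set S) p" "p 0 = y" "\<And>t. t \<in> {0..1} \<Longrightarrow> mat_orbit G (p t) = \<beta> t"
    using orbit_path_lift[OF \<beta>(1) y(1)] by metis
  have "c = homotopy_class (orbit_space G S) (mat_orbit G \<circ> p)"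
    unfolding \<beta>(2) using p(3) by (intro homotopy_class_cong[OF \<beta>(1)]) simp
  then show ?thesis using that p by blast
qed

lemma orbit_arrow_faithful:
  assumes p: "pathin (top_of_set S) p" and q: "pathin (top_of_set S) q" and pq: "p 0 = q 0"
    and eq: "homotopy_class (orbit_space G S) (mat_orbit G \<circ> p) = homotopy_class (orbit_space G S) (mat_orbit G \<circ> q)"
  shows "homotopy_class (top_of_set S) p = homotopy_class (top_of_set S) q" "p 1 = q 1"
proof -
  have "path_homotopic (orbit_space G S) (mat_orbit G \<circ> p) (mat_orbit G \<circ> q)"
    using homotopy_class_eqD[OF pathin_comp[OF q continuous_map_orbit] eq] .
  then have "path_homotopic (top_of_set S) p q"
    using orbit_path_homotopic_lift[OF p q pq] by blast
  then show "homotopy_class (top_of_set S) p = homotopy_class (top_of_set S) q" "p 1 = q 1"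
    using homotopy_class_eqI path_homotopicD(4) by metis+
qed

end


section \<open>Homomorphisms of fundamental groups of orbit spaces\<close>

lemma pi1_map_cong:
  assumes "continuous_map S T f" "\<And>x. x \<in> topspace S \<Longrightarrow> f x = g x" "is_arrow S c"
  shows "pi1_map T f c = pi1_map T g c"
proof -
  obtain p where p: "pathin S p" "c = homotopy_class S p" using assms(3) by (rule arrow_cases)
  have g: "continuous_map S T g" using continuous_map_eq[OF assms(1,2)] .
  have "p t \<in> topspace S" if "t \<in> {0..1}" for t
    using p(1) that unfolding pathin_def using continuous_map_image_subset_topspace by fastforce
  then have "homotopy_class T (f \<circ> p) = homotopy_class T (g \<circ> p)"
    using assms(2) by (intro homotopy_class_cong[OF pathin_comp[OF p(1) assms(1)]]) auto
  then show ?thesis using p pi1_map_class[OF assms(1)] pi1_map_class[OF g] by simp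
qed

lemma continuous_map_square_path:
  assumes "continuous_map (top_of_set ({0..1} \<times> {0..1})) T K"
  shows "s \<in> {0..1} \<Longrightarrow> pathin T (\<lambda>t. K (s, t))" "t \<in> {0..1} \<Longrightarrow> pathin T (\<lambda>s. K (s, t))"
proof -
  assume "s \<in> {0..1}"
  then have "continuous_map (top_of_set {0..1}) (top_of_set ({0..1} \<times> {0..1})) (\<lambda>t. (s, t))"
    by (auto simp: continuous_map_in_subtopology intro!: continuous_intros)
  from continuous_map_compose[OF this assms] show "pathin T (\<lambda>t. K (s, t))"
    by (simp add: pathin_def o_def)
next
  assume "t \<in> {0..1}"
  then have "continuous_map (top_of_set {0..1}) (top_of_set ({0..1} \<times> {0..1})) (\<lambda>s. (s, t))"
    by (auto simp: continuous_map_in_subtopology intro!: continuous_intros)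
  from continuous_map_compose[OF this assms] show "pathin T (\<lambda>s. K (s, t))"
    by (simp add: pathin_def o_def)
qed

text \<open>During a free homotopy of loops, the class changes by conjugation with the track of the base
  point.\<close>

lemma loop_homotopy_pconj:
  assumes K: "continuous_map (top_of_set ({0..1} \<times> {0..1})) T K"
    and ends: "\<And>s. s \<in> {0..1} \<Longrightarrow> K (s, 1) = K (s, 0)"
  shows "homotopy_class T (\<lambda>t. K (1, t)) =
    pconj T (homotopy_class T (\<lambda>s. K (s, 0))) (homotopy_class T (\<lambda>t. K (0, t)))"
proof -
  let ?\<tau> = "homotopy_class T (\<lambda>s. K (s, 0))"
  have paths: "pathin T (\<lambda>s. K (s, 0))" "pathin T (\<lambda>t. K (0, t))" "pathin T (\<lambda>t. K (1, t))"
    using continuous_map_square_path[OF K] by auto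
  have "homotopy_class T (\<lambda>s. K (s, 1)) = ?\<tau>"
    using paths(1) ends by (intro homotopy_class_cong[symmetric]) auto
  then have "pmul T ?\<tau> (homotopy_class T (\<lambda>t. K (1, t))) = pmul T (homotopy_class T (\<lambda>t. K (0, t))) ?\<tau>"
    using square_homotopy[OF K] by simp
  then have "pconj T ?\<tau> (homotopy_class T (\<lambda>t. K (0, t))) =
      pmul T (pinv T ?\<tau>) (pmul T ?\<tau> (homotopy_class T (\<lambda>t. K (1, t))))"
    by (simp add: pconj_def)
  then show ?thesis using paths by simp
qed

lemma pi1_map_homotopy:
  assumes H: "continuous_on ({0..1} \<times> S) H" "\<And>s x. \<lbrakk>s \<in> {0..1}; x \<in> S\<rbrakk> \<Longrightarrow> H (s, x) \<in> R"
    and c: "c \<in> carrier (fundamental_group (top_of_set S) y)"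
  shows "pi1_map (top_of_set R) (\<lambda>x. H (1, x)) c =
    pconj (top_of_set R) (homotopy_class (top_of_set R) (\<lambda>s. H (s, y))) (pi1_map (top_of_set R) (\<lambda>x. H (0, x)) c)"
proof -
  obtain p where p: "pathin (top_of_set S) p" "c = homotopy_class (top_of_set S) p" "p 0 = y" "p 1 = y"
    using c by (auto simp: carrier_fundamental_group elim!: arrow_cases)
  have pc: "continuous_on {0..1} p" "\<And>t. t \<in> {0..1} \<Longrightarrow> p t \<in> S"
    using p(1) by (auto simp: pathin_top_of_set path_def path_image_def)
  let ?K = "\<lambda>z. H (fst z, p (snd z))"
  have "continuous_on ({0..1} \<times> {0..1}) ?K"
    by (intro continuous_on_compose2[OF H(1)] continuous_intros continuous_on_compose2[OF pc(1)])
      (use pc(2) in auto)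
  then have K: "continuous_map (top_of_set ({0..1} \<times> {0..1})) (top_of_set R) ?K"
    using H(2) pc(2) by (auto simp: continuous_map_in_subtopology)
  have cont: "continuous_map (top_of_set S) (top_of_set R) (\<lambda>x. H (s, x))" if "s \<in> {0..1}" for s
    using H that
    by (auto simp: continuous_map_in_subtopology intro!: continuous_on_compose2[OF H(1)] continuous_intros)
  show ?thesis
    using loop_homotopy_pconj[OF K] p by (simp add: pi1_map_class[OF cont] o_def)
qed

text \<open>The map of orbit spaces induced by an equivariant map \<open>F\<close>; it does not mention the smaller group,
  because it acts on orbits as sets of points.\<close>

definition orbit_induced :: "(complex^'n^'n) set \<Rightarrow> (complex^'n \<Rightarrow> complex^'n) \<Rightarrow> (complex^'n) set \<Rightarrow> (complex^'n) set" where
  "orbit_induced K F Q = (\<Union>x\<in>Q. mat_orbit K (F x))"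

lemma orbit_coarsen_eq: "orbit_coarsen K = orbit_induced K (\<lambda>x. x)"
  by (auto simp: orbit_coarsen_def orbit_induced_def)

definition derived_subgroup :: "('a, 'b) monoid_scheme \<Rightarrow> 'a set" where
  "derived_subgroup G = derived G (carrier G)"

lemma (in group_hom) derived_subgroup_hom:
  assumes "c \<in> derived_subgroup G" shows "h c \<in> derived_subgroup H"
proof -
  have "h c \<in> h ` derived G (carrier G)" using assms by (simp add: derived_subgroup_def)
  also have "\<dots> = derived H (h ` carrier G)" by (simp add: derived_img)
  also have "\<dots> \<subseteq> derived H (carrier H)" by (intro H.mono_derived) auto
  finally show ?thesis by (simp add: derived_subgroup_def)
qed

lemma (in group) derived_subgroup_carrier: "derived_subgroup G \<subseteq> carrier G"
  unfolding derived_subgroup_def by (rule derived_in_carrier) simp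

lemma comp_in_hom: "f \<in> hom G H \<Longrightarrow> g \<in> hom H K \<Longrightarrow> g \<circ> f \<in> hom G K"
  by (auto simp: hom_def Pi_iff)

text \<open>The composite of \<open>h\<close> with the projection to \<open>H Mod M\<close> has kernel \<open>N\<close>, so the homomorphism theorem
  applies to it.\<close>

lemma group_hom_on_quotients:
  assumes "group_hom G H h" "N \<lhd> G" "M \<lhd> H"
    and ker: "\<And>c. c \<in> carrier G \<Longrightarrow> h c \<in> M \<longleftrightarrow> c \<in> N"
  obtains f where "\<And>c. c \<in> carrier G \<Longrightarrow> f (N #>\<^bsub>G\<^esub> c) = M #>\<^bsub>H\<^esub> h c"
    "group_hom (G Mod N) (H Mod M) f" "inj_on f (carrier (G Mod N))"
proof -
  interpret group_hom G H h by fact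
  interpret N: normal N G by fact
  interpret M: normal M H by fact
  let ?q = "\<lambda>c. M #>\<^bsub>H\<^esub> h c"
  have grpM: "group (H Mod M)" by (rule M.factorgroup_is_group)
  have "(\<lambda>a. M #>\<^bsub>H\<^esub> a) \<circ> h \<in> hom G (H Mod M)"
    using homh M.r_coset_hom_Mod by (rule comp_in_hom)
  then have "?q \<in> hom G (H Mod M)" by (simp add: o_def)
  then interpret q: group_hom G "H Mod M" ?q
    using grpM by (simp add: group_hom_def group_hom_axioms_def)
  have kern: "kernel G (H Mod M) ?q = N"
  proof -
    have "?q c = M \<longleftrightarrow> c \<in> N" if c: "c \<in> carrier G" for c
    proof
      assume "?q c = M"
      then have "h c \<in> M" using H.rcos_self[OF hom_closed[OF c] M.subgroup_axioms] by simp
      then show "c \<in> N" using ker c by simp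
    next
      assume "c \<in> N"
      then show "?q c = M" using ker c H.coset_join2 M.subgroup_axioms by simp
    qed
    then show ?thesis using N.subset by (auto simp: kernel_def FactGroup_def)
  qed
  let ?f = "\<lambda>C. the_elem (?q ` C)"
  have f: "?f (N #>\<^bsub>G\<^esub> c) = ?q c" if c: "c \<in> carrier G" for c
  proof -
    have "?q ` (N #>\<^bsub>G\<^esub> c) = {?q c}"
    proof (intro equalityI subsetI)
      fix Q assume "Q \<in> ?q ` (N #>\<^bsub>G\<^esub> c)"
      then obtain n where n: "n \<in> N" "Q = ?q (n \<otimes>\<^bsub>G\<^esub> c)" by (auto simp: r_coset_def)
      have nc: "n \<in> carrier G" using n(1) N.subset by blast
      have "?q n = \<one>\<^bsub>H Mod M\<^esub>" using n(1) kern by (auto simp: kernel_def)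
      then have "?q (n \<otimes>\<^bsub>G\<^esub> c) = ?q c" using q.hom_mult[OF nc c] q.hom_closed[OF c] q.H.l_one by simp
      then show "Q \<in> {?q c}" using n(2) by simp
    next
      fix Q assume "Q \<in> {?q c}"
      then show "Q \<in> ?q ` (N #>\<^bsub>G\<^esub> c)" using G.rcos_self[OF c N.subgroup_axioms] by blast
    qed
    then show ?thesis by simp
  qed
  show ?thesis
  proof
    show "?f (N #>\<^bsub>G\<^esub> c) = M #>\<^bsub>H\<^esub> h c" if "c \<in> carrier G" for c using f[OF that] .
    show "group_hom (G Mod N) (H Mod M) ?f"
      using q.FactGroup_hom N.factorgroup_is_group grpM unfolding kern
      by (simp add: group_hom_def group_hom_axioms_def)
    show "inj_on ?f (carrier (G Mod N))"
      using q.FactGroup_inj_on unfolding kern .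
  qed
qed

locale free_action_pair = A: free_action G' S' + B: free_action G S
  for G' :: "(complex^'n^'n) set" and S' and G :: "(complex^'n^'n) set" and S +
  assumes G'_sub: "G' \<subseteq> G"
begin

definition equivariant_map :: "(complex^'n \<Rightarrow> complex^'n) \<Rightarrow> bool" where
  "equivariant_map F \<longleftrightarrow> continuous_on S' F \<and> (\<forall>x\<in>S'. F x \<in> S) \<and>
     (\<forall>g\<in>G'. \<forall>x\<in>S'. F (g *v x) = g *v F x)"

lemma equivariant_mapD:
  assumes "equivariant_map F"
  shows "continuous_on S' F" "\<And>x. x \<in> S' \<Longrightarrow> F x \<in> S"
    "\<And>g x. \<lbrakk>g \<in> G'; x \<in> S'\<rbrakk> \<Longrightarrow> F (g *v x) = g *v F x"
    "continuous_map (top_of_set S') (top_of_set S) F"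
  using assms by (auto simp: equivariant_map_def continuous_map_in_subtopology)

abbreviation "TB \<equiv> orbit_space G S"
abbreviation "TB' \<equiv> orbit_space G' S'"

lemma orbit_induced_orbit:
  assumes "equivariant_map F" "x \<in> S'"
  shows "orbit_induced G F (mat_orbit G' x) = mat_orbit G (F x)"
proof -
  have "mat_orbit G (F (g *v x)) = mat_orbit G (F x)" if "g \<in> G'" for g
    using equivariant_mapD(3)[OF assms(1) that assms(2)] B.orbit_translate that G'_sub by auto
  then have "orbit_induced G F (mat_orbit G' x) = (\<Union>g\<in>G'. mat_orbit G (F x))"
    by (simp add: orbit_induced_def mat_orbit_def)
  then show ?thesis using A.one_in by auto
qed

lemma continuous_map_orbit_induced:
  assumes "equivariant_map F"
  shows "continuous_map TB' TB (orbit_induced G F)"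
proof (rule continuous_map_from_orbit_space)
  have "continuous_map (top_of_set S') TB (mat_orbit G \<circ> F)"
    using equivariant_mapD(4)[OF assms] continuous_map_orbit by (rule continuous_map_compose)
  then show "continuous_map (top_of_set S') TB (orbit_induced G F \<circ> mat_orbit G')"
    by (rule continuous_map_eq) (simp add: orbit_induced_orbit[OF assms])
qed

lemma pathin_S'D: "pathin (top_of_set S') p \<Longrightarrow> t \<in> {0..1} \<Longrightarrow> p t \<in> S'"
  by (auto simp: pathin_top_of_set path_image_def)

lemma pi1_map_orbit_induced:
  assumes F: "equivariant_map F" and p: "pathin (top_of_set S') p"
  shows "pi1_map TB (orbit_induced G F) (homotopy_class TB' (mat_orbit G' \<circ> p)) =
    homotopy_class TB (mat_orbit G \<circ> (F \<circ> p))"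
proof -
  have \<pi>p: "pathin TB' (mat_orbit G' \<circ> p)" by (rule pathin_comp[OF p continuous_map_orbit])
  show ?thesis
    unfolding pi1_map_class[OF continuous_map_orbit_induced[OF F] \<pi>p]
    by (rule homotopy_class_cong[OF pathin_comp[OF \<pi>p continuous_map_orbit_induced[OF F]]])
      (use orbit_induced_orbit[OF F] pathin_S'D[OF p] in auto)
qed

text \<open>
  Every standard embedding has this form on \<open>B'\<close>, with \<open>F\<close> a contraction into a small ball and \<open>m\<close> a
  path from \<open>F y\<close> to the base point \<open>x\<close> of \<open>B\<close>.\<close>

definition braid_hom :: "(complex^'n \<Rightarrow> complex^'n) \<Rightarrow> (real \<Rightarrow> complex^'n)
    \<Rightarrow> (real \<Rightarrow> (complex^'n) set) set \<Rightarrow> (real \<Rightarrow> (complex^'n) set) set" where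
  "braid_hom F m c = pconj TB (homotopy_class TB (mat_orbit G \<circ> m)) (pi1_map TB (orbit_induced G F) c)"

definition pure_at :: "complex^'n \<Rightarrow> (real \<Rightarrow> (complex^'n) set) set set" where
  "pure_at x = pi1_map TB (mat_orbit G) ` carrier (fundamental_group (top_of_set S) x)"

definition pure_at' :: "complex^'n \<Rightarrow> (real \<Rightarrow> (complex^'n) set) set set" where
  "pure_at' y = pi1_map TB' (mat_orbit G') ` carrier (fundamental_group (top_of_set S') y)"

abbreviation "\<pi>B x \<equiv> fundamental_group TB (mat_orbit G x)"
abbreviation "\<pi>B' y \<equiv> fundamental_group TB' (mat_orbit G' y)"

lemma base_in_topspace: "x \<in> S \<Longrightarrow> mat_orbit G x \<in> topspace TB"
  "y \<in> S' \<Longrightarrow> mat_orbit G' y \<in> topspace TB'"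
  by (auto simp: topspace_orbit_space)

lemma braid_hom_group_hom:
  assumes F: "equivariant_map F" and y: "y \<in> S'"
    and m: "pathin (top_of_set S) m" "m 0 = F y" "m 1 = x"
  shows "group_hom (\<pi>B' y) (\<pi>B x) (braid_hom F m)"
proof -
  have \<pi>m: "pathin TB (mat_orbit G \<circ> m)" by (rule pathin_comp[OF m(1) continuous_map_orbit])
  interpret f: group_hom "\<pi>B' y" "\<pi>B (F y)" "pi1_map TB (orbit_induced G F)"
    using pi1_map_group_hom[OF continuous_map_orbit_induced[OF F] base_in_topspace(2)[OF y]]
      orbit_induced_orbit[OF F y] by simp
  interpret g: group_hom "\<pi>B (F y)" "\<pi>B x" "pconj TB (homotopy_class TB (mat_orbit G \<circ> m))"
    using pconj_group_hom[OF is_arrow_class[OF \<pi>m]] \<pi>m m by simp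
  have "pconj TB (homotopy_class TB (mat_orbit G \<circ> m)) \<circ> pi1_map TB (orbit_induced G F) \<in> hom (\<pi>B' y) (\<pi>B x)"
    using f.homh g.homh by (rule comp_in_hom)
  then show ?thesis
    unfolding group_hom_def group_hom_axioms_def braid_hom_def
    using f.G.group_axioms g.H.group_axioms by (simp add: o_def)
qed

lemma braid_hom_pure:
  assumes F: "equivariant_map F" and m: "pathin (top_of_set S) m" "m 0 = F y"
    and e: "e \<in> carrier (fundamental_group (top_of_set S') y)"
  shows "braid_hom F m (pi1_map TB' (mat_orbit G') e) =
    pi1_map TB (mat_orbit G) (pconj (top_of_set S) (homotopy_class (top_of_set S) m) (pi1_map (top_of_set S) F e))"
proof -
  note contF = equivariant_mapD(4)[OF F]
  have arr: "is_arrow (top_of_set S') e" "psrc e = y" "ptgt e = y" using e by (auto simp: carrier_fundamental_group)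
  have y: "y \<in> S'" using arrow_ends[OF arr(1)] arr by simp
  have Fe: "pi1_map (top_of_set S) F e \<in> carrier (fundamental_group (top_of_set S) (F y))"
    using arr by (simp add: carrier_fundamental_group pi1_map_arrow[OF contF])
  have "pi1_map TB (orbit_induced G F) (pi1_map TB' (mat_orbit G') e) =
      pi1_map TB (orbit_induced G F \<circ> mat_orbit G') e"
    by (rule pi1_map_comp[OF continuous_map_orbit continuous_map_orbit_induced[OF F] arr(1)])
  also have "\<dots> = pi1_map TB (mat_orbit G \<circ> F) e"
    by (rule pi1_map_cong[OF continuous_map_compose[OF continuous_map_orbit continuous_map_orbit_induced[OF F]]])
      (simp_all add: arr orbit_induced_orbit[OF F])
  also have "\<dots> = pi1_map TB (mat_orbit G) (pi1_map (top_of_set S) F e)"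
    by (rule pi1_map_comp[OF contF continuous_map_orbit arr(1), symmetric])
  finally show ?thesis
    unfolding braid_hom_def
    using m Fe pi1_map_pconj[OF continuous_map_orbit, of S "homotopy_class (top_of_set S) m" _ G]
    by (simp add: pi1_map_class[OF continuous_map_orbit])
qed

lemma pure_at_hom: "x \<in> S \<Longrightarrow> group_hom (fundamental_group (top_of_set S) x) (\<pi>B x) (pi1_map TB (mat_orbit G))"
  by (rule pi1_map_group_hom[OF continuous_map_orbit]) simp

lemma pure_at'_hom: "y \<in> S' \<Longrightarrow> group_hom (fundamental_group (top_of_set S') y) (\<pi>B' y) (pi1_map TB' (mat_orbit G'))"
  by (rule pi1_map_group_hom[OF continuous_map_orbit]) simp

lemma derived_pure_at:
  assumes "x \<in> S"
  shows "derived (\<pi>B x) (pure_at x) =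
    pi1_map TB (mat_orbit G) ` derived_subgroup (fundamental_group (top_of_set S) x)"
  unfolding pure_at_def derived_subgroup_def
  by (rule group_hom.derived_img[OF pure_at_hom[OF assms]]) simp

lemma derived_pure_at':
  assumes "y \<in> S'"
  shows "derived (\<pi>B' y) (pure_at' y) =
    pi1_map TB' (mat_orbit G') ` derived_subgroup (fundamental_group (top_of_set S') y)"
  unfolding pure_at'_def derived_subgroup_def
  by (rule group_hom.derived_img[OF pure_at'_hom[OF assms]]) simp

lemma braid_hom_derived:
  assumes F: "equivariant_map F" and y: "y \<in> S'" and x: "x \<in> S"
    and m: "pathin (top_of_set S) m" "m 0 = F y" "m 1 = x"
    and c: "c \<in> derived (\<pi>B' y) (pure_at' y)"
  shows "braid_hom F m c \<in> derived (\<pi>B x) (pure_at x)"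
proof -
  obtain e where e: "e \<in> derived_subgroup (fundamental_group (top_of_set S') y)" "c = pi1_map TB' (mat_orbit G') e"
    using c unfolding derived_pure_at'[OF y] by blast
  interpret P': group "fundamental_group (top_of_set S') y"
    using y by (intro group_fundamental_group) simp
  have ec: "e \<in> carrier (fundamental_group (top_of_set S') y)" using e(1) P'.derived_subgroup_carrier by blast
  have 1: "group_hom (fundamental_group (top_of_set S') y) (fundamental_group (top_of_set S) (F y)) (pi1_map (top_of_set S) F)"
    using y by (intro pi1_map_group_hom equivariant_mapD(4)[OF F]) simp
  have 2: "group_hom (fundamental_group (top_of_set S) (F y)) (fundamental_group (top_of_set S) x)
      (pconj (top_of_set S) (homotopy_class (top_of_set S) m))"
    using pconj_group_hom[OF is_arrow_class[OF m(1)]] m by simp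
  have "pconj (top_of_set S) (homotopy_class (top_of_set S) m) (pi1_map (top_of_set S) F e)
      \<in> derived_subgroup (fundamental_group (top_of_set S) x)"
    by (intro group_hom.derived_subgroup_hom[OF 2] group_hom.derived_subgroup_hom[OF 1] e(1))
  then show ?thesis
    unfolding e(2) braid_hom_pure[OF F m(1,2) ec] derived_pure_at[OF x] by blast
qed

text \<open>
  The inclusion \<open>S \<subseteq> S'\<close> provides a left inverse on fundamental groups. Lift \<open>c\<close> to a path \<open>p\<close> in \<open>S'\<close>
  from \<open>y\<close> to \<open>g *v y\<close>. Then the image of \<open>c\<close> lifts to the path \<open>n\<close> in \<open>S\<close> from \<open>x\<close> to \<open>g *v x\<close>. As the
  image is also the class of a loop \<open>q\<close> in \<open>S\<close> that is a product of commutators, the uniqueness of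
  lifts gives \<open>g *v x = x\<close>, hence \<open>g = mat 1\<close>, and \<open>n\<close> is homotopic to \<open>q\<close> in \<open>S\<close>. So \<open>F \<circ> p\<close> is a product
  of commutators of loops in \<open>S\<close>, a fortiori in \<open>S'\<close>. There \<open>F\<close> is homotopic to the identity by \<open>H\<close>,
  and the same holds for \<open>p\<close>.\<close>

lemma braid_hom_reflects_derived:
  fixes H :: "real \<times> (complex^'n) \<Rightarrow> complex^'n"
  assumes F: "equivariant_map F" and y: "y \<in> S'" and x: "x \<in> S"
    and m: "pathin (top_of_set S) m" "m 0 = F y" "m 1 = x"
    and SS': "S \<subseteq> S'"
    and H: "continuous_on ({0..1} \<times> S') H" "\<And>s x. \<lbrakk>s \<in> {0..1}; x \<in> S'\<rbrakk> \<Longrightarrow> H (s, x) \<in> S'"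
      "\<And>x. x \<in> S' \<Longrightarrow> H (0, x) = F x" "\<And>x. x \<in> S' \<Longrightarrow> H (1, x) = x"
    and c: "c \<in> carrier (\<pi>B' y)" "braid_hom F m c \<in> derived (\<pi>B x) (pure_at x)"
  shows "c \<in> derived (\<pi>B' y) (pure_at' y)"
proof -
  let ?T = "top_of_set S" and ?T' = "top_of_set S'"
  note contF = equivariant_mapD(4)[OF F]
  have c': "is_arrow TB' c" "psrc c = mat_orbit G' y" "ptgt c = mat_orbit G' y"
    using c(1) by (auto simp: carrier_fundamental_group)
  obtain p where p: "pathin ?T' p" "p 0 = y" "c = homotopy_class TB' (mat_orbit G' \<circ> p)"
    using A.orbit_arrow_lift[OF c'(1) y c'(2)] by metis
  have \<pi>p: "pathin TB' (mat_orbit G' \<circ> p)" by (rule pathin_comp[OF p(1) continuous_map_orbit])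
  have "mat_orbit G' y = mat_orbit G' (p 1)" using c'(3) p(3) \<pi>p by simp
  then obtain g where g: "g \<in> G'" "p 1 = g *v y" by (rule A.orbit_eqD)
  have gG: "g \<in> G" using g G'_sub by blast
  have Fp: "pathin ?T (F \<circ> p)" using p(1) contF by (rule pathin_comp)
  have gcont: "continuous_map ?T ?T (\<lambda>x. g *v x)"
    using B.stable[OF gG] by (auto simp: continuous_map_in_subtopology intro!: continuous_intros)
  define n where "n = path_concat (path_reverse m) (path_concat (F \<circ> p) ((\<lambda>x. g *v x) \<circ> m))"
  have gm: "pathin ?T ((\<lambda>x. g *v x) \<circ> m)" using m(1) gcont by (rule pathin_comp)
  have Fp1: "(F \<circ> p) 1 = g *v F y" using g equivariant_mapD(3)[OF F g(1) y] by simp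
  have n: "pathin ?T n" "n 0 = x" "n 1 = g *v x"
    unfolding n_def using m p(2) gm Fp Fp1 by (auto intro!: pathin_concat pathin_reverse)
  have \<pi>g: "mat_orbit G \<circ> ((\<lambda>x. g *v x) \<circ> m) = mat_orbit G \<circ> m"
    using B.orbit_translate[OF gG] by auto
  note \<pi>cont = continuous_map_orbit[of S G]
  note paths = pathin_comp[OF m(1) \<pi>cont] pathin_comp[OF Fp \<pi>cont]
  have eq: "braid_hom F m c = homotopy_class TB (mat_orbit G \<circ> n)"
  proof -
    have "homotopy_class TB (mat_orbit G \<circ> n) =
        homotopy_class TB (path_concat (path_reverse (mat_orbit G \<circ> m)) (path_concat (mat_orbit G \<circ> (F \<circ> p)) (mat_orbit G \<circ> m)))"
      unfolding n_def comp_path_concat comp_path_reverse \<pi>g ..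
    also have "\<dots> = pconj TB (homotopy_class TB (mat_orbit G \<circ> m)) (homotopy_class TB (mat_orbit G \<circ> (F \<circ> p)))"
    proof -
      have e1: "(mat_orbit G \<circ> (F \<circ> p)) 1 = (mat_orbit G \<circ> m) 0"
        using Fp1 m(2) B.orbit_translate[OF gG] by simp
      have e0: "(mat_orbit G \<circ> (F \<circ> p)) 0 = (mat_orbit G \<circ> m) 0"
        using p(2) m(2) by simp
      show ?thesis
        unfolding pconj_def pinv_class[OF paths(1)] pmul_class[OF paths(2,1) e1]
        using e0 e1 by (subst pmul_class) (auto intro!: pathin_reverse pathin_concat paths)
    qed
    also have "\<dots> = braid_hom F m c"
      unfolding braid_hom_def p(3) pi1_map_orbit_induced[OF F p(1)] ..
    finally show ?thesis by simp
  qed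
  interpret P: group "fundamental_group ?T x"
    using x by (intro group_fundamental_group) simp
  obtain e where e: "e \<in> derived_subgroup (fundamental_group ?T x)" "braid_hom F m c = pi1_map TB (mat_orbit G) e"
    using c(2) unfolding derived_pure_at[OF x] by blast
  have "e \<in> carrier (fundamental_group ?T x)" using e(1) P.derived_subgroup_carrier by blast
  then obtain q where q: "pathin ?T q" "e = homotopy_class ?T q" "q 0 = x" "q 1 = x"
    by (auto simp: carrier_fundamental_group elim!: arrow_cases)
  have hom: "homotopy_class TB (mat_orbit G \<circ> n) = homotopy_class TB (mat_orbit G \<circ> q)"
    using eq e(2) q by (simp add: pi1_map_class[OF \<pi>cont])
  have "n 0 = q 0" using n q by simp
  from B.orbit_arrow_faithful[OF n(1) q(1) this hom]
  have nq: "homotopy_class ?T n = e" and "g *v x = x" using n q by auto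
  then have g1: "g = mat 1" using B.free[OF gG x] by simp
  have p1: "p 1 = y" using g(2) g1 by simp
  have gm1: "(\<lambda>x. g *v x) \<circ> m = m" by (auto simp: g1)
  let ?c = "homotopy_class ?T' p" and ?m = "homotopy_class ?T m"
  have c_car: "?c \<in> carrier (fundamental_group ?T' y)"
    using p p1 by (simp add: carrier_fundamental_group)
  have e_eq: "e = pconj ?T ?m (homotopy_class ?T (F \<circ> p))"
    unfolding nq[symmetric] n_def gm1 pconj_def using m Fp p(2) p1
    by (simp add: pinv_class pmul_class pathin_reverse pathin_concat)
  have Fc_car: "homotopy_class ?T (F \<circ> p) \<in> carrier (fundamental_group ?T (F y))"
    using Fp p(2) p1 by (simp add: carrier_fundamental_group)
  have "pconj ?T (pinv ?T ?m) e = pconj ?T (punit ?T (F y)) (homotopy_class ?T (F \<circ> p))"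
    unfolding e_eq using m Fc_car by (subst pconj_pconj) simp_all
  also have "\<dots> = homotopy_class ?T (F \<circ> p)" by (rule pconj_punit[OF Fc_car])
  finally have Fc: "homotopy_class ?T (F \<circ> p) = pconj ?T (pinv ?T ?m) e" by simp
  have "group_hom (fundamental_group ?T x) (fundamental_group ?T (F y)) (pconj ?T (pinv ?T ?m))"
    using pconj_group_hom[of ?T "pinv ?T ?m"] m by simp
  from group_hom.derived_subgroup_hom[OF this e(1)]
  have 1: "homotopy_class ?T (F \<circ> p) \<in> derived_subgroup (fundamental_group ?T (F y))"
    unfolding Fc .
  have inc: "continuous_map ?T ?T' (\<lambda>x. x)"
    using SS' by (auto simp: continuous_map_in_subtopology)
  have Fy: "F y \<in> S" using equivariant_mapD(2)[OF F y] .
  have "group_hom (fundamental_group ?T (F y)) (fundamental_group ?T' (F y)) (pi1_map ?T' (\<lambda>x. x))"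
    using pi1_map_group_hom[OF inc, of "F y"] Fy by simp
  from group_hom.derived_subgroup_hom[OF this 1]
  have 2: "homotopy_class ?T' (F \<circ> p) \<in> derived_subgroup (fundamental_group ?T' (F y))"
    unfolding pi1_map_class[OF inc Fp] by (simp add: o_def)
  let ?\<tau> = "homotopy_class ?T' (\<lambda>s. H (s, y))"
  have \<tau>: "pathin ?T' (\<lambda>s. H (s, y))"
    unfolding pathin_def continuous_map_in_subtopology
    using H(2) y by (auto intro!: continuous_on_compose2[OF H(1)] continuous_intros)
  have contH: "continuous_map ?T' ?T' (\<lambda>x. H (s, x))" if "s \<in> {0..1}" for s
    using that H(2)
    by (auto simp: continuous_map_in_subtopology intro!: continuous_on_compose2[OF H(1)] continuous_intros)
  have H1: "pi1_map ?T' (\<lambda>x. H (1, x)) ?c = ?c"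
    using H(4) pathin_S'D[OF p(1)] pathin_comp[OF p(1) contH[of 1]]
    by (simp add: pi1_map_class[OF contH p(1)]) (intro homotopy_class_cong; simp)
  have H0: "pi1_map ?T' (\<lambda>x. H (0, x)) ?c = homotopy_class ?T' (F \<circ> p)"
    using H(3) pathin_S'D[OF p(1)] pathin_comp[OF p(1) contH[of 0]]
    by (simp add: pi1_map_class[OF contH p(1)]) (intro homotopy_class_cong; simp)
  have "?c = pconj ?T' ?\<tau> (homotopy_class ?T' (F \<circ> p))"
    using pi1_map_homotopy[OF H(1,2) c_car] by (simp add: H1 H0)
  moreover have "group_hom (fundamental_group ?T' (F y)) (fundamental_group ?T' y) (pconj ?T' ?\<tau>)"
    using pconj_group_hom[OF is_arrow_class[OF \<tau>]] \<tau> H(3,4) y by simp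
  ultimately have "?c \<in> derived_subgroup (fundamental_group ?T' y)"
    using group_hom.derived_subgroup_hom[OF _ 2] by metis
  then show ?thesis
    unfolding derived_pure_at'[OF y] p(3) pi1_map_class[OF continuous_map_orbit p(1), symmetric] by blast
qed

text \<open>A loop in the orbit space lifts to a path \<open>p\<close> from \<open>y\<close> to \<open>g *v y\<close>. By equivariance the tracks of the
  two ends of \<open>p\<close> under \<open>H\<close> have the same image in the orbit space, so the square \<open>?K\<close> is a free
  homotopy of loops.\<close>

lemma braid_hom_homotopy:
  fixes H :: "real \<times> (complex^'n) \<Rightarrow> complex^'n"
  assumes H: "continuous_on ({0..1} \<times> S') H" "\<And>s x. \<lbrakk>s \<in> {0..1}; x \<in> S'\<rbrakk> \<Longrightarrow> H (s, x) \<in> S"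
      "\<And>s g x. \<lbrakk>s \<in> {0..1}; g \<in> G'; x \<in> S'\<rbrakk> \<Longrightarrow> H (s, g *v x) = g *v H (s, x)"
    and y: "y \<in> S'" and c: "c \<in> carrier (\<pi>B' y)"
  shows "pi1_map TB (orbit_induced G (\<lambda>x. H (1, x))) c =
    pconj TB (homotopy_class TB (\<lambda>s. mat_orbit G (H (s, y)))) (pi1_map TB (orbit_induced G (\<lambda>x. H (0, x))) c)"
proof -
  have c': "is_arrow TB' c" "psrc c = mat_orbit G' y" "ptgt c = mat_orbit G' y"
    using c by (auto simp: carrier_fundamental_group)
  obtain p where p: "pathin (top_of_set S') p" "p 0 = y" "c = homotopy_class TB' (mat_orbit G' \<circ> p)"
    using A.orbit_arrow_lift[OF c'(1) y c'(2)] by metis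
  have \<pi>p: "pathin TB' (mat_orbit G' \<circ> p)" by (rule pathin_comp[OF p(1) continuous_map_orbit])
  have "mat_orbit G' y = mat_orbit G' (p 1)" using c'(3) p(3) \<pi>p by simp
  then obtain g where g: "g \<in> G'" "p 1 = g *v y" by (rule A.orbit_eqD)
  have pc: "continuous_on {0..1} p" "\<And>t. t \<in> {0..1} \<Longrightarrow> p t \<in> S'"
    using p(1) by (auto simp: pathin_top_of_set path_def path_image_def)
  let ?K = "\<lambda>z. mat_orbit G (H (fst z, p (snd z)))"
  have "continuous_on ({0..1} \<times> {0..1}) (\<lambda>z. H (fst z, p (snd z)))"
    by (intro continuous_on_compose2[OF H(1)] continuous_intros continuous_on_compose2[OF pc(1)])
      (use pc(2) in auto)
  then have "continuous_map (top_of_set ({0..1} \<times> {0..1})) (top_of_set S) (\<lambda>z. H (fst z, p (snd z)))"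
    using H(2) pc(2) by (auto simp: continuous_map_in_subtopology)
  from continuous_map_compose[OF this continuous_map_orbit]
  have K: "continuous_map (top_of_set ({0..1} \<times> {0..1})) TB ?K" by (simp add: o_def)
  have ends: "?K (s, 1) = ?K (s, 0)" if "s \<in> {0..1}" for s
    using H(3)[OF that g(1) y] B.orbit_translate[of g] g G'_sub p(2) by auto
  have eqv: "equivariant_map (\<lambda>x. H (s, x))" if "s \<in> {0..1}" for s
    unfolding equivariant_map_def using that H
    by (auto intro!: continuous_on_compose2[OF H(1)] continuous_intros)
  have "pi1_map TB (orbit_induced G (\<lambda>x. H (s, x))) c = homotopy_class TB (\<lambda>t. mat_orbit G (H (s, p t)))"
    if "s \<in> {0..1}" for s
    unfolding p(3) pi1_map_orbit_induced[OF eqv[OF that] p(1)] by (simp add: o_def)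
  then show ?thesis
    using loop_homotopy_pconj[OF K ends] p(2) by simp
qed

text \<open>
  The conjugating element is the class of the loop at \<open>x\<close> that runs back along \<open>m0\<close>, along the track
  of \<open>y\<close> and then along \<open>m1\<close>. All three paths lie in \<open>S\<close>, which is why it is pure.\<close>

lemma braid_hom_conjugate:
  fixes H :: "real \<times> (complex^'n) \<Rightarrow> complex^'n"
  assumes H: "continuous_on ({0..1} \<times> S') H" "\<And>s x. \<lbrakk>s \<in> {0..1}; x \<in> S'\<rbrakk> \<Longrightarrow> H (s, x) \<in> S"
      "\<And>s g x. \<lbrakk>s \<in> {0..1}; g \<in> G'; x \<in> S'\<rbrakk> \<Longrightarrow> H (s, g *v x) = g *v H (s, x)"
    and y: "y \<in> S'"
    and m0: "pathin (top_of_set S) m0" "m0 0 = H (0, y)" "m0 1 = x"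
    and m1: "pathin (top_of_set S) m1" "m1 0 = H (1, y)" "m1 1 = x"
  shows "\<exists>\<gamma>\<in>pure_at x. \<forall>c\<in>carrier (\<pi>B' y).
    braid_hom (\<lambda>x. H (1, x)) m1 c = pconj TB \<gamma> (braid_hom (\<lambda>x. H (0, x)) m0 c)"
proof -
  let ?\<tau> = "\<lambda>s. H (s, y)"
  note \<pi>cont = continuous_map_orbit[of S G]
  have \<tau>: "pathin (top_of_set S) ?\<tau>"
    unfolding pathin_def continuous_map_in_subtopology
    using H(2) y by (auto intro!: continuous_on_compose2[OF H(1)] continuous_intros)
  define k where "k = path_concat (path_reverse m0) (path_concat ?\<tau> m1)"
  have k: "pathin (top_of_set S) k" "k 0 = x" "k 1 = x"
    unfolding k_def using \<tau> m0 m1 by (auto intro!: pathin_concat pathin_reverse)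
  let ?\<gamma> = "homotopy_class TB (mat_orbit G \<circ> k)"
  have "?\<gamma> = pi1_map TB (mat_orbit G) (homotopy_class (top_of_set S) k)"
    by (rule pi1_map_class[OF \<pi>cont k(1), symmetric])
  then have pure: "?\<gamma> \<in> pure_at x"
    unfolding pure_at_def using k by (simp add: carrier_fundamental_group)
  let ?m0 = "homotopy_class TB (mat_orbit G \<circ> m0)" and ?m1 = "homotopy_class TB (mat_orbit G \<circ> m1)"
    and ?t = "homotopy_class TB (mat_orbit G \<circ> ?\<tau>)"
  note ps = pathin_comp[OF m0(1) \<pi>cont] pathin_comp[OF m1(1) \<pi>cont] pathin_comp[OF \<tau> \<pi>cont]
  have \<gamma>: "?\<gamma> = pmul TB (pinv TB ?m0) (pmul TB ?t ?m1)"
    unfolding k_def comp_path_concat comp_path_reverse using ps m0 m1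
    by (simp add: pinv_class pmul_class pathin_reverse pathin_concat)
  have eqv: "equivariant_map (\<lambda>x. H (s, x))" if "s \<in> {0..1}" for s
    unfolding equivariant_map_def using that H
    by (auto intro!: continuous_on_compose2[OF H(1)] continuous_intros)
  have "braid_hom (\<lambda>x. H (1, x)) m1 c = pconj TB ?\<gamma> (braid_hom (\<lambda>x. H (0, x)) m0 c)"
    if c: "c \<in> carrier (\<pi>B' y)" for c
  proof -
    let ?c0 = "pi1_map TB (orbit_induced G (\<lambda>x. H (0, x))) c"
    have c0: "?c0 \<in> carrier (\<pi>B (H (0, y)))"
      using c pi1_map_arrow[OF continuous_map_orbit_induced[OF eqv[of 0]], of c]
        orbit_induced_orbit[OF eqv[of 0] y] by (simp add: carrier_fundamental_group)
    have "pconj TB ?\<gamma> (braid_hom (\<lambda>x. H (0, x)) m0 c) = pconj TB ?\<gamma> (pconj TB ?m0 ?c0)"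
      by (simp add: braid_hom_def)
    also have "\<dots> = pconj TB (pmul TB ?m0 ?\<gamma>) ?c0"
      using ps c0 m0 k pathin_comp[OF k(1) \<pi>cont] by (intro pconj_pconj) simp_all
    also have "pmul TB ?m0 ?\<gamma> = pmul TB ?t ?m1"
      unfolding \<gamma> using ps m0 m1 by simp
    also have "pconj TB (pmul TB ?t ?m1) ?c0 = pconj TB ?m1 (pconj TB ?t ?c0)"
      using ps c0 m1 by (intro pconj_pconj[symmetric]) simp_all
    also have "pconj TB ?t ?c0 = pi1_map TB (orbit_induced G (\<lambda>x. H (1, x))) c"
      using braid_hom_homotopy[OF H y c] by (simp add: o_def)
    finally show ?thesis unfolding braid_hom_def by (rule sym)
  qed
  then show ?thesis using pure by blast
qed

text \<open>If \<open>b\<close> lifts to a path \<open>p\<close> from \<open>x\<close> to \<open>g *v x\<close>, then the conjugate by \<open>b\<close> of the class of a loop \<open>q\<close> in \<open>S\<close>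
  lifts to a loop in \<open>S\<close> as well: along \<open>p\<close>, around the translate of \<open>q\<close> by \<open>g\<close>, and back.\<close>

lemma pure_at_normal:
  assumes x: "x \<in> S" shows "pure_at x \<lhd> \<pi>B x"
proof -
  note \<pi>cont = continuous_map_orbit[of S G]
  interpret h: group_hom "fundamental_group (top_of_set S) x" "\<pi>B x" "pi1_map TB (mat_orbit G)"
    using x by (rule pure_at_hom)
  have sub: "subgroup (pure_at x) (\<pi>B x)"
    unfolding pure_at_def by (rule h.img_is_subgroup)
  have "b \<otimes>\<^bsub>\<pi>B x\<^esub> e \<otimes>\<^bsub>\<pi>B x\<^esub> inv\<^bsub>\<pi>B x\<^esub> b \<in> pure_at x"
    if b: "b \<in> carrier (\<pi>B x)" and e: "e \<in> pure_at x" for b e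
  proof -
    have b': "is_arrow TB b" "psrc b = mat_orbit G x" "ptgt b = mat_orbit G x"
      using b by (auto simp: carrier_fundamental_group)
    obtain p where p: "pathin (top_of_set S) p" "p 0 = x" "b = homotopy_class TB (mat_orbit G \<circ> p)"
      using B.orbit_arrow_lift[OF b'(1) x b'(2)] by metis
    note \<pi>p = pathin_comp[OF p(1) \<pi>cont]
    have "mat_orbit G x = mat_orbit G (p 1)" using b'(3) p(3) \<pi>p by simp
    then obtain g where g: "g \<in> G" "p 1 = g *v x" by (rule B.orbit_eqD)
    obtain q where q: "pathin (top_of_set S) q" "q 0 = x" "q 1 = x" "e = homotopy_class TB (mat_orbit G \<circ> q)"
      using e unfolding pure_at_def
      by (auto simp: carrier_fundamental_group pi1_map_class[OF \<pi>cont] elim!: arrow_cases)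
    note \<pi>q = pathin_comp[OF q(1) \<pi>cont]
    have gcont: "continuous_map (top_of_set S) (top_of_set S) (\<lambda>x. g *v x)"
      using B.stable[OF g(1)] by (auto simp: continuous_map_in_subtopology intro!: continuous_intros)
    have gq: "pathin (top_of_set S) ((\<lambda>x. g *v x) \<circ> q)" using q(1) gcont by (rule pathin_comp)
    have \<pi>g: "mat_orbit G \<circ> ((\<lambda>x. g *v x) \<circ> q) = mat_orbit G \<circ> q"
      using B.orbit_translate[OF g(1)] by auto
    define k where "k = path_concat (path_concat p ((\<lambda>x. g *v x) \<circ> q)) (path_reverse p)"
    have k: "pathin (top_of_set S) k" "k 0 = x" "k 1 = x"
      unfolding k_def using p g q gq by (auto intro!: pathin_concat pathin_reverse)
    have ends: "mat_orbit G (p 1) = mat_orbit G x" using g B.orbit_translate by simp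
    have "b \<otimes>\<^bsub>\<pi>B x\<^esub> e \<otimes>\<^bsub>\<pi>B x\<^esub> inv\<^bsub>\<pi>B x\<^esub> b = pmul TB (pmul TB b e) (pinv TB b)"
      by (simp add: inv_fundamental_group[OF b])
    also have "\<dots> = homotopy_class TB (mat_orbit G \<circ> k)"
      unfolding k_def comp_path_concat comp_path_reverse \<pi>g
      using p(2,3) q(2-4) \<pi>p \<pi>q ends
      by (simp add: pinv_class pmul_class pathin_reverse pathin_concat del: pmul_assoc)
    also have "\<dots> = pi1_map TB (mat_orbit G) (homotopy_class (top_of_set S) k)"
      by (rule pi1_map_class[OF \<pi>cont k(1), symmetric])
    also have "\<dots> \<in> pure_at x"
      unfolding pure_at_def using k by (simp add: carrier_fundamental_group)
    finally show ?thesis .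
  qed
  then show ?thesis using sub h.H.normal_inv_iff by blast
qed

end


section \<open>Invariant norms\<close>

definition hnorm :: "(complex^'n \<Rightarrow> complex^'n \<Rightarrow> complex) \<Rightarrow> complex^'n \<Rightarrow> real" where
  "hnorm h x = sqrt (Re (h x x))"

lemma hermitian_ball_iff: "x \<in> hermitian_ball h v r \<longleftrightarrow> hnorm h (x - v) < r"
  by (simp add: hermitian_ball_def hnorm_def)

context
  fixes h :: "complex^'n \<Rightarrow> complex^'n \<Rightarrow> complex"
  assumes h: "hermitian_inner_product h"
begin

lemma hermitian_add: "h (x + y) z = h x z + h y z"
  and hermitian_scale: "h (c *s x) z = c * h x z"
  and hermitian_sym: "h y x = cnj (h x y)"
  and hermitian_pos: "x \<noteq> 0 \<Longrightarrow> 0 < Re (h x x)"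
  using h unfolding hermitian_inner_product_def by blast+

lemma hermitian_zero: "h 0 z = 0"
  using hermitian_scale[of 0 0 z] by simp

lemma hermitian_sum: "h (\<Sum>i\<in>A. f i) z = (\<Sum>i\<in>A. h (f i) z)"
  by (induction A rule: infinite_finite_induct) (simp_all add: hermitian_zero hermitian_add)

lemma hermitian_expand: "h x z = (\<Sum>i\<in>UNIV. x $ i * h (axis i 1) z)"
proof -
  have "h x z = h (\<Sum>i\<in>UNIV. x $ i *s axis i 1) z" by (simp add: basis_expansion)
  then show ?thesis by (simp add: hermitian_sum hermitian_scale)
qed

lemma continuous_hnorm:
  assumes "continuous_on A f" shows "continuous_on A (\<lambda>z. hnorm h (f z))"
proof -
  have "h x x = (\<Sum>i\<in>UNIV. x $ i * cnj (\<Sum>j\<in>UNIV. x $ j * h (axis j 1) (axis i 1)))" for x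
    using hermitian_expand[of x x] hermitian_sym[of "axis _ 1" x] hermitian_expand[of x "axis _ 1"]
    by simp
  then show ?thesis unfolding hnorm_def by (simp only:) (intro continuous_intros assms)
qed

lemma hnorm_nonneg: "0 \<le> hnorm h x"
  using hermitian_pos[of x] hermitian_zero[of 0] by (cases "x = 0") (auto simp: hnorm_def)

lemma hnorm_zero [simp]: "hnorm h 0 = 0"
  by (simp add: hnorm_def hermitian_zero)

lemma hnorm_pos: "x \<noteq> 0 \<Longrightarrow> 0 < hnorm h x"
  using hermitian_pos[of x] by (simp add: hnorm_def)

lemma hnorm_scale: "hnorm h (c *s x) = cmod c * hnorm h x"
proof -
  have "h (c *s x) (c *s x) = c * cnj (c * h x x)"
    using hermitian_scale[of c x "c *s x"] hermitian_sym[of x "c *s x"] hermitian_scale[of c x x] by simp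
  also have "\<dots> = (c * cnj c) * h x x"
    using hermitian_sym[of x x] by simp
  also have "\<dots> = complex_of_real ((cmod c)\<^sup>2) * h x x"
    unfolding complex_norm_square ..
  finally have "Re (h (c *s x) (c *s x)) = (cmod c)\<^sup>2 * Re (h x x)" by (simp del: of_real_power)
  then show ?thesis by (simp add: hnorm_def real_sqrt_mult)
qed

text \<open>By homogeneity it suffices that \<open>hnorm h\<close> has a positive minimum on the unit sphere.\<close>

lemma norm_small_if_hnorm_small:
  assumes "\<delta> > 0"
  obtains \<epsilon> where "\<epsilon> > 0" "\<And>y. hnorm h y \<le> \<epsilon> \<Longrightarrow> norm y < \<delta>"
proof -
  have "continuous_on (sphere 0 1) (hnorm h)" by (rule continuous_hnorm[OF continuous_on_id])
  moreover have "axis undefined 1 \<in> sphere (0 :: complex^'n) 1" by (simp add: norm_axis_1)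
  then have "sphere (0 :: complex^'n) 1 \<noteq> {}" by blast
  ultimately obtain u where u: "norm u = 1" "\<And>x. norm x = 1 \<Longrightarrow> hnorm h u \<le> hnorm h x"
    using continuous_attains_inf[OF compact_sphere, of 0 1 "hnorm h"] by auto
  define m where "m = hnorm h u"
  have m: "m > 0" unfolding m_def using u(1) by (intro hnorm_pos) auto
  have le: "m * norm y \<le> hnorm h y" for y
  proof (cases "y = 0")
    case False
    let ?y = "complex_of_real (1 / norm y) *s y"
    have "norm ?y = 1" using False by (simp add: norm_scalar_mult_vec norm_divide)
    then have "m \<le> hnorm h ?y" unfolding m_def by (rule u(2))
    also have "\<dots> = hnorm h y / norm y" by (simp add: hnorm_scale norm_divide)
    finally show ?thesis using False by (simp add: field_simps)
  qed simp
  show ?thesis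
  proof
    show "m * \<delta> / 2 > 0" using m assms by simp
    fix y assume "hnorm h y \<le> m * \<delta> / 2"
    then have "m * norm y \<le> m * (\<delta> / 2)" using le[of y] by simp
    then have "norm y \<le> \<delta> / 2" using m by simp
    then show "norm y < \<delta>" using assms by simp
  qed
qed

lemma open_hermitian_ball: "open (hermitian_ball h v r)"
proof -
  have "hermitian_ball h v r = {x. hnorm h (x - v) < r}" by (auto simp: hermitian_ball_iff)
  then show ?thesis
    by (simp only:) (intro open_Collect_less continuous_hnorm continuous_intros)
qed

end

lemma invariant_hermitian_exists:
  fixes G :: "(complex^'n^'n) set"
  assumes "finite_matrix_group G"
  obtains h where "hermitian_inner_product h" "\<forall>w\<in>G. \<forall>x y. h (w *v x) (w *v y) = h x y"
proof -
  interpret finite_matrix_group G by fact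
  define h0 :: "complex^'n \<Rightarrow> complex^'n \<Rightarrow> complex" where "h0 x y = (\<Sum>i\<in>UNIV. x $ i * cnj (y $ i))" for x y
  define h where "h x y = (\<Sum>w\<in>G. h0 (w *v x) (w *v y))" for x y
  have h0_re: "Re (h0 x x) = (\<Sum>i\<in>UNIV. (cmod (x $ i))\<^sup>2)" for x
    by (simp add: h0_def complex_mult_cnj cmod_power2)
  have h0_nonneg: "0 \<le> Re (h0 x x)" for x by (simp add: h0_re sum_nonneg)
  have h0_pos: "0 < Re (h0 x x)" if x: "x \<noteq> 0" for x
  proof -
    obtain i where "x $ i \<noteq> 0" using x by (metis vec_eq_iff zero_index)
    then show ?thesis unfolding h0_re by (intro sum_pos2[of _ i]) auto
  qed
  have "hermitian_inner_product h"
    unfolding hermitian_inner_product_def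
  proof (intro conjI allI impI)
    show "h (x + y) z = h x z + h y z" for x y z
      by (simp add: h_def h0_def matrix_vector_right_distrib distrib_right sum.distrib)
    show "h (c *s x) z = c * h x z" for c x z
      by (simp add: h_def h0_def vector_scalar_commute sum_distrib_left mult.assoc)
    show "h y x = cnj (h x y)" for x y
      by (simp add: h_def h0_def mult.commute)
    show "0 < Re (h x x)" if "x \<noteq> 0" for x
    proof -
      have "Re (h x x) = (\<Sum>w\<in>G. Re (h0 (w *v x) (w *v x)))" by (simp add: h_def)
      moreover have "0 < Re (h0 (mat 1 *v x) (mat 1 *v x))" using h0_pos[OF that] by simp
      ultimately show ?thesis
        using sum_pos2[OF finite_G one_in, of "\<lambda>w. Re (h0 (w *v x) (w *v x))"] h0_nonneg by simp
    qed
  qed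
  moreover have "h (w *v x) (w *v y) = h x y" if "w \<in> G" for w x y
    unfolding h_def using sum_right_translate[OF that, of "\<lambda>w. h0 (w *v x) (w *v y)"]
    by (simp add: matrix_vector_mul_assoc)
  ultimately show ?thesis using that by blast
qed

section \<open>Hyperplane complements\<close>

text \<open>A reflection fixes exactly the points of its hyperplane.\<close>

lemma hyperplane_complement_iff:
  "x \<in> hyperplane_complement G \<longleftrightarrow> (\<forall>s\<in>G. pseudo_reflection s \<longrightarrow> s *v x \<noteq> x)"
  using reflection_fixes_iff
  unfolding hyperplane_complement_def reflecting_hyperplanes_def pseudo_reflection_def by blast

lemma reflecting_hyperplane_eq_fixed:
  "is_reflection_along H s \<Longrightarrow> H = {x. s *v x = x}"
  using reflection_fixes_iff by blast

lemma finite_reflecting_hyperplanes: "finite G \<Longrightarrow> finite (reflecting_hyperplanes G)"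
  by (rule finite_subset[of _ "(\<lambda>s. {x. s *v x = x}) ` G"])
    (auto simp: reflecting_hyperplanes_def dest: reflecting_hyperplane_eq_fixed)

lemma reflecting_hyperplane_subspace: "H \<in> reflecting_hyperplanes G \<Longrightarrow> vec.subspace H"
  by (auto simp: reflecting_hyperplanes_def is_reflection_along_def hyperplane_def)

lemma subspace_closed_complex:
  fixes K :: "(complex^'n) set"
  assumes "vec.subspace K" shows "closed K"
proof -
  have "subspace K"
    using assms vec.subspace_add vec.subspace_0 vec.subspace_scale[OF assms, of _ "complex_of_real _"]
    by (auto simp: subspace_def scaleR_vec_def vector_scalar_mult_def scaleR_conv_of_real)
  then show ?thesis by (rule closed_subspace)
qed

lemma path_connected_hyperplane_complement: "finite G \<Longrightarrow> path_connected (hyperplane_complement G)"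
  unfolding hyperplane_complement_def
  using finite_reflecting_hyperplanes reflecting_hyperplane_subspace
  by (intro path_connected_subspace_minus_Union) auto

lemma pseudo_reflection_conjugate:
  fixes g k s :: "complex^'n^'n"
  assumes s: "pseudo_reflection s" and gk: "g ** k = mat 1" "k ** g = mat 1"
  shows "pseudo_reflection (k ** s ** g)"
proof -
  obtain H where H: "is_reflection_along H s" using s pseudo_reflection_def by blast
  have sub: "vec.subspace H" and dim: "vec.dim H + 1 = CARD('n)" and fixH: "\<And>x. x \<in> H \<Longrightarrow> s *v x = x"
    and s1: "s \<noteq> mat 1" "invertible s"
    using H by (auto simp: is_reflection_along_def hyperplane_def)
  have gk': "g *v (k *v x) = x" "k *v (g *v x) = x" for x
    using gk by (simp_all add: matrix_vector_mul_assoc)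
  have lin: "Vector_Spaces.linear (*s) (*s) (\<lambda>x. k *v x)" by (rule matrix_vector_mul_linear_gen)
  have inv: "invertible k" "invertible g" using gk unfolding invertible_def by blast+
  have "is_reflection_along ((\<lambda>x. k *v x) ` H) (k ** s ** g)"
    unfolding is_reflection_along_def hyperplane_def
  proof (intro conjI ballI)
    show "invertible (k ** s ** g)" by (intro invertible_mult inv s1)
    show "k ** s ** g \<noteq> mat 1"
    proof
      assume "k ** s ** g = mat 1"
      then have "g ** (k ** s ** g) ** k = g ** mat 1 ** k" by simp
      then have "s = mat 1" using gk by (simp add: matrix_mul_assoc) (simp add: matrix_mul_assoc[symmetric])
      then show False using s1 by simp
    qed
    show "vec.subspace ((\<lambda>x. k *v x) ` H)" using lin sub by (rule vec.linear_subspace_image)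
    have "inj_on (\<lambda>x. k *v x) (vec.span H)" using gk'(1) by (metis inj_onI)
    then have "vec.dim ((\<lambda>x. k *v x) ` H) = vec.dim H" using lin by (rule vec.dim_image_eq[rotated])
    then show "vec.dim ((\<lambda>x. k *v x) ` H) + 1 = CARD('n)" using dim by simp
    show "(k ** s ** g) *v x = x" if "x \<in> (\<lambda>x. k *v x) ` H" for x
      using that fixH gk' by (auto simp flip: matrix_vector_mul_assoc)
  qed
  then show ?thesis using pseudo_reflection_def by blast
qed

lemma (in finite_matrix_group) hyperplane_complement_stable:
  assumes g: "g \<in> G" and x: "x \<in> hyperplane_complement G"
  shows "g *v x \<in> hyperplane_complement G"
  unfolding hyperplane_complement_iff
proof (intro ballI impI)
  fix s assume s: "s \<in> G" "pseudo_reflection s"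
  obtain k where k: "k \<in> G" "k ** g = mat 1" "g ** k = mat 1" using inv_in g by blast
  have "(k ** s ** g) *v x \<noteq> x"
    using x pseudo_reflection_conjugate[OF s(2) k(3,2)] mult_in k s g unfolding hyperplane_complement_iff by blast
  then show "s *v (g *v x) \<noteq> g *v x"
    using k(2) by (metis matrix_vector_mul_assoc matrix_vector_mul_lid)
qed

section \<open>A parabolic subgroup and its local model\<close>

text \<open>The homothety with centre \<open>u\<close> and ratio \<open>c\<close>. Letting \<open>c\<close> depend on \<open>x\<close> gives the contractions
  towards \<open>u\<close> used below.\<close>

definition radial :: "complex^'n \<Rightarrow> real \<Rightarrow> complex^'n \<Rightarrow> complex^'n" where
  "radial u c x = u + complex_of_real c *s (x - u)"

lemma continuous_on_radial [continuous_intros]: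
  "\<lbrakk>continuous_on A f; continuous_on A c; continuous_on A g\<rbrakk> \<Longrightarrow> continuous_on A (\<lambda>z. radial (f z) (c z) (g z))"
  unfolding radial_def by (intro continuous_intros)

lemma radial_1 [simp]: "radial u 1 x = x"
  by (simp add: radial_def)

text \<open>The ratio that moves \<open>x\<close> radially into the closed ball of radius \<open>\<rho>\<close> about \<open>v\<close> and is \<open>1\<close> on that ball, so
  that \<open>retract h \<rho> v\<close> fixes the points of the ball.\<close>

definition shrink :: "(complex^'n \<Rightarrow> complex^'n \<Rightarrow> complex) \<Rightarrow> real \<Rightarrow> complex^'n \<Rightarrow> complex^'n \<Rightarrow> real" where
  "shrink h \<rho> v x = \<rho> / max \<rho> (hnorm h (x - v))"

definition retract :: "(complex^'n \<Rightarrow> complex^'n \<Rightarrow> complex) \<Rightarrow> real \<Rightarrow> complex^'n \<Rightarrow> complex^'n \<Rightarrow> complex^'n" where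
  "retract h \<rho> v x = radial v (shrink h \<rho> v x) x"

lemma shrink_bounds: "0 < \<rho> \<Longrightarrow> 0 < shrink h \<rho> v x" "0 < \<rho> \<Longrightarrow> shrink h \<rho> v x \<le> 1"
  by (auto simp: shrink_def divide_le_eq)

lemma shrink_eq_1: "\<lbrakk>0 < \<rho>; hnorm h (x - v) \<le> \<rho>\<rbrakk> \<Longrightarrow> shrink h \<rho> v x = 1"
  by (simp add: shrink_def max_absorb1)

lemma shrink_mult_le:
  assumes "hermitian_inner_product h" "0 < \<rho>"
  shows "shrink h \<rho> v x * hnorm h (x - v) \<le> \<rho>"
  using assms(2) hnorm_nonneg[OF assms(1), of "x - v"]
  by (cases "hnorm h (x - v) \<le> \<rho>") (auto simp: shrink_def max_def)

lemma continuous_shrink: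
  assumes "hermitian_inner_product h" "0 < \<rho>" "continuous_on A f" "continuous_on A g"
  shows "continuous_on A (\<lambda>z. shrink h \<rho> (f z) (g z))"
  unfolding shrink_def using assms(2)
  by (intro continuous_intros continuous_hnorm[OF assms(1)] assms) auto

lemma hnorm_radial:
  assumes "hermitian_inner_product h" "0 \<le> c"
  shows "hnorm h (radial v c x - v) = c * hnorm h (x - v)"
proof -
  have "radial v c x - v = complex_of_real c *s (x - v)"
    unfolding radial_def by (simp only: add_diff_cancel_left')
  then show ?thesis using hnorm_scale[OF assms(1), of "complex_of_real c" "x - v"] assms(2) by simp
qed

locale parabolic_pair =
  fixes W W' :: "(complex^'n^'n) set"
  assumes refl: "complex_reflection_group W" and para: "parabolic_subgroup W' W"
begin

abbreviation "X \<equiv> hyperplane_complement W"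
abbreviation "X' \<equiv> hyperplane_complement W'"

lemma W'_sub: "W' \<subseteq> W"
  using para by (auto simp: parabolic_subgroup_def)

sublocale W: finite_matrix_group W
  using refl by (rule finite_matrix_group_if_reflection_group)

sublocale W': finite_matrix_group W'
proof
  obtain S where S: "W' = {w \<in> W. \<forall>x\<in>S. w *v x = x}" using para parabolic_subgroup_def by blast
  show "finite W'" using W.finite_G W'_sub by (rule finite_subset[rotated])
  show "mat 1 \<in> W'" using W.one_in by (simp add: S)
  show "g ** h \<in> W'" if "g \<in> W'" "h \<in> W'" for g h
    using that W.mult_in by (auto simp: S simp flip: matrix_vector_mul_assoc)
  show "\<exists>h\<in>W'. h ** g = mat 1 \<and> g ** h = mat 1" if g: "g \<in> W'" for g
  proof -
    obtain h where h: "h \<in> W" "h ** g = mat 1" "g ** h = mat 1" using W.inv_in g W'_sub by blast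
    have "h *v x = x" if "x \<in> S" for x
    proof -
      have "g *v x = x" using g that by (simp add: S)
      then show ?thesis using h(2) by (metis matrix_vector_mul_assoc matrix_vector_mul_lid)
    qed
    then show ?thesis using h by (auto simp: S)
  qed
qed

definition fixed_space :: "(complex^'n) set" where
  "fixed_space = {x. \<forall>w\<in>W'. w *v x = x}"

lemma subspace_fixed_space: "vec.subspace fixed_space"
  by (rule vec.subspaceI) (auto simp: fixed_space_def matrix_vector_right_distrib vector_scalar_commute)

text \<open>
  The points with stabiliser \<open>W'\<close> in \<open>W\<close>, written as the complement of finitely many proper subspaces
  of \<open>fixed_space\<close>: this form shows that there are such points and that they form a path-connected set.\<close>

definition generic :: "(complex^'n) set" where
  "generic = fixed_space - \<Union>((\<lambda>w. {x. w *v x = x}) ` (W - W'))"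

lemma generic_iff: "v \<in> generic \<longleftrightarrow> {w \<in> W. w *v v = v} = W'"
  using W'_sub unfolding generic_def fixed_space_def by auto

lemma generic_nonempty: "generic \<noteq> {}"
proof -
  obtain S where S: "W' = {w \<in> W. \<forall>x\<in>S. w *v x = x}" using para parabolic_subgroup_def by blast
  then have S_fixed: "S \<subseteq> fixed_space" unfolding fixed_space_def by blast
  have "vec.subspace K \<and> \<not> fixed_space \<subseteq> K" if "K \<in> (\<lambda>w. {x. w *v x = x}) ` (W - W')" for K
  proof -
    obtain w where w: "w \<in> W" "w \<notin> W'" "K = {x. w *v x = x}" using \<open>K \<in> _\<close> by blast
    then show ?thesis using S_fixed S fixed_space_subspace[of w] by auto
  qed
  moreover have "finite ((\<lambda>w. {x. w *v x = x}) ` (W - W'))" using W.finite_G by simp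
  ultimately obtain v where "v \<in> fixed_space" "v \<notin> \<Union>((\<lambda>w. {x. w *v x = x}) ` (W - W'))"
    using subspace_avoids_finite_Union[OF _ subspace_fixed_space, of "(\<lambda>w. {x. w *v x = x}) ` (W - W')"] by blast
  then show ?thesis by (auto simp: generic_def)
qed

lemma generic_path_connected: "path_connected generic"
  unfolding generic_def
  by (rule path_connected_subspace_minus_Union)
    (use W.finite_G subspace_fixed_space fixed_space_subspace in auto)

lemma generic_fixed_space: "v \<in> generic \<Longrightarrow> v \<in> fixed_space"
  by (simp add: generic_def)

lemma reflecting_hyperplanes_mono: "reflecting_hyperplanes W' \<subseteq> reflecting_hyperplanes W"
  using W'_sub by (auto simp: reflecting_hyperplanes_def)

lemma X_subset: "X \<subseteq> X'"
  using reflecting_hyperplanes_mono by (auto simp: hyperplane_complement_def)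

lemma fixed_space_in_hyperplane: "\<lbrakk>H \<in> reflecting_hyperplanes W'; u \<in> fixed_space\<rbrakk> \<Longrightarrow> u \<in> H"
  using reflection_fixes_iff by (auto simp: reflecting_hyperplanes_def fixed_space_def)

lemma generic_in_hyperplane:
  assumes "v \<in> generic" "H \<in> reflecting_hyperplanes W" "v \<in> H"
  shows "H \<in> reflecting_hyperplanes W'"
proof -
  obtain s where s: "s \<in> W" "is_reflection_along H s" using assms(2) by (auto simp: reflecting_hyperplanes_def)
  then have "s *v v = v" using assms(3) reflection_fixes_iff by blast
  then have "s \<in> W'" using s(1) assms(1) generic_iff by blast
  then show ?thesis using s(2) by (auto simp: reflecting_hyperplanes_def)
qed

text \<open>All hyperplanes of \<open>W'\<close> contain \<open>u\<close>, so they are stable under homotheties with centre \<open>u\<close>.\<close>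

lemma radial_X':
  assumes "u \<in> fixed_space" "0 < c" "x \<in> X'"
  shows "radial u c x \<in> X'"
proof -
  have "x \<in> H" if H: "H \<in> reflecting_hyperplanes W'" "radial u c x \<in> H" for H
  proof -
    have sub: "vec.subspace H" using H(1) by (rule reflecting_hyperplane_subspace)
    have u: "u \<in> H" using fixed_space_in_hyperplane[OF H(1) assms(1)] .
    have "radial u c x - u \<in> H" using sub H(2) u by (rule vec.subspace_diff)
    then have "(1 / complex_of_real c) *s (radial u c x - u) \<in> H" using sub vec.subspace_scale by blast
    then have "x - u \<in> H" using assms(2) by (simp add: radial_def vector_smult_assoc del: vec.scale_right_diff_distrib)
    then have "(x - u) + u \<in> H" using u sub vec.subspace_add by blast
    then show ?thesis by simp
  qed
  then show ?thesis using assms(3) by (auto simp: hyperplane_complement_def)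
qed

lemma radial_X:
  assumes "u \<in> fixed_space" "0 < c" "x \<in> X'"
    and "\<And>H. \<lbrakk>H \<in> reflecting_hyperplanes W; H \<notin> reflecting_hyperplanes W'\<rbrakk> \<Longrightarrow> radial u c x \<notin> H"
  shows "radial u c x \<in> X"
  using radial_X'[OF assms(1-3)] assms(4) by (auto simp: hyperplane_complement_def)

lemma radial_equivariant: "\<lbrakk>u \<in> fixed_space; w \<in> W'\<rbrakk> \<Longrightarrow> radial u c (w *v x) = w *v radial u c x"
  by (simp add: radial_def fixed_space_def matrix_vector_right_distrib vector_scalar_commute matrix_vector_mult_diff_distrib)

text \<open>The data of a small ball that determine the homotopy theory: its centre, norm and radius, and that
  only hyperplanes through the centre meet it.\<close>

definition small_data :: "complex^'n \<Rightarrow> (complex^'n \<Rightarrow> complex^'n \<Rightarrow> complex) \<Rightarrow> real \<Rightarrow> bool" where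
  "small_data v h r \<longleftrightarrow> v \<in> generic \<and> hermitian_inner_product h \<and>
     (\<forall>w\<in>W. \<forall>x y. h (w *v x) (w *v y) = h x y) \<and> 0 < r \<and>
     (\<forall>H\<in>reflecting_hyperplanes W. H \<inter> hermitian_ball h v r \<noteq> {} \<longrightarrow> v \<in> H)"

lemma small_ball_data:
  assumes "small_ball W W' \<Omega>"
  obtains v h r where "small_data v h r" "\<Omega> = hermitian_ball h v r"
proof -
  obtain v h r where "{w \<in> W. w *v v = v} = W'" "hermitian_inner_product h"
    "\<forall>w\<in>W. \<forall>x y. h (w *v x) (w *v y) = h x y" "0 < r" "\<Omega> = hermitian_ball h v r"
    "\<forall>H\<in>reflecting_hyperplanes W. H \<inter> \<Omega> \<noteq> {} \<longrightarrow> v \<in> H"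
    using assms unfolding small_ball_def by (elim exE conjE) (rule that; assumption)
  then show ?thesis using generic_iff by (intro that[of v h r]) (auto simp: small_data_def)
qed

lemma small_dataD:
  assumes "small_data v h r"
  shows "v \<in> generic" "v \<in> fixed_space" "hermitian_inner_product h" "0 < r"
    "\<forall>w\<in>W. \<forall>x y. h (w *v x) (w *v y) = h x y"
    "\<And>H z. \<lbrakk>H \<in> reflecting_hyperplanes W; z \<in> H; hnorm h (z - v) < r\<rbrakk> \<Longrightarrow> H \<in> reflecting_hyperplanes W'"
proof -
  show "v \<in> generic" "v \<in> fixed_space" "hermitian_inner_product h" "0 < r"
    "\<forall>w\<in>W. \<forall>x y. h (w *v x) (w *v y) = h x y"
    using assms generic_fixed_space by (auto simp: small_data_def)
  fix H z assume H: "H \<in> reflecting_hyperplanes W" "z \<in> H" "hnorm h (z - v) < r"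
  then have "H \<inter> hermitian_ball h v r \<noteq> {}" by (auto simp: hermitian_ball_iff)
  then have "v \<in> H" using assms H(1) by (auto simp: small_data_def)
  then show "H \<in> reflecting_hyperplanes W'"
    using generic_in_hyperplane \<open>v \<in> generic\<close> H(1) by blast
qed

lemma hnorm_invariant:
  assumes "\<forall>w\<in>W. \<forall>x y. h (w *v x) (w *v y) = h x y" "w \<in> W'" "u \<in> fixed_space"
  shows "hnorm h (w *v x - u) = hnorm h (x - u)"
proof -
  have "w *v x - u = w *v (x - u)" using assms(2,3) by (simp add: fixed_space_def matrix_vector_mult_diff_distrib)
  then show ?thesis using assms(1,2) W'_sub by (auto simp: hnorm_def)
qed

lemma shrink_invariant:
  assumes "\<forall>w\<in>W. \<forall>x y. h (w *v x) (w *v y) = h x y" "w \<in> W'" "u \<in> fixed_space"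
  shows "shrink h \<rho> u (w *v x) = shrink h \<rho> u x"
  unfolding shrink_def using hnorm_invariant[OF assms] by simp

lemma ball_X: "\<lbrakk>small_data v h r; x \<in> hermitian_ball h v r; x \<in> X'\<rbrakk> \<Longrightarrow> x \<in> X"
  using small_dataD(6) unfolding hyperplane_complement_def hermitian_ball_iff by blast

sublocale free_W: free_action W X
proof
  show "g *v x \<in> X" if "g \<in> W" "x \<in> X" for g x
    using W.hyperplane_complement_stable that .
  show "g = mat 1" if "g \<in> W" "x \<in> X" "g *v x = x" for g x
    using reflection_group_acts_freely[OF refl] that by blast
qed

text \<open>
  All conditions on a small ball are satisfied in some neighbourhood of \<open>v\<close>, and balls of an invariant
  norm form a neighbourhood basis.\<close>

lemma small_data_exists:
  assumes v: "v \<in> generic"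
  obtains h r where "small_data v h r" "small_ball W W' (hermitian_ball h v r)"
proof -
  obtain h where h: "hermitian_inner_product h" "\<forall>w\<in>W. \<forall>x y. h (w *v x) (w *v y) = h x y"
    using invariant_hermitian_exists[OF W.finite_matrix_group_axioms] by metis
  let ?A = "\<Union>{H \<in> reflecting_hyperplanes W. v \<notin> H}"
  have "closed ?A"
    using finite_reflecting_hyperplanes[OF W.finite_G] reflecting_hyperplane_subspace subspace_closed_complex
    by (intro closed_Union) auto
  then have "open (- ?A)" by auto
  moreover have "\<exists>B. open B \<and> v \<in> B \<and> (\<forall>b\<in>B. w *v b \<notin> B)" if w: "w \<in> W - W'" for w
  proof -
    have "w *v v \<noteq> v" using w v generic_iff by blast
    then obtain V V' where V: "open V" "open V'" "w *v v \<in> V" "v \<in> V'" "V \<inter> V' = {}" by (meson hausdorff)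
    have "open ((\<lambda>y. w *v y) -` V)" using V(1) by (intro open_vimage continuous_intros)
    then show ?thesis using V by (intro exI[of _ "V' \<inter> (\<lambda>y. w *v y) -` V"]) auto
  qed
  then obtain B where B: "\<And>w. w \<in> W - W' \<Longrightarrow> open (B w) \<and> v \<in> B w \<and> (\<forall>b\<in>B w. w *v b \<notin> B w)" by metis
  have "open (\<Inter>w\<in>W - W'. B w)" using B W.finite_G by (intro open_INT) auto
  ultimately have "open (- ?A \<inter> (\<Inter>w\<in>W - W'. B w))" by (rule open_Int)
  moreover have "v \<in> - ?A \<inter> (\<Inter>w\<in>W - W'. B w)" using B by auto
  ultimately obtain \<delta> where \<delta>: "\<delta> > 0" "ball v \<delta> \<subseteq> - ?A \<inter> (\<Inter>w\<in>W - W'. B w)"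
    by (meson open_contains_ball)
  obtain \<epsilon> where \<epsilon>: "\<epsilon> > 0" "\<And>y. hnorm h y \<le> \<epsilon> \<Longrightarrow> norm y < \<delta>"
    using norm_small_if_hnorm_small[OF h(1) \<delta>(1)] by metis
  have sub: "hermitian_ball h v \<epsilon> \<subseteq> - ?A \<inter> (\<Inter>w\<in>W - W'. B w)"
  proof
    fix x assume "x \<in> hermitian_ball h v \<epsilon>"
    then have "norm (x - v) < \<delta>" using \<epsilon>(2) by (simp add: hermitian_ball_iff)
    then have "x \<in> ball v \<delta>" by (simp add: dist_norm norm_minus_commute)
    then show "x \<in> - ?A \<inter> (\<Inter>w\<in>W - W'. B w)" using \<delta>(2) by blast
  qed
  have 1: "\<forall>H\<in>reflecting_hyperplanes W. H \<inter> hermitian_ball h v \<epsilon> \<noteq> {} \<longrightarrow> v \<in> H"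
    using sub by blast
  have 2: "\<forall>w\<in>W - W'. (\<lambda>x. w *v x) ` hermitian_ball h v \<epsilon> \<inter> hermitian_ball h v \<epsilon> = {}"
  proof
    fix w assume w: "w \<in> W - W'"
    have "w *v b \<notin> hermitian_ball h v \<epsilon>" if "b \<in> hermitian_ball h v \<epsilon>" for b
      using that sub B[OF w] w by blast
    then show "(\<lambda>x. w *v x) ` hermitian_ball h v \<epsilon> \<inter> hermitian_ball h v \<epsilon> = {}" by blast
  qed
  have "small_data v h \<epsilon>"
    using v h \<epsilon>(1) 1 by (simp add: small_data_def)
  moreover have "{w \<in> W. w *v v = v} = W'" using v generic_iff by simp
  then have "small_ball W W' (hermitian_ball h v \<epsilon>)"
    unfolding small_ball_def
    by (intro exI[of _ v] exI[of _ h] exI[of _ \<epsilon>] conjI h \<epsilon>(1) 1 2 HOL.refl)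
  ultimately show ?thesis by (rule that)
qed

lemma retract_in_ball:
  assumes "small_data v h r" "0 < \<rho>" "\<rho> < r"
  shows "retract h \<rho> v x \<in> hermitian_ball h v r"
  using shrink_mult_le[OF small_dataD(3)[OF assms(1)] assms(2), of v x] assms(3)
  unfolding hermitian_ball_iff retract_def
    hnorm_radial[OF small_dataD(3)[OF assms(1)] less_imp_le[OF shrink_bounds(1)[OF assms(2)]]]
  by linarith

lemma retract_X:
  assumes "small_data v h r" "0 < \<rho>" "\<rho> < r" "x \<in> X'"
  shows "retract h \<rho> v x \<in> X"
  using ball_X[OF assms(1) retract_in_ball[OF assms(1-3)]]
    radial_X'[OF small_dataD(2)[OF assms(1)] shrink_bounds(1)[OF assms(2)] assms(4)]
  unfolding retract_def by blast

lemma retract_equivariant: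
  assumes "small_data v h r" "w \<in> W'"
  shows "retract h \<rho> v (w *v x) = w *v retract h \<rho> v x"
  unfolding retract_def
  using shrink_invariant[OF small_dataD(5)[OF assms(1)] assms(2) small_dataD(2)[OF assms(1)]]
    radial_equivariant[OF small_dataD(2)[OF assms(1)] assms(2)] by simp

lemma continuous_retract:
  assumes "small_data v h r" "0 < \<rho>"
  shows "continuous_on A (retract h \<rho> v)"
  unfolding retract_def
  by (intro continuous_intros continuous_shrink[OF small_dataD(3)[OF assms(1)] assms(2)])

text \<open>
  The contraction is equivariant, so an element of \<open>W'\<close> that fixes a point of \<open>X'\<close> also fixes its image
  in \<open>X\<close>, where \<open>W\<close> acts freely.\<close>

sublocale free_W': free_action W' X'
proof
  show "g *v x \<in> X'" if "g \<in> W'" "x \<in> X'" for g x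
    using W'.hyperplane_complement_stable that .
  show "g = mat 1" if g: "g \<in> W'" and x: "x \<in> X'" "g *v x = x" for g x
  proof -
    obtain v where "v \<in> generic" using generic_nonempty by blast
    then obtain h r where d: "small_data v h r" using small_data_exists by metis
    have r: "0 < r / 2" "r / 2 < r" using small_dataD(4)[OF d] by auto
    have "g *v retract h (r / 2) v x = retract h (r / 2) v x"
      using retract_equivariant[OF d g, of "r / 2" x] x(2) by simp
    then show ?thesis
      using free_W.free retract_X[OF d r x(1)] g W'_sub by blast
  qed
qed

sublocale pair: free_action_pair W' X' W X
  by unfold_locales (rule W'_sub)

lemma retract_equivariant_map:
  assumes "small_data v h r" "0 < \<rho>" "\<rho> < r"
  shows "pair.equivariant_map (retract h \<rho> v)"
  unfolding pair.equivariant_map_def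
  using continuous_retract[OF assms(1,2)] retract_X[OF assms] retract_equivariant[OF assms(1)] by blast

end


section \<open>Standard embeddings\<close>

text \<open>
  The track of the base point is constant, so the conjugation that relates the two ends of the
  homotopy is trivial.\<close>

lemma (in free_action) equivariant_deformation_trivial:
  fixes H :: "real \<times> (complex^'n) \<Rightarrow> complex^'n"
  assumes H: "continuous_on ({0..1} \<times> S) H" "\<And>s x. \<lbrakk>s \<in> {0..1}; x \<in> S\<rbrakk> \<Longrightarrow> H (s, x) \<in> S"
      "\<And>s g x. \<lbrakk>s \<in> {0..1}; g \<in> G; x \<in> S\<rbrakk> \<Longrightarrow> H (s, g *v x) = g *v H (s, x)"
      "\<And>x. x \<in> S \<Longrightarrow> H (0, x) = x" "\<And>x. H (1, x) = F x" "\<And>s. s \<in> {0..1} \<Longrightarrow> H (s, z) = z"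
    and z: "z \<in> S" and c: "c \<in> carrier (fundamental_group (orbit_space G S) (mat_orbit G z))"
  shows "pi1_map (orbit_space G S) (orbit_induced G F) c = c"
proof -
  interpret P: free_action_pair G S G S by unfold_locales simp
  let ?T = "orbit_space G S"
  have arr: "is_arrow ?T c" using c by (simp add: carrier_fundamental_group)
  have \<pi>z: "mat_orbit G z \<in> topspace ?T" using z by (auto simp: topspace_orbit_space)
  have eqv: "P.equivariant_map (\<lambda>x. H (0, x))"
    unfolding P.equivariant_map_def
    by (auto simp: H(4) stable intro!: continuous_on_compose2[OF H(1)] continuous_intros)
  have id: "continuous_map ?T ?T (\<lambda>x. x)" by simp
  have ind0: "orbit_induced G (\<lambda>x. H (0, x)) Q = Q" if "Q \<in> topspace ?T" for Q
    using that P.orbit_induced_orbit[OF eqv] H(4) by (auto simp: topspace_orbit_space)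
  have "pi1_map ?T (orbit_induced G (\<lambda>x. H (0, x))) c = pi1_map ?T (\<lambda>x. x) c"
    by (rule pi1_map_cong[OF P.continuous_map_orbit_induced[OF eqv] ind0 arr])
  also have "\<dots> = c" using arr by (auto elim!: arrow_cases simp: pi1_map_class[OF id] o_def)
  finally have 0: "pi1_map ?T (orbit_induced G (\<lambda>x. H (0, x))) c = c" .
  have "homotopy_class ?T (\<lambda>s. mat_orbit G (H (s, z))) = punit ?T (mat_orbit G z)"
    unfolding punit_def using H(6) \<pi>z by (intro homotopy_class_cong[symmetric]) (auto simp: pathin_const_iff)
  then have "pi1_map ?T (orbit_induced G (\<lambda>x. H (1, x))) c = pconj ?T (punit ?T (mat_orbit G z)) c"
    using P.braid_hom_homotopy[OF H(1-3) z c] 0 by simp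
  then show ?thesis using pconj_punit[OF c] by (simp add: H(5))
qed

lemma path_from_to_iff:
  "path_from_to S a b p \<longleftrightarrow> pathin (top_of_set S) p \<and> p 0 = a \<and> p 1 = b"
  by (auto simp: path_from_to_def pathin_top_of_set pathstart_def pathfinish_def)

context parabolic_pair
begin

text \<open>The straight-line homotopy from the identity to \<open>retract h \<rho> v\<close>. It moves points along rays from
  \<open>v\<close> with positive ratio at most \<open>1\<close>, so it preserves \<open>X'\<close> and also the part of \<open>X\<close> in the ball.\<close>

definition retract_homotopy :: "(complex^'n \<Rightarrow> complex^'n \<Rightarrow> complex) \<Rightarrow> real \<Rightarrow> complex^'n \<Rightarrow> real \<times> (complex^'n) \<Rightarrow> complex^'n" where
  "retract_homotopy h \<rho> v = (\<lambda>(s, x). radial v ((1 - s) + s * shrink h \<rho> v x) x)"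

lemma retract_homotopy_coefficient:
  assumes "0 < \<rho>" "s \<in> {0..1}"
  shows "0 < (1 - s) + s * shrink h \<rho> v x" "(1 - s) + s * shrink h \<rho> v x \<le> 1"
proof -
  note b = shrink_bounds[OF assms(1), of h v x]
  show "0 < (1 - s) + s * shrink h \<rho> v x"
  proof (cases "s = 1")
    case False
    then have "0 < 1 - s" "0 \<le> s * shrink h \<rho> v x" using assms(2) b by auto
    then show ?thesis by linarith
  qed (use b in simp)
  have "s * shrink h \<rho> v x \<le> s * 1" using assms(2) b by (intro mult_left_mono) auto
  then show "(1 - s) + s * shrink h \<rho> v x \<le> 1" by simp
qed

lemma retract_homotopy_properties:
  assumes d: "small_data v h r" and \<rho>: "0 < \<rho>" "\<rho> < r"
  shows "continuous_on A (retract_homotopy h \<rho> v)"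
    "\<And>s x. \<lbrakk>s \<in> {0..1}; x \<in> X'\<rbrakk> \<Longrightarrow> retract_homotopy h \<rho> v (s, x) \<in> X'"
    "\<And>s x. \<lbrakk>s \<in> {0..1}; x \<in> hermitian_ball h v r \<inter> X\<rbrakk> \<Longrightarrow> retract_homotopy h \<rho> v (s, x) \<in> hermitian_ball h v r \<inter> X"
    "\<And>s g x. g \<in> W' \<Longrightarrow> retract_homotopy h \<rho> v (s, g *v x) = g *v retract_homotopy h \<rho> v (s, x)"
    "\<And>x. retract_homotopy h \<rho> v (0, x) = x" "\<And>x. retract_homotopy h \<rho> v (1, x) = retract h \<rho> v x"
    "\<And>s x. hnorm h (x - v) \<le> \<rho> \<Longrightarrow> retract_homotopy h \<rho> v (s, x) = x"
proof -
  note D = small_dataD[OF d]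
  note coeff = retract_homotopy_coefficient[OF \<rho>(1), of _ h v]
  show "continuous_on A (retract_homotopy h \<rho> v)"
    unfolding retract_homotopy_def case_prod_unfold
    by (intro continuous_intros continuous_shrink[OF D(3) \<rho>(1)])
  show X': "retract_homotopy h \<rho> v (s, x) \<in> X'" if "s \<in> {0..1}" "x \<in> X'" for s x
    using radial_X'[OF D(2) coeff(1)[OF that(1)] that(2)] by (simp add: retract_homotopy_def)
  show "retract_homotopy h \<rho> v (s, x) \<in> hermitian_ball h v r \<inter> X"
    if s: "s \<in> {0..1}" and x: "x \<in> hermitian_ball h v r \<inter> X" for s x
  proof -
    let ?c = "(1 - s) + s * shrink h \<rho> v x"
    have "hnorm h (radial v ?c x - v) = ?c * hnorm h (x - v)"
      using coeff(1)[OF s, of x] by (intro hnorm_radial[OF D(3)]) simp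
    also have "\<dots> \<le> 1 * hnorm h (x - v)"
      using coeff(2)[OF s] hnorm_nonneg[OF D(3)] by (intro mult_right_mono)
    also have "\<dots> < r" using x by (simp add: hermitian_ball_iff)
    finally have ball: "retract_homotopy h \<rho> v (s, x) \<in> hermitian_ball h v r"
      by (simp add: hermitian_ball_iff retract_homotopy_def)
    moreover have "x \<in> X'" using x X_subset by blast
    ultimately show ?thesis using ball_X[OF d] X'[OF s] by blast
  qed
  show "retract_homotopy h \<rho> v (s, g *v x) = g *v retract_homotopy h \<rho> v (s, x)" if "g \<in> W'" for s g x
    unfolding retract_homotopy_def case_prod_conv shrink_invariant[OF D(5) that D(2)]
    by (rule radial_equivariant[OF D(2) that])
  show "retract_homotopy h \<rho> v (0, x) = x" "retract_homotopy h \<rho> v (1, x) = retract h \<rho> v x" for x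
    by (simp_all add: retract_homotopy_def retract_def)
  show "retract_homotopy h \<rho> v (s, x) = x" if "hnorm h (x - v) \<le> \<rho>" for s x
    by (simp add: retract_homotopy_def shrink_eq_1[OF \<rho>(1) that])
qed

lemma braid_hom_reflects:
  assumes d: "small_data v h r" and \<rho>: "0 < \<rho>" "\<rho> < r" and y: "y \<in> X'" and x: "x \<in> X"
    and m: "pathin (top_of_set X) m" "m 0 = retract h \<rho> v y" "m 1 = x"
    and c: "c \<in> carrier (pair.\<pi>B' y)"
  shows "pair.braid_hom (retract h \<rho> v) m c \<in> derived (pair.\<pi>B x) (pair.pure_at x) \<longleftrightarrow>
    c \<in> derived (pair.\<pi>B' y) (pair.pure_at' y)"
proof
  note eqv = retract_equivariant_map[OF d \<rho>]
  let ?H = "\<lambda>(s, x). retract_homotopy h \<rho> v (1 - s, x)"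
  assume a: "pair.braid_hom (retract h \<rho> v) m c \<in> derived (pair.\<pi>B x) (pair.pure_at x)"
  show "c \<in> derived (pair.\<pi>B' y) (pair.pure_at' y)"
  proof (rule pair.braid_hom_reflects_derived[OF eqv y x m X_subset _ _ _ _ c a, where H = ?H])
    show "continuous_on ({0..1} \<times> X') ?H"
      unfolding case_prod_unfold
      by (intro continuous_on_compose2[OF retract_homotopy_properties(1)[OF d \<rho>, of UNIV]] continuous_intros) auto
  qed (use retract_homotopy_properties[OF d \<rho>] in auto)
next
  assume "c \<in> derived (pair.\<pi>B' y) (pair.pure_at' y)"
  then show "pair.braid_hom (retract h \<rho> v) m c \<in> derived (pair.\<pi>B x) (pair.pure_at x)"
    by (rule pair.braid_hom_derived[OF retract_equivariant_map[OF d \<rho>] y x m])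
qed

text \<open>
  The radius \<open>\<rho>\<close> is chosen with the base point \<open>z\<close> inside, so that the contraction fixes \<open>z\<close>. Up to
  homotopies that fix \<open>z\<close>, the contraction is inverse to the inclusion of the orbits of the ball into
  those of \<open>X'\<close>. This proves that \<open>local_to_parabolic\<close> is bijective. It also identifies \<open>local_to_global\<close>,
  precomposed with the inverse, with \<open>braid_hom\<close> of the contraction. The base points are connected by
  \<open>m\<close>: back along the contracted path \<open>d\<close> from the image of \<open>y\<close> to \<open>z\<close>, and on along \<open>g\<close> to \<open>x\<close>.\<close>

lemma standard_embedding_is_braid_hom:
  assumes std: "standard_embedding W x W' y \<iota>"
  obtains v h r \<rho> m where "small_data v h r" "0 < \<rho>" "\<rho> < r"
    "pathin (top_of_set X) m" "m 0 = retract h \<rho> v y" "m 1 = x"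
    "\<And>c. c \<in> carrier (pair.\<pi>B' y) \<Longrightarrow> \<iota> c = pair.braid_hom (retract h \<rho> v) m c"
proof -
  obtain \<Omega> z d g where \<Omega>: "small_ball W W' \<Omega>" and z: "z \<in> \<Omega> \<inter> X"
    and "path_from_to X' z y d" "path_from_to X z x g"
    and \<iota>: "\<iota> = local_to_global W g \<circ> inv_into (carrier (local_braid_group W W' \<Omega> z)) (local_to_parabolic W' d)"
    using std unfolding standard_embedding_def by blast
  then have d: "pathin (top_of_set X') d" "d 0 = z" "d 1 = y"
    and g: "pathin (top_of_set X) g" "g 0 = z" "g 1 = x"
    by (simp_all add: path_from_to_iff)
  obtain v h r where data: "small_data v h r" and \<Omega>_eq: "\<Omega> = hermitian_ball h v r"
    using small_ball_data[OF \<Omega>] by metis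
  note D = small_dataD[OF data]
  define \<rho> where "\<rho> = (hnorm h (z - v) + r) / 2"
  have \<rho>: "0 < \<rho>" "\<rho> < r" and z\<rho>: "hnorm h (z - v) \<le> \<rho>"
    using z D(4) hnorm_nonneg[OF D(3), of "z - v"] by (auto simp: \<rho>_def \<Omega>_eq hermitian_ball_iff)
  let ?F = "retract h \<rho> v" and ?H = "retract_homotopy h \<rho> v"
  note RH = retract_homotopy_properties[OF data \<rho>]
  note eqv = retract_equivariant_map[OF data \<rho>]
  have \<Omega>X_sub: "\<Omega> \<inter> X \<subseteq> X'" using X_subset by blast
  interpret loc: free_action W' "\<Omega> \<inter> X"
  proof
    show "g *v x \<in> \<Omega> \<inter> X" if g: "g \<in> W'" and x: "x \<in> \<Omega> \<inter> X" for g x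
      using hnorm_invariant[OF D(5) g D(2), of x] x W.hyperplane_complement_stable W'_sub g
      by (auto simp: \<Omega>_eq hermitian_ball_iff)
    show "g = mat 1" if "g \<in> W'" "x \<in> \<Omega> \<inter> X" "g *v x = x" for g x
      using free_W'.free that \<Omega>X_sub by blast
  qed
  interpret up: free_action_pair W' X' W' "\<Omega> \<inter> X" by unfold_locales simp
  interpret out: free_action_pair W' "\<Omega> \<inter> X" W X by unfold_locales (rule W'_sub)
  let ?T = "orbit_space W X" and ?T' = "orbit_space W' X'" and ?Tl = "orbit_space W' (\<Omega> \<inter> X)"
  let ?l = "carrier (local_braid_group W W' \<Omega> z)"
  have l_def: "?l = carrier (fundamental_group ?Tl (mat_orbit W' z))"
    by (simp add: local_braid_group_def)
  have z': "z \<in> X'" using z \<Omega>X_sub by blast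
  have Fz: "?F z = z" using RH(6)[of z] RH(7)[OF z\<rho>, of 1] by simp
  have F_up: "up.equivariant_map ?F"
    unfolding up.equivariant_map_def
    using continuous_retract[OF data \<rho>(1)] retract_in_ball[OF data \<rho>] retract_X[OF data \<rho>]
      retract_equivariant[OF data] \<Omega>_eq by blast
  have inc: "continuous_map ?Tl ?T' id"
  proof (rule continuous_map_from_orbit_space)
    show "continuous_map (top_of_set (\<Omega> \<inter> X)) ?T' (id \<circ> mat_orbit W')"
      using continuous_map_from_subtopology_mono[OF continuous_map_orbit \<Omega>X_sub] by simp
  qed
  note contF = up.continuous_map_orbit_induced[OF F_up]
  have inc_arrow: "pi1_map ?T' id c \<in> carrier (pair.\<pi>B' z)" if "c \<in> ?l" for c
    using that pi1_map_arrow[OF inc, of c] unfolding l_def carrier_fundamental_group by simp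
  have F_arrow: "pi1_map ?Tl (orbit_induced W' ?F) c \<in> ?l" if "c \<in> carrier (pair.\<pi>B' z)" for c
    using that pi1_map_arrow[OF contF, of c] up.orbit_induced_orbit[OF F_up z'] Fz
    unfolding l_def carrier_fundamental_group by simp
  have inv1: "pi1_map ?Tl (orbit_induced W' ?F) (pi1_map ?T' id c) = c" if c: "c \<in> ?l" for c
  proof -
    have "is_arrow ?Tl c" using c unfolding l_def carrier_fundamental_group by simp
    from pi1_map_comp[OF inc contF this]
    have "pi1_map ?Tl (orbit_induced W' ?F) (pi1_map ?T' id c) = pi1_map ?Tl (orbit_induced W' ?F) c" by simp
    also have "\<dots> = c"
      by (rule loc.equivariant_deformation_trivial[OF RH(1) _ _ _ RH(6) _ z c[unfolded l_def]])
        (use RH(3-5,7) z\<rho> \<Omega>_eq in auto)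
    finally show ?thesis .
  qed
  have inv2: "pi1_map ?T' id (pi1_map ?Tl (orbit_induced W' ?F) c) = c" if c: "c \<in> carrier (pair.\<pi>B' z)" for c
  proof -
    have "is_arrow ?T' c" using c unfolding carrier_fundamental_group by simp
    from pi1_map_comp[OF contF inc this]
    have "pi1_map ?T' id (pi1_map ?Tl (orbit_induced W' ?F) c) = pi1_map ?T' (orbit_induced W' ?F) c" by simp
    also have "\<dots> = c"
      by (rule free_W'.equivariant_deformation_trivial[OF RH(1) _ _ _ RH(6) _ z' c])
        (use RH(2,4,5,7) z\<rho> in auto)
    finally show ?thesis .
  qed
  have bij1: "bij_betw (pi1_map ?T' id) ?l (carrier (pair.\<pi>B' z))"
    using inv1 inv2 inc_arrow F_arrow
    by (intro bij_betw_byWitness[where f' = "pi1_map ?Tl (orbit_induced W' ?F)"]) auto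
  note \<pi>d = pathin_comp[OF d(1) continuous_map_orbit[of X' W']]
  have l2p: "local_to_parabolic W' d c = pconj ?T' (homotopy_class ?T' (mat_orbit W' \<circ> d)) (pi1_map ?T' id c)"
    if "c \<in> ?l" for c
  proof -
    have "local_to_parabolic W' d c = pi1_transport ?T' (mat_orbit W' \<circ> d) (pi1_map ?T' id c)"
      by (simp add: local_to_parabolic_def Let_def)
    also have "\<dots> = pconj ?T' (homotopy_class ?T' (mat_orbit W' \<circ> d)) (pi1_map ?T' id c)"
      using inc_arrow[OF that] d(2) by (intro pi1_transport_eq_pconj[OF \<pi>d]) simp
    finally show ?thesis .
  qed
  have "bij_betw (pconj ?T' (homotopy_class ?T' (mat_orbit W' \<circ> d))) (carrier (pair.\<pi>B' z)) (carrier (pair.\<pi>B' y))"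
    using pconj_bij[OF is_arrow_class[OF \<pi>d]] \<pi>d d(2,3) by simp
  from bij_betw_trans[OF bij1 this]
  have bij: "bij_betw (local_to_parabolic W' d) ?l (carrier (pair.\<pi>B' y))"
    by (rule bij_betw_cong[THEN iffD1, rotated]) (simp add: l2p)
  define m where "m = path_concat (path_reverse (?F \<circ> d)) g"
  have Fd: "pathin (top_of_set X) (?F \<circ> d)"
    using d(1) pair.equivariant_mapD(4)[OF eqv] by (rule pathin_comp)
  have m: "pathin (top_of_set X) m" "m 0 = ?F y" "m 1 = x"
    unfolding m_def using Fd g d Fz by (auto intro!: pathin_concat pathin_reverse)
  note \<pi>cont = continuous_map_orbit[of X W]
  note ps = pathin_comp[OF Fd \<pi>cont] pathin_comp[OF g(1) \<pi>cont] pathin_comp[OF m(1) \<pi>cont]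
  let ?Fd = "homotopy_class ?T (mat_orbit W \<circ> (?F \<circ> d))" and ?g = "homotopy_class ?T (mat_orbit W \<circ> g)"
    and ?m = "homotopy_class ?T (mat_orbit W \<circ> m)"
  have "?m = pmul ?T (pinv ?T ?Fd) ?g"
    unfolding m_def comp_path_concat comp_path_reverse using ps d g Fz
    by (simp add: pinv_class pmul_class pathin_reverse)
  then have Fdm: "pmul ?T ?Fd ?m = ?g" using ps d g Fz by simp
  note contFG = pair.continuous_map_orbit_induced[OF eqv]
  have key: "pair.braid_hom ?F m (local_to_parabolic W' d c) = local_to_global W g c" if c: "c \<in> ?l" for c
  proof -
    have arr: "is_arrow ?Tl c" using c unfolding l_def carrier_fundamental_group by simp
    have id_eqv: "out.equivariant_map (\<lambda>x. x)" by (auto simp: out.equivariant_map_def)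
    let ?c = "pi1_map ?T (orbit_coarsen W) c"
    have co: "?c \<in> carrier (pair.\<pi>B z)"
      unfolding orbit_coarsen_eq
      using c pi1_map_arrow[OF out.continuous_map_orbit_induced[OF id_eqv], of c]
        out.orbit_induced_orbit[OF id_eqv z]
      unfolding l_def carrier_fundamental_group by simp
    have "pi1_map ?T (orbit_induced W ?F) (pi1_map ?T' id c) = pi1_map ?T (orbit_induced W ?F) c"
      using pi1_map_comp[OF inc contFG arr] by simp
    also have "\<dots> = ?c"
    proof -
      have "pi1_map ?T (orbit_induced W (\<lambda>x. ?H (1, x))) c =
          pconj ?T (homotopy_class ?T (\<lambda>s. mat_orbit W (?H (s, z)))) (pi1_map ?T (orbit_induced W (\<lambda>x. ?H (0, x))) c)"
        by (rule out.braid_hom_homotopy[OF RH(1) _ _ z c[unfolded l_def]])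
          (use RH(3,4) \<Omega>_eq in auto)
      moreover have "homotopy_class ?T (\<lambda>s. mat_orbit W (?H (s, z))) = punit ?T (mat_orbit W z)"
        unfolding punit_def RH(7)[OF z\<rho>] ..
      ultimately show ?thesis
        unfolding RH(5,6) orbit_coarsen_eq[symmetric] using pconj_punit[OF co] by simp
    qed
    finally have c_eq: "pi1_map ?T (orbit_induced W ?F) (pi1_map ?T' id c) = ?c" .
    have "pair.braid_hom ?F m (local_to_parabolic W' d c) =
        pconj ?T ?m (pi1_map ?T (orbit_induced W ?F) (pconj ?T' (homotopy_class ?T' (mat_orbit W' \<circ> d)) (pi1_map ?T' id c)))"
      unfolding pair.braid_hom_def l2p[OF c] ..
    also have "\<dots> = pconj ?T ?m (pconj ?T ?Fd ?c)"
      using inc_arrow[OF c] d(2) \<pi>d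
      by (subst pi1_map_pconj[OF contFG is_arrow_class[OF \<pi>d]])
        (simp_all add: pair.pi1_map_orbit_induced[OF eqv d(1)] c_eq)
    also have "\<dots> = pconj ?T (pmul ?T ?Fd ?m) ?c"
      using ps d m co Fz by (intro pconj_pconj) simp_all
    also have "\<dots> = pi1_transport ?T (mat_orbit W \<circ> g) ?c"
      unfolding Fdm using co g(2) by (intro pi1_transport_eq_pconj[OF ps(2), symmetric]) simp
    finally show ?thesis by (simp add: local_to_global_def Let_def)
  qed
  have "\<iota> b = pair.braid_hom ?F m b" if b: "b \<in> carrier (pair.\<pi>B' y)" for b
  proof -
    let ?c = "inv_into ?l (local_to_parabolic W' d) b"
    have b': "b \<in> local_to_parabolic W' d ` ?l" using bij b by (simp add: bij_betw_def)
    have "?c \<in> ?l" using b' by (rule inv_into_into)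
    from key[OF this] show ?thesis
      unfolding \<iota> comp_apply using f_inv_into_f[OF b'] by simp
  qed
  then show ?thesis using that data \<rho> m by blast
qed

lemma standard_embedding_exists:
  assumes x: "x \<in> X" and y: "y \<in> X'"
  shows "\<exists>\<iota>. standard_embedding W x W' y \<iota>"
proof -
  obtain v where "v \<in> generic" using generic_nonempty by blast
  then obtain h r where data: "small_data v h r" and ball: "small_ball W W' (hermitian_ball h v r)"
    using small_data_exists by metis
  define z where "z = retract h (r / 2) v x"
  have r: "0 < r / 2" "r / 2 < r" using small_dataD(4)[OF data] by auto
  have z: "z \<in> hermitian_ball h v r \<inter> X"
    using retract_in_ball[OF data r] retract_X[OF data r] x X_subset by (auto simp: z_def)
  have "path_connected X'" "path_connected X"
    using path_connected_hyperplane_complement W.finite_G W'.finite_G by blast+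
  moreover have "z \<in> X'" using z X_subset by blast
  ultimately obtain d g where "path_from_to X' z y d" "path_from_to X z x g"
    using x y z unfolding path_connected_def path_from_to_def by blast
  then show ?thesis unfolding standard_embedding_def using ball z by blast
qed

text \<open>
  Two equivariant maps induce the same homomorphism up to conjugation by pure braids, whatever paths
  connect the images of \<open>y\<close> to \<open>x\<close>. Quantifying over the paths makes the relation transitive, as any
  path can be used for the map in the middle.\<close>

definition conjugate_homs :: "complex^'n \<Rightarrow> complex^'n \<Rightarrow> (complex^'n \<Rightarrow> complex^'n) \<Rightarrow> (complex^'n \<Rightarrow> complex^'n) \<Rightarrow> bool" where
  "conjugate_homs x y F F' \<longleftrightarrow> (\<forall>m m'. pathin (top_of_set X) m \<and> m 0 = F y \<and> m 1 = x \<and>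
     pathin (top_of_set X) m' \<and> m' 0 = F' y \<and> m' 1 = x \<longrightarrow>
     (\<exists>\<gamma>\<in>pair.pure_at x. \<forall>c\<in>carrier (pair.\<pi>B' y).
       pair.braid_hom F' m' c = pconj pair.TB \<gamma> (pair.braid_hom F m c)))"

lemma conjugate_homs_trans:
  assumes x: "x \<in> X" and y: "y \<in> X'" and F: "pair.equivariant_map F" and F': "F' y \<in> X"
    and 1: "conjugate_homs x y F F'" and 2: "conjugate_homs x y F' F''"
  shows "conjugate_homs x y F F''"
  unfolding conjugate_homs_def
proof (intro allI impI, elim conjE)
  fix m m''
  assume m: "pathin (top_of_set X) m" "m 0 = F y" "m 1 = x"
    and m'': "pathin (top_of_set X) m''" "m'' 0 = F'' y" "m'' 1 = x"
  have "path_connected X" using path_connected_hyperplane_complement W.finite_G by blast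
  then obtain m' where "path_from_to X (F' y) x m'"
    using x F' unfolding path_connected_def path_from_to_def by blast
  then have m': "pathin (top_of_set X) m'" "m' 0 = F' y" "m' 1 = x" by (simp_all add: path_from_to_iff)
  obtain \<gamma> where \<gamma>: "\<gamma> \<in> pair.pure_at x" "\<And>c. c \<in> carrier (pair.\<pi>B' y) \<Longrightarrow>
      pair.braid_hom F' m' c = pconj pair.TB \<gamma> (pair.braid_hom F m c)"
    using 1 m m' unfolding conjugate_homs_def by blast
  obtain \<delta> where \<delta>: "\<delta> \<in> pair.pure_at x" "\<And>c. c \<in> carrier (pair.\<pi>B' y) \<Longrightarrow>
      pair.braid_hom F'' m'' c = pconj pair.TB \<delta> (pair.braid_hom F' m' c)"
    using 2 m'' m' unfolding conjugate_homs_def by blast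
  have sub: "subgroup (pair.pure_at x) (pair.\<pi>B x)"
    using pair.pure_at_normal[OF x] by (simp add: normal_def)
  have "\<gamma> \<in> carrier (pair.\<pi>B x)" "\<delta> \<in> carrier (pair.\<pi>B x)"
    using subgroup.subset[OF sub] \<gamma>(1) \<delta>(1) by auto
  then have arr: "is_arrow pair.TB \<gamma>" "psrc \<gamma> = mat_orbit W x" "ptgt \<gamma> = mat_orbit W x"
    "is_arrow pair.TB \<delta>" "psrc \<delta> = mat_orbit W x"
    by (simp_all add: carrier_fundamental_group)
  interpret hom: group_hom "pair.\<pi>B' y" "pair.\<pi>B x" "pair.braid_hom F m"
    by (rule pair.braid_hom_group_hom[OF F y m])
  show "\<exists>\<gamma>\<in>pair.pure_at x. \<forall>c\<in>carrier (pair.\<pi>B' y).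
      pair.braid_hom F'' m'' c = pconj pair.TB \<gamma> (pair.braid_hom F m c)"
  proof (intro bexI[of _ "pmul pair.TB \<gamma> \<delta>"] ballI)
    show "pmul pair.TB \<gamma> \<delta> \<in> pair.pure_at x"
      using subgroup.m_closed[OF sub \<gamma>(1) \<delta>(1)] by simp
    show "pair.braid_hom F'' m'' c = pconj pair.TB (pmul pair.TB \<gamma> \<delta>) (pair.braid_hom F m c)"
      if c: "c \<in> carrier (pair.\<pi>B' y)" for c
      using \<gamma>(2)[OF c] \<delta>(2)[OF c] arr hom.hom_closed[OF c]
      by (simp add: pconj_pconj)
  qed
qed

lemma conjugate_homs_radial:
  fixes u :: "real \<Rightarrow> complex^'n" and \<sigma> :: "real \<times> (complex^'n) \<Rightarrow> real"
  assumes y: "y \<in> X'"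
    and u: "continuous_on {0..1} u" "\<And>s. s \<in> {0..1} \<Longrightarrow> u s \<in> fixed_space"
    and \<sigma>: "continuous_on ({0..1} \<times> X') \<sigma>" "\<And>s x. \<lbrakk>s \<in> {0..1}; x \<in> X'\<rbrakk> \<Longrightarrow> 0 < \<sigma> (s, x)"
      "\<And>s w x. \<lbrakk>s \<in> {0..1}; x \<in> X'; w \<in> W'\<rbrakk> \<Longrightarrow> \<sigma> (s, w *v x) = \<sigma> (s, x)"
    and avoid: "\<And>s x H. \<lbrakk>s \<in> {0..1}; x \<in> X'; H \<in> reflecting_hyperplanes W; H \<notin> reflecting_hyperplanes W'\<rbrakk> \<Longrightarrow>
      radial (u s) (\<sigma> (s, x)) x \<notin> H"
    and F: "\<And>x. F x = radial (u 0) (\<sigma> (0, x)) x" "\<And>x. F' x = radial (u 1) (\<sigma> (1, x)) x"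
  shows "conjugate_homs x y F F'"
proof -
  define H where "H p = radial (u (fst p)) (\<sigma> p) (snd p)" for p
  have cont: "continuous_on ({0..1} \<times> X') H"
    unfolding H_def by (intro continuous_intros \<sigma>(1) continuous_on_compose2[OF u(1)]) auto
  have mem: "H (s, x) \<in> X" if "s \<in> {0..1}" "x \<in> X'" for s x
    unfolding H_def using radial_X[OF u(2)[OF that(1)] \<sigma>(2)[OF that] that(2)] avoid[OF that] by simp
  have eqv: "H (s, w *v x) = w *v H (s, x)" if "s \<in> {0..1}" "w \<in> W'" "x \<in> X'" for s w x
    unfolding H_def using \<sigma>(3)[OF that(1,3,2)] radial_equivariant[OF u(2)[OF that(1)] that(2)] by simp
  have F_H: "F = (\<lambda>x. H (0, x))" "F' = (\<lambda>x. H (1, x))" by (auto simp: H_def F)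
  show ?thesis
    unfolding conjugate_homs_def F_H
    by (intro allI impI, elim conjE)
      (rule pair.braid_hom_conjugate[where H = H and y = y, OF cont mem eqv y]; assumption)
qed

text \<open>Interpolate the ratios: each interpolated point lies on the segment between two points of the ball, and
  inside the ball only hyperplanes of \<open>W'\<close> have to be avoided.\<close>

lemma conjugate_homs_same_center:
  assumes d: "small_data v h r" and y: "y \<in> X'"
    and \<sigma>: "continuous_on X' \<sigma>" "\<And>x. x \<in> X' \<Longrightarrow> 0 < \<sigma> x" "\<And>w x. w \<in> W' \<Longrightarrow> \<sigma> (w *v x) = \<sigma> x"
      "\<And>x. x \<in> X' \<Longrightarrow> hnorm h (radial v (\<sigma> x) x - v) < r"
    and \<tau>: "continuous_on X' \<tau>" "\<And>x. x \<in> X' \<Longrightarrow> 0 < \<tau> x" "\<And>w x. w \<in> W' \<Longrightarrow> \<tau> (w *v x) = \<tau> x"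
      "\<And>x. x \<in> X' \<Longrightarrow> hnorm h (radial v (\<tau> x) x - v) < r"
  shows "conjugate_homs x y (\<lambda>x. radial v (\<sigma> x) x) (\<lambda>x. radial v (\<tau> x) x)"
proof (rule conjugate_homs_radial[OF y, where u = "\<lambda>s. v" and \<sigma> = "\<lambda>(s, x). (1 - s) * \<sigma> x + s * \<tau> x"])
  note D = small_dataD[OF d]
  have pos: "0 < (1 - s) * \<sigma> x + s * \<tau> x" if s: "s \<in> {0..1}" and x: "x \<in> X'" for s x
  proof (cases "s = 0")
    case False
    then have "0 \<le> (1 - s) * \<sigma> x" "0 < s * \<tau> x" using s \<sigma>(2)[OF x] \<tau>(2)[OF x] by auto
    then show ?thesis by linarith
  qed (use \<sigma>(2)[OF x] in simp)
  show "continuous_on ({0..1} \<times> X') (\<lambda>(s, x). (1 - s) * \<sigma> x + s * \<tau> x)"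
    unfolding case_prod_unfold
    by (intro continuous_intros continuous_on_compose2[OF \<sigma>(1)] continuous_on_compose2[OF \<tau>(1)]) auto
  show "0 < (case (s, x) of (s, x) \<Rightarrow> (1 - s) * \<sigma> x + s * \<tau> x)" if "s \<in> {0..1}" "x \<in> X'" for s x
    using pos[OF that] by simp
  show "radial v (case (s, x) of (s, x) \<Rightarrow> (1 - s) * \<sigma> x + s * \<tau> x) x \<notin> H"
    if s: "s \<in> {0..1}" and x: "x \<in> X'" and H: "H \<in> reflecting_hyperplanes W" "H \<notin> reflecting_hyperplanes W'" for s x H
  proof -
    let ?c = "(1 - s) * \<sigma> x + s * \<tau> x"
    have lt: "\<sigma> x * hnorm h (x - v) < r" "\<tau> x * hnorm h (x - v) < r"
      using \<sigma>(4)[OF x] \<tau>(4)[OF x] \<sigma>(2)[OF x] \<tau>(2)[OF x] by (simp_all add: hnorm_radial[OF D(3)])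
    have "hnorm h (radial v ?c x - v) = ?c * hnorm h (x - v)"
      using pos[OF s x] by (intro hnorm_radial[OF D(3)]) simp
    also have "\<dots> = (1 - s) * (\<sigma> x * hnorm h (x - v)) + s * (\<tau> x * hnorm h (x - v))"
      by (simp add: algebra_simps)
    also have "\<dots> < r" using s lt by (intro convex_bound_lt) auto
    finally show ?thesis using D(6)[OF H(1)] H(2) by auto
  qed
qed (use small_dataD(2)[OF d] \<sigma>(3) \<tau>(3) in auto)

text \<open>Move the centre from \<open>v\<^sub>1\<close> to \<open>v\<^sub>2\<close> along a path of points with stabiliser \<open>W'\<close>. The path is compact
  and avoids the hyperplanes outside \<open>W'\<close>, so for small \<open>\<epsilon>\<close> the contractions to the balls of radius \<open>\<epsilon>\<close>
  about its points all have values in \<open>X\<close>; here the norm is that of \<open>h\<^sub>1\<close> throughout. Before and after,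
  the centre is kept and the ratio is changed: at \<open>v\<^sub>1\<close> from \<open>\<rho>\<^sub>1\<close> to \<open>\<epsilon>\<close>, and at \<open>v\<^sub>2\<close> to the norm of
  \<open>h\<^sub>2\<close> and the radius \<open>\<rho>\<^sub>2\<close>.\<close>

lemma conjugate_homs_retract:
  assumes d1: "small_data v\<^sub>1 h\<^sub>1 r\<^sub>1" and \<rho>1: "0 < \<rho>\<^sub>1" "\<rho>\<^sub>1 < r\<^sub>1"
    and d2: "small_data v\<^sub>2 h\<^sub>2 r\<^sub>2" and \<rho>2: "0 < \<rho>\<^sub>2" "\<rho>\<^sub>2 < r\<^sub>2"
    and x: "x \<in> X" and y: "y \<in> X'"
  shows "conjugate_homs x y (retract h\<^sub>1 \<rho>\<^sub>1 v\<^sub>1) (retract h\<^sub>2 \<rho>\<^sub>2 v\<^sub>2)"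
proof -
  note D1 = small_dataD[OF d1] and D2 = small_dataD[OF d2]
  obtain u where u: "path u" "path_image u \<subseteq> generic" "pathstart u = v\<^sub>1" "pathfinish u = v\<^sub>2"
    using generic_path_connected D1(1) D2(1) unfolding path_connected_def by blast
  have u_gen: "u s \<in> generic" if "s \<in> {0..1}" for s
    using u(2) that by (auto simp: path_image_def)
  have u01: "u 0 = v\<^sub>1" "u 1 = v\<^sub>2" using u(3,4) by (simp_all add: pathstart_def pathfinish_def)
  let ?A = "\<Union>(reflecting_hyperplanes W - reflecting_hyperplanes W')"
  have "closed ?A"
    using finite_reflecting_hyperplanes[OF W.finite_G] reflecting_hyperplane_subspace subspace_closed_complex
    by (intro closed_Union) auto
  moreover have "path_image u \<inter> ?A = {}"
    using u(2) generic_in_hyperplane by blast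
  ultimately obtain d where d: "d > 0" "\<And>p q. p \<in> path_image u \<Longrightarrow> q \<in> ?A \<Longrightarrow> d \<le> dist p q"
    using separate_compact_closed[OF compact_path_image[OF u(1)]] by metis
  obtain \<epsilon>1 where \<epsilon>1: "\<epsilon>1 > 0" "\<And>y. hnorm h\<^sub>1 y \<le> \<epsilon>1 \<Longrightarrow> norm y < d"
    using norm_small_if_hnorm_small[OF D1(3) d(1)] by metis
  have "v\<^sub>2 \<in> hermitian_ball h\<^sub>2 v\<^sub>2 r\<^sub>2" using D2(4) by (simp add: hermitian_ball_iff hnorm_zero[OF D2(3)])
  then obtain \<delta> where \<delta>: "\<delta> > 0" "ball v\<^sub>2 \<delta> \<subseteq> hermitian_ball h\<^sub>2 v\<^sub>2 r\<^sub>2"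
    using open_hermitian_ball[OF D2(3)] by (meson open_contains_ball)
  obtain \<epsilon>2 where \<epsilon>2: "\<epsilon>2 > 0" "\<And>y. hnorm h\<^sub>1 y \<le> \<epsilon>2 \<Longrightarrow> norm y < \<delta>"
    using norm_small_if_hnorm_small[OF D1(3) \<delta>(1)] by metis
  define \<epsilon> where "\<epsilon> = min (min \<epsilon>1 \<epsilon>2) (r\<^sub>1 / 2)"
  have \<epsilon>: "0 < \<epsilon>" "\<epsilon> \<le> \<epsilon>1" "\<epsilon> \<le> \<epsilon>2" "\<epsilon> < r\<^sub>1"
    using \<epsilon>1(1) \<epsilon>2(1) D1(4) by (auto simp: \<epsilon>_def)
  have le: "hnorm h\<^sub>1 (radial v (shrink h\<^sub>1 c v x) x - v) \<le> c" if "0 < c" for c v x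
    using shrink_mult_le[OF D1(3) that, of v x] hnorm_radial[OF D1(3) less_imp_le[OF shrink_bounds(1)[OF that, of h\<^sub>1 v x]], of v x] by simp
  have le2: "hnorm h\<^sub>2 (radial v (shrink h\<^sub>2 c v x) x - v) \<le> c" if "0 < c" for c v x
    using shrink_mult_le[OF D2(3) that, of v x] hnorm_radial[OF D2(3) less_imp_le[OF shrink_bounds(1)[OF that, of h\<^sub>2 v x]], of v x] by simp
  have avoid: "radial (u s) (shrink h\<^sub>1 \<epsilon> (u s) x) x \<notin> H"
    if s: "s \<in> {0..1}" and H: "H \<in> reflecting_hyperplanes W" "H \<notin> reflecting_hyperplanes W'" for s x H
  proof
    let ?q = "radial (u s) (shrink h\<^sub>1 \<epsilon> (u s) x) x"
    assume "?q \<in> H"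
    then have "d \<le> dist (u s) ?q" using H s by (intro d(2)) (auto simp: path_image_def)
    moreover have "norm (?q - u s) < d" using le[OF \<epsilon>(1), of "u s" x] \<epsilon>(2) by (intro \<epsilon>1(2)) linarith
    ultimately show False by (simp add: dist_norm norm_minus_commute)
  qed
  have A: "conjugate_homs x y (retract h\<^sub>1 \<rho>\<^sub>1 v\<^sub>1) (retract h\<^sub>1 \<epsilon> v\<^sub>1)"
    unfolding retract_def
  proof (rule conjugate_homs_same_center[OF d1 y])
    show "continuous_on X' (shrink h\<^sub>1 \<rho>\<^sub>1 v\<^sub>1)"
      by (rule continuous_shrink[OF D1(3) \<rho>1(1) continuous_on_const continuous_on_id])
    show "0 < shrink h\<^sub>1 \<rho>\<^sub>1 v\<^sub>1 x" for x by (rule shrink_bounds(1)[OF \<rho>1(1)])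
    show "shrink h\<^sub>1 \<rho>\<^sub>1 v\<^sub>1 (w *v x) = shrink h\<^sub>1 \<rho>\<^sub>1 v\<^sub>1 x" if "w \<in> W'" for w x
      by (rule shrink_invariant[OF D1(5) that D1(2)])
    show "hnorm h\<^sub>1 (radial v\<^sub>1 (shrink h\<^sub>1 \<rho>\<^sub>1 v\<^sub>1 x) x - v\<^sub>1) < r\<^sub>1" for x
      using le[OF \<rho>1(1), of v\<^sub>1 x] \<rho>1(2) by simp
    show "continuous_on X' (shrink h\<^sub>1 \<epsilon> v\<^sub>1)"
      by (rule continuous_shrink[OF D1(3) \<epsilon>(1) continuous_on_const continuous_on_id])
    show "0 < shrink h\<^sub>1 \<epsilon> v\<^sub>1 x" for x by (rule shrink_bounds(1)[OF \<epsilon>(1)])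
    show "shrink h\<^sub>1 \<epsilon> v\<^sub>1 (w *v x) = shrink h\<^sub>1 \<epsilon> v\<^sub>1 x" if "w \<in> W'" for w x
      by (rule shrink_invariant[OF D1(5) that D1(2)])
    show "hnorm h\<^sub>1 (radial v\<^sub>1 (shrink h\<^sub>1 \<epsilon> v\<^sub>1 x) x - v\<^sub>1) < r\<^sub>1" for x
      using le[OF \<epsilon>(1), of v\<^sub>1 x] \<epsilon>(4) by simp
  qed
  have B: "conjugate_homs x y (retract h\<^sub>1 \<epsilon> v\<^sub>1) (retract h\<^sub>1 \<epsilon> v\<^sub>2)"
  proof (rule conjugate_homs_radial[OF y, where u = u and \<sigma> = "\<lambda>(s, x). shrink h\<^sub>1 \<epsilon> (u s) x"])
    show cont_u: "continuous_on {0..1} u" using u(1) by (simp add: path_def)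
    have "continuous_on ({0..1} \<times> X') (\<lambda>z. u (fst z))"
      by (rule continuous_on_compose2[OF cont_u continuous_on_fst[OF continuous_on_id]]) auto
    from continuous_shrink[OF D1(3) \<epsilon>(1) this continuous_on_snd[OF continuous_on_id]]
    show "continuous_on ({0..1} \<times> X') (\<lambda>(s, x). shrink h\<^sub>1 \<epsilon> (u s) x)"
      by (simp add: case_prod_unfold)
    show u_fixed: "u s \<in> fixed_space" if "s \<in> {0..1}" for s using generic_fixed_space[OF u_gen[OF that]] .
    show "(case (s, w *v x) of (s, x) \<Rightarrow> shrink h\<^sub>1 \<epsilon> (u s) x) = (case (s, x) of (s, x) \<Rightarrow> shrink h\<^sub>1 \<epsilon> (u s) x)"
      if "s \<in> {0..1}" "w \<in> W'" for s w x
      using shrink_invariant[OF D1(5) that(2) u_fixed[OF that(1)]] by simp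
    show "radial (u s) (case (s, x) of (s, x) \<Rightarrow> shrink h\<^sub>1 \<epsilon> (u s) x) x \<notin> H"
      if "s \<in> {0..1}" "H \<in> reflecting_hyperplanes W" "H \<notin> reflecting_hyperplanes W'" for s x H
      using avoid[OF that] by simp
  qed (simp_all add: shrink_bounds(1)[OF \<epsilon>(1)] retract_def u01)
  have small2: "hnorm h\<^sub>2 (radial v\<^sub>2 (shrink h\<^sub>1 \<epsilon> v\<^sub>2 x) x - v\<^sub>2) < r\<^sub>2" for x
  proof -
    let ?q = "radial v\<^sub>2 (shrink h\<^sub>1 \<epsilon> v\<^sub>2 x) x"
    have "norm (?q - v\<^sub>2) < \<delta>" using le[OF \<epsilon>(1), of v\<^sub>2 x] \<epsilon>(3) by (intro \<epsilon>2(2)) linarith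
    then have "?q \<in> ball v\<^sub>2 \<delta>" by (simp add: dist_norm norm_minus_commute)
    then show ?thesis using \<delta>(2) by (auto simp: hermitian_ball_iff)
  qed
  have C: "conjugate_homs x y (retract h\<^sub>1 \<epsilon> v\<^sub>2) (retract h\<^sub>2 \<rho>\<^sub>2 v\<^sub>2)"
    unfolding retract_def
  proof (rule conjugate_homs_same_center[OF d2 y])
    show "continuous_on X' (shrink h\<^sub>1 \<epsilon> v\<^sub>2)"
      by (rule continuous_shrink[OF D1(3) \<epsilon>(1) continuous_on_const continuous_on_id])
    show "0 < shrink h\<^sub>1 \<epsilon> v\<^sub>2 x" for x by (rule shrink_bounds(1)[OF \<epsilon>(1)])
    show "shrink h\<^sub>1 \<epsilon> v\<^sub>2 (w *v x) = shrink h\<^sub>1 \<epsilon> v\<^sub>2 x" if "w \<in> W'" for w x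
      by (rule shrink_invariant[OF D1(5) that D2(2)])
    show "hnorm h\<^sub>2 (radial v\<^sub>2 (shrink h\<^sub>1 \<epsilon> v\<^sub>2 x) x - v\<^sub>2) < r\<^sub>2" for x
      by (rule small2)
    show "continuous_on X' (shrink h\<^sub>2 \<rho>\<^sub>2 v\<^sub>2)"
      by (rule continuous_shrink[OF D2(3) \<rho>2(1) continuous_on_const continuous_on_id])
    show "0 < shrink h\<^sub>2 \<rho>\<^sub>2 v\<^sub>2 x" for x by (rule shrink_bounds(1)[OF \<rho>2(1)])
    show "shrink h\<^sub>2 \<rho>\<^sub>2 v\<^sub>2 (w *v x) = shrink h\<^sub>2 \<rho>\<^sub>2 v\<^sub>2 x" if "w \<in> W'" for w x
      by (rule shrink_invariant[OF D2(5) that D2(2)])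
    show "hnorm h\<^sub>2 (radial v\<^sub>2 (shrink h\<^sub>2 \<rho>\<^sub>2 v\<^sub>2 x) x - v\<^sub>2) < r\<^sub>2" for x
      using le2[OF \<rho>2(1), of v\<^sub>2 x] \<rho>2(2) by simp
  qed
  have X1: "retract h\<^sub>1 \<epsilon> v\<^sub>1 y \<in> X" using retract_X[OF d1 \<epsilon>(1,4) y] .
  have X2: "retract h\<^sub>1 \<epsilon> v\<^sub>2 y \<in> X"
    unfolding retract_def using avoid[of 1] u01
    by (intro radial_X D2(2) shrink_bounds(1) \<epsilon>(1) y) auto
  note F1 = retract_equivariant_map[OF d1 \<rho>1]
  show ?thesis
    by (rule conjugate_homs_trans[OF x y F1 X2 conjugate_homs_trans[OF x y F1 X1 A B] C])
qed

lemma braid_group_eq: "braid_group W x = pair.\<pi>B x" "braid_group W' y = pair.\<pi>B' y"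
  by (simp_all add: braid_group_def)

lemma pure_braids_eq: "pure_braids W x = pair.pure_at x" "pure_braids W' y = pair.pure_at' y"
  by (simp_all add: pure_braids_def pure_braid_group_def pair.pure_at_def pair.pure_at'_def)

lemma pure_commutators_normal:
  assumes "x \<in> X" "y \<in> X'"
  shows "pure_commutators W x \<lhd> pair.\<pi>B x" "pure_commutators W' y \<lhd> pair.\<pi>B' y"
proof -
  interpret small: free_action_pair W' X' W' X' by unfold_locales simp
  have "group (pair.\<pi>B x)" "group (pair.\<pi>B' y)"
    using assms pair.base_in_topspace by (auto intro: group_fundamental_group)
  then show "pure_commutators W x \<lhd> pair.\<pi>B x" "pure_commutators W' y \<lhd> pair.\<pi>B' y"
    using group.derived_is_normal pair.pure_at_normal[OF assms(1)] small.pure_at_normal[OF assms(2)]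
    unfolding pure_commutators_def braid_group_eq pure_braids_eq small.pure_at_def pair.pure_at'_def
    by blast+
qed

lemma standard_embedding_induces_injection:
  assumes x: "x \<in> X" and y: "y \<in> X'" and \<iota>: "standard_embedding W x W' y \<iota>"
  shows "\<exists>f. induced_on_quotients W x W' y \<iota> f \<and>
    group_hom (braid_quotient W' y) (braid_quotient W x) f \<and> inj_on f (carrier (braid_quotient W' y))"
proof -
  obtain v h r \<rho> m where d: "small_data v h r" and \<rho>: "0 < \<rho>" "\<rho> < r"
    and m: "pathin (top_of_set X) m" "m 0 = retract h \<rho> v y" "m 1 = x"
    and eq: "\<And>c. c \<in> carrier (pair.\<pi>B' y) \<Longrightarrow> \<iota> c = pair.braid_hom (retract h \<rho> v) m c"
    using standard_embedding_is_braid_hom[OF \<iota>] by metis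
  obtain f where f: "\<And>c. c \<in> carrier (pair.\<pi>B' y) \<Longrightarrow>
      f (pure_commutators W' y #>\<^bsub>pair.\<pi>B' y\<^esub> c) = pure_commutators W x #>\<^bsub>pair.\<pi>B x\<^esub> pair.braid_hom (retract h \<rho> v) m c"
    "group_hom (pair.\<pi>B' y Mod pure_commutators W' y) (pair.\<pi>B x Mod pure_commutators W x) f"
    "inj_on f (carrier (pair.\<pi>B' y Mod pure_commutators W' y))"
  proof (rule group_hom_on_quotients[OF pair.braid_hom_group_hom[OF retract_equivariant_map[OF d \<rho>] y m]
          pure_commutators_normal(2,1)[OF x y]])
    show "pair.braid_hom (retract h \<rho> v) m c \<in> pure_commutators W x \<longleftrightarrow> c \<in> pure_commutators W' y"
      if "c \<in> carrier (pair.\<pi>B' y)" for c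
      unfolding pure_commutators_def braid_group_eq pure_braids_eq
      by (rule braid_hom_reflects[OF d \<rho> y x m that])
  qed (rule that; blast)
  then show ?thesis
    unfolding induced_on_quotients_def braid_quotient_proj_def braid_quotient_def braid_group_eq
    using eq by (intro exI[of _ f]) simp
qed

lemma standard_embeddings_conjugate:
  assumes x: "x \<in> X" and y: "y \<in> X'"
    and \<iota>: "standard_embedding W x W' y \<iota>" "standard_embedding W x W' y \<iota>'"
  obtains \<gamma> where "\<gamma> \<in> pair.pure_at x"
    "\<And>c. c \<in> carrier (pair.\<pi>B' y) \<Longrightarrow> \<iota> c \<in> carrier (pair.\<pi>B x) \<and> \<iota>' c = pconj pair.TB \<gamma> (\<iota> c)"
proof -
  obtain v h r \<rho> m where d: "small_data v h r" and \<rho>: "0 < \<rho>" "\<rho> < r"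
    and m: "pathin (top_of_set X) m" "m 0 = retract h \<rho> v y" "m 1 = x"
    and eq: "\<And>c. c \<in> carrier (pair.\<pi>B' y) \<Longrightarrow> \<iota> c = pair.braid_hom (retract h \<rho> v) m c"
    using standard_embedding_is_braid_hom[OF \<iota>(1)] by metis
  obtain v' h' r' \<rho>' m' where d': "small_data v' h' r'" and \<rho>': "0 < \<rho>'" "\<rho>' < r'"
    and m': "pathin (top_of_set X) m'" "m' 0 = retract h' \<rho>' v' y" "m' 1 = x"
    and eq': "\<And>c. c \<in> carrier (pair.\<pi>B' y) \<Longrightarrow> \<iota>' c = pair.braid_hom (retract h' \<rho>' v') m' c"
    using standard_embedding_is_braid_hom[OF \<iota>(2)] by metis
  obtain \<gamma> where "\<gamma> \<in> pair.pure_at x" "\<forall>c\<in>carrier (pair.\<pi>B' y).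
      pair.braid_hom (retract h' \<rho>' v') m' c = pconj pair.TB \<gamma> (pair.braid_hom (retract h \<rho> v) m c)"
    using conjugate_homs_retract[OF d \<rho> d' \<rho>' x y] m m' unfolding conjugate_homs_def by blast
  moreover have "\<iota> c \<in> carrier (pair.\<pi>B x)" if "c \<in> carrier (pair.\<pi>B' y)" for c
    using group_hom.hom_closed[OF pair.braid_hom_group_hom[OF retract_equivariant_map[OF d \<rho>] y m] that] eq[OF that]
    by simp
  ultimately show ?thesis using that eq eq' by simp
qed

end

theorem proposition2p4:
  fixes W W' :: "(complex^'n^'n) set" and x y :: "complex^'n"
  assumes "complex_reflection_group W"
    and "parabolic_subgroup W' W"
    and "x \<in> hyperplane_complement W"
    and "y \<in> hyperplane_complement W'"
  shows "(\<exists>\<iota>. standard_embedding W x W' y \<iota>) \<and>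
    (\<forall>\<iota>. standard_embedding W x W' y \<iota> \<longrightarrow>
       (\<exists>f. induced_on_quotients W x W' y \<iota> f \<and>
            group_hom (braid_quotient W' y) (braid_quotient W x) f \<and>
            inj_on f (carrier (braid_quotient W' y)))) \<and>
    (\<forall>\<iota>\<^sub>1 \<iota>\<^sub>2 f\<^sub>1 f\<^sub>2.
       standard_embedding W x W' y \<iota>\<^sub>1 \<and> induced_on_quotients W x W' y \<iota>\<^sub>1 f\<^sub>1 \<and>
       standard_embedding W x W' y \<iota>\<^sub>2 \<and> induced_on_quotients W x W' y \<iota>\<^sub>2 f\<^sub>2 \<longrightarrow>
       (\<exists>p\<in>pure_braid_ab W x. \<forall>c\<in>carrier (braid_quotient W' y).
          f\<^sub>2 c = p \<otimes>\<^bsub>braid_quotient W x\<^esub> f\<^sub>1 c \<otimes>\<^bsub>braid_quotient W x\<^esub> inv\<^bsub>braid_quotient W x\<^esub> p))"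
proof -
  interpret parabolic_pair W W' by unfold_locales (fact assms)+
  note x = assms(3) and y = assms(4)
  interpret N: normal "pure_commutators W x" "pair.\<pi>B x" by (rule pure_commutators_normal(1)[OF x y])
  let ?B = "pair.\<pi>B x" and ?Q = "braid_quotient W x" and ?q = "braid_quotient_proj W x"
  have Q: "?Q = ?B Mod pure_commutators W x" by (simp add: braid_quotient_def braid_group_eq)
  interpret q: group_hom ?B ?Q ?q
  proof -
    have "?q \<in> hom ?B ?Q"
      using N.r_coset_hom_Mod by (simp add: Q braid_quotient_proj_def[abs_def] braid_group_eq)
    then show "group_hom ?B ?Q ?q"
      using N.factorgroup_is_group N.is_group by (simp add: group_hom_def group_hom_axioms_def Q)
  qed
  have "\<exists>p\<in>pure_braid_ab W x. \<forall>c\<in>carrier (braid_quotient W' y).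
      f\<^sub>2 c = p \<otimes>\<^bsub>?Q\<^esub> f\<^sub>1 c \<otimes>\<^bsub>?Q\<^esub> inv\<^bsub>?Q\<^esub> p"
    if \<iota>: "standard_embedding W x W' y \<iota>\<^sub>1" "standard_embedding W x W' y \<iota>\<^sub>2"
      and f: "induced_on_quotients W x W' y \<iota>\<^sub>1 f\<^sub>1" "induced_on_quotients W x W' y \<iota>\<^sub>2 f\<^sub>2" for \<iota>\<^sub>1 \<iota>\<^sub>2 f\<^sub>1 f\<^sub>2
  proof -
    obtain \<gamma> where \<gamma>: "\<gamma> \<in> pair.pure_at x" "\<And>c. c \<in> carrier (pair.\<pi>B' y) \<Longrightarrow>
        \<iota>\<^sub>1 c \<in> carrier ?B \<and> \<iota>\<^sub>2 c = pconj pair.TB \<gamma> (\<iota>\<^sub>1 c)"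
      using standard_embeddings_conjugate[OF x y \<iota>] by metis
    have sub: "subgroup (pair.pure_at x) ?B" using pair.pure_at_normal[OF x] by (simp add: normal_def)
    have \<gamma>B: "\<gamma> \<in> carrier ?B" using subgroup.subset[OF sub] \<gamma>(1) by blast
    \<comment> \<open>Change of base point along \<open>\<gamma>\<close> is conjugation by its inverse.\<close>
    let ?p = "?q (inv\<^bsub>?B\<^esub> \<gamma>)"
    have "?p \<in> pure_braid_ab W x"
      unfolding pure_braid_ab_def pure_braids_eq using subgroup.m_inv_closed[OF sub \<gamma>(1)] by (rule imageI)
    moreover have "f\<^sub>2 c = ?p \<otimes>\<^bsub>?Q\<^esub> f\<^sub>1 c \<otimes>\<^bsub>?Q\<^esub> inv\<^bsub>?Q\<^esub> ?p" if c: "c \<in> carrier (braid_quotient W' y)" for c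
    proof -
      obtain b where b: "b \<in> carrier (pair.\<pi>B' y)" "c = braid_quotient_proj W' y b"
        using c unfolding braid_quotient_def braid_quotient_proj_def braid_group_eq
        by (auto simp: FactGroup_def RCOSETS_def)
      have f_eq: "f\<^sub>1 c = ?q (\<iota>\<^sub>1 b)" "f\<^sub>2 c = ?q (\<iota>\<^sub>2 b)"
        using f b unfolding induced_on_quotients_def braid_group_eq by auto
      have i1: "\<iota>\<^sub>1 b \<in> carrier ?B" using \<gamma>(2)[OF b(1)] by simp
      have "\<iota>\<^sub>2 b = inv\<^bsub>?B\<^esub> \<gamma> \<otimes>\<^bsub>?B\<^esub> (\<iota>\<^sub>1 b \<otimes>\<^bsub>?B\<^esub> \<gamma>)"
        using \<gamma>(2)[OF b(1)] by (simp add: pconj_def inv_fundamental_group[OF \<gamma>B])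
      also have "\<dots> = inv\<^bsub>?B\<^esub> \<gamma> \<otimes>\<^bsub>?B\<^esub> \<iota>\<^sub>1 b \<otimes>\<^bsub>?B\<^esub> \<gamma>"
        using i1 \<gamma>B by (intro N.m_assoc[symmetric] N.inv_closed)
      finally have "?q (\<iota>\<^sub>2 b) = ?p \<otimes>\<^bsub>?Q\<^esub> ?q (\<iota>\<^sub>1 b) \<otimes>\<^bsub>?Q\<^esub> ?q \<gamma>"
        using i1 \<gamma>B by (simp only: q.hom_mult N.inv_closed N.m_closed)
      moreover have "?q \<gamma> = inv\<^bsub>?Q\<^esub> ?p"
        using \<gamma>B q.H.inv_inv[OF q.hom_closed[OF \<gamma>B]] by (simp only: q.hom_inv)
      ultimately show ?thesis unfolding f_eq by simp
    qed
    ultimately show ?thesis by blast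
  qed
  then show ?thesis
    using standard_embedding_exists[OF x y] standard_embedding_induces_injection[OF x y] by blast
qed

end
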